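(* Let $F: \mathbb{R}^m \to \mathbb{R}^n$ be a bounded (possibly discontinuous) semialgebraic function. Then there exist $\mathcal{N} \in ISDnet(m,n,1)$ and $c_{\max} \ge 0$ such that $\mathrm{SANN}^{lim}(\mathcal{N}, x, c_{\max}) = F(x)$ for all $x\in\mathbb{R}^m$.
   Context: For $D \subseteq \mathbb{R}^N$, $ISD(D)$ is the smallest set of functions $D \to \mathbb{R}$ containing all restrictions of real polynomials and closed under pointwise $\min$ and $\max$; vector/matrix-valued functions are ISD if all entries are. $ISDnet(m,n,k) := ISD(\mathbb{R}^m\times\mathbb{R}^{n+k}\times\mathbb{R},\ \mathbb{R}^{(n+k)\times(n+k)}\times\mathbb{R}^{n+k})$; for $\mathcal N$ in it write $\mathcal N(x,z,s) = (M(x,z,s), b(x,z,s))$. For $c\ge 0$, $\mathrm{clamp\text{-}sol}_c(M,b) := \mathrm{clamp}(M^{-1}b,-c,c)$ if $M$ is invertible and $0$ otherwise, with clamp applied componentwise ($a_i\mapsto\min(\max(a_i,-c),c)$). $\mathrm{SANN}^{lim}(\mathcal N,x,c_{\max})$ is the vector of the first $n$ components of $z(1)$, where $z:[0,1]\to\mathbb{R}^{n+k}$ is the (exact) solution of $\dot z(s) = \mathrm{clamp\text{-}sol}_{c_{\max}}(M(x,z(s),s), b(x,z(s),s))$, $z(0)=0$. A semialgebraic function is one whose graph is a semialgebraic set. *)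

theory Defs
  imports "HOL-Analysis.Analysis"
begin

(* Points of R^N are represented as real lists of length N. *)

(* Real polynomial functions R^N -> R (as functions on lists; only lists of length N matter) *)
inductive poly_fun :: "nat \<Rightarrow> (real list \<Rightarrow> real) \<Rightarrow> bool" for N where
  pf_const: "poly_fun N (\<lambda>xs. c)"
| pf_proj: "i < N \<Longrightarrow> poly_fun N (\<lambda>xs. xs ! i)"
| pf_add: "poly_fun N p \<Longrightarrow> poly_fun N q \<Longrightarrow> poly_fun N (\<lambda>xs. p xs + q xs)"
| pf_mult: "poly_fun N p \<Longrightarrow> poly_fun N q \<Longrightarrow> poly_fun N (\<lambda>xs. p xs * q xs)"

inductive isd_gen :: "nat \<Rightarrow> (real list \<Rightarrow> real) \<Rightarrow> bool" for N where
  isd_poly: "poly_fun N p \<Longrightarrow> isd_gen N p"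
| isd_min: "isd_gen N f \<Longrightarrow> isd_gen N g \<Longrightarrow> isd_gen N (\<lambda>xs. min (f xs) (g xs))"
| isd_max: "isd_gen N f \<Longrightarrow> isd_gen N g \<Longrightarrow> isd_gen N (\<lambda>xs. max (f xs) (g xs))"

definition ISD :: "nat \<Rightarrow> (real list \<Rightarrow> real) \<Rightarrow> bool" where
  "ISD N f \<longleftrightarrow> (\<exists>g. isd_gen N g \<and> (\<forall>xs. length xs = N \<longrightarrow> f xs = g xs))"

(* ISDnet(m,n,k): matrix entries Mf i j and vector entries bf i (i,j < n+k) are ISD functions
   of the concatenated input x @ z @ [s] \<in> R^m \<times> R^(n+k) \<times> R *)
definition ISDnet :: "nat \<Rightarrow> nat \<Rightarrow> nat \<Rightarrow>
    (nat \<Rightarrow> nat \<Rightarrow> real list \<Rightarrow> real) \<Rightarrow> (nat \<Rightarrow> real list \<Rightarrow> real) \<Rightarrow> bool" where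
  "ISDnet m n k Mf bf \<longleftrightarrow>
     (\<forall>i < n + k. \<forall>j < n + k. ISD (m + (n + k) + 1) (Mf i j)) \<and>
     (\<forall>i < n + k. ISD (m + (n + k) + 1) (bf i))"

inductive semialg_set :: "nat \<Rightarrow> real list set \<Rightarrow> bool" for N where
  sa_basic: "poly_fun N p \<Longrightarrow> semialg_set N {xs. length xs = N \<and> p xs > 0}"
| sa_compl: "semialg_set N S \<Longrightarrow> semialg_set N ({xs. length xs = N} - S)"
| sa_union: "semialg_set N S \<Longrightarrow> semialg_set N T \<Longrightarrow> semialg_set N (S \<union> T)"
| sa_inter: "semialg_set N S \<Longrightarrow> semialg_set N T \<Longrightarrow> semialg_set N (S \<inter> T)"

definition semialg_fun :: "nat \<Rightarrow> nat \<Rightarrow> (real list \<Rightarrow> real list) \<Rightarrow> bool" where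
  "semialg_fun m n F \<longleftrightarrow>
     (\<forall>x. length x = m \<longrightarrow> length (F x) = n) \<and>
     semialg_set (m + n) {x @ F x | x. length x = m}"

definition bounded_fun :: "nat \<Rightarrow> nat \<Rightarrow> (real list \<Rightarrow> real list) \<Rightarrow> bool" where
  "bounded_fun m n F \<longleftrightarrow> (\<exists>B. \<forall>x. length x = m \<longrightarrow> (\<forall>i < n. \<bar>F x ! i\<bar> \<le> B))"

definition mat_invertible :: "nat \<Rightarrow> (nat \<Rightarrow> nat \<Rightarrow> real) \<Rightarrow> bool" where
  "mat_invertible d M \<longleftrightarrow> (\<exists>A. \<forall>i < d. \<forall>j < d.
      (\<Sum>l<d. M i l * A l j) = (if i = j then 1 else 0) \<and>
      (\<Sum>l<d. A i l * M l j) = (if i = j then 1 else 0))"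

definition mat_inv :: "nat \<Rightarrow> (nat \<Rightarrow> nat \<Rightarrow> real) \<Rightarrow> (nat \<Rightarrow> nat \<Rightarrow> real)" where
  "mat_inv d M = (THE A. (\<forall>i j. (i \<ge> d \<or> j \<ge> d) \<longrightarrow> A i j = 0) \<and> (\<forall>i < d. \<forall>j < d.
      (\<Sum>l<d. M i l * A l j) = (if i = j then 1 else 0) \<and>
      (\<Sum>l<d. A i l * M l j) = (if i = j then 1 else 0)))"

definition clamp :: "real \<Rightarrow> real \<Rightarrow> real" where
  "clamp c a = min (max a (- c)) c"

definition clamp_sol :: "real \<Rightarrow> nat \<Rightarrow> (nat \<Rightarrow> nat \<Rightarrow> real) \<Rightarrow> (nat \<Rightarrow> real) \<Rightarrow> real list" where
  "clamp_sol c d M b =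
     (if mat_invertible d M
      then map (\<lambda>i. clamp c (\<Sum>j<d. mat_inv d M i j * b j)) [0..<d]
      else replicate d 0)"

definition SANN_solution :: "nat \<Rightarrow> nat \<Rightarrow> nat \<Rightarrow>
    (nat \<Rightarrow> nat \<Rightarrow> real list \<Rightarrow> real) \<Rightarrow> (nat \<Rightarrow> real list \<Rightarrow> real) \<Rightarrow>
    real list \<Rightarrow> real \<Rightarrow> (real \<Rightarrow> real list) \<Rightarrow> bool" where
  "SANN_solution m n k Mf bf x c z \<longleftrightarrow>
     (\<forall>s \<in> {0..1}. length (z s) = n + k) \<and>
     z 0 = replicate (n + k) 0 \<and>
     (\<forall>s \<in> {0..1}. \<forall>i < n + k.
        ((\<lambda>t. z t ! i) has_real_derivative
           (clamp_sol c (n + k) (\<lambda>a b. Mf a b (x @ z s @ [s])) (\<lambda>a. bf a (x @ z s @ [s])) ! i))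
        (at s within {0..1}))"

definition SANN_lim_eq :: "nat \<Rightarrow> nat \<Rightarrow> nat \<Rightarrow>
    (nat \<Rightarrow> nat \<Rightarrow> real list \<Rightarrow> real) \<Rightarrow> (nat \<Rightarrow> real list \<Rightarrow> real) \<Rightarrow>
    real list \<Rightarrow> real \<Rightarrow> real list \<Rightarrow> bool" where
  "SANN_lim_eq m n k Mf bf x c v \<longleftrightarrow>
     (\<exists>z. SANN_solution m n k Mf bf x c z) \<and>
     (\<forall>z. SANN_solution m n k Mf bf x c z \<longrightarrow> take n (z 1) = v)"

end

theory Submission
  imports Defs
begin

text \<open>
  The matrix is a scalar multiple of the identity, so the velocity is \<open>b\<^sub>i / d\<close> (and \<open>0\<close> where
  \<open>d = 0\<close>), and the time interval is cut into phases in each of which a single component moves.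

  A quotient \<open>max g 0 / max g 0\<close> is the indicator of \<open>g > 0\<close>. Hence the extra component can compute
  an integer code of the signs at \<open>x\<close> of finitely many polynomials. By Tarski--Seidenberg these can
  be chosen such that the code determines the signs at \<open>y = F x ! i\<close> of a finite family of polynomials
  in \<open>(x, y)\<close> which is closed under \<open>y\<close>-derivatives and contains a nonzero one vanishing at \<open>F x ! i\<close>.
  By Thom's lemma the total violation \<open>q\<close> of these sign conditions is an ISD function of
  \<open>x\<close>, \<open>y\<close> and the code that vanishes only at \<open>y = F x ! i\<close>.

  It remains to move \<open>y\<close> upwards from \<open>A = - B\<close> so that it stops at the zero \<open>f\<close> of \<open>q\<close>,
  differentiably, with bounded speed, and within a time that does not depend on \<open>x\<close>. This is done by
  \<open>y' = q y / (q y + w\<^sup>K)\<close> with the slack \<open>w = max 0 (y - A + 1 - t)\<close>. As \<open>w' = y' - 1\<close>, the slack is used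
  up while \<open>q y\<close> is small compared with it, and \<open>y\<close> moves otherwise. Both run out simultaneously, at
  time \<open>t = f - A + 1\<close>. If \<open>K\<close> exceeds the order of vanishing of \<open>q\<close> at \<open>f\<close>, then \<open>y\<close> arrives
  with speed \<open>0\<close>.
\<close>

section \<open>Polynomials with the same signs along the line\<close>

text \<open>A finite set \<open>Z\<close> cuts the line into its points and the open intervals between them. These cells
  are numbered from left to right, so that the points of \<open>Z\<close> get the odd numbers.\<close>

definition cell_index :: "real set \<Rightarrow> real \<Rightarrow> nat" where
  "cell_index Z y = card {z \<in> Z. z < y} + card {z \<in> Z. z \<le> y}"

lemma mono_cell_index: "finite Z \<Longrightarrow> mono (cell_index Z)"
  unfolding cell_index_def by (intro monoI add_mono card_mono) auto

lemma cell_index_less_imp_less: "finite Z \<Longrightarrow> cell_index Z s < cell_index Z t \<Longrightarrow> s < t"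
  using mono_cell_index by (metis monoD not_le)

lemma odd_cell_index_iff: "finite Z \<Longrightarrow> odd (cell_index Z y) \<longleftrightarrow> y \<in> Z"
proof -
  assume fin: "finite Z"
  have "{z \<in> Z. z \<le> y} = (if y \<in> Z then insert y {z \<in> Z. z < y} else {z \<in> Z. z < y})"
    by (auto simp: less_le)
  then show ?thesis using fin by (simp add: cell_index_def)
qed

lemma cell_index_eq_iff:
  assumes fin: "finite Z" and "s < t"
  shows "cell_index Z s = cell_index Z t \<longleftrightarrow> Z \<inter> {s..t} = {}"
proof
  assume "Z \<inter> {s..t} = {}"
  then have "{z \<in> Z. z < s} = {z \<in> Z. z < t}" "{z \<in> Z. z \<le> s} = {z \<in> Z. z \<le> t}"
    using \<open>s < t\<close> by (auto simp: disjoint_iff)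
  then show "cell_index Z s = cell_index Z t" by (simp add: cell_index_def)
next
  assume eq: "cell_index Z s = cell_index Z t"
  have "card {z \<in> Z. z < s} \<le> card {z \<in> Z. z < t}" "card {z \<in> Z. z \<le> s} \<le> card {z \<in> Z. z \<le> t}"
    using fin \<open>s < t\<close> by (auto intro!: card_mono)
  then have "card {z \<in> Z. z < s} = card {z \<in> Z. z < t}" "card {z \<in> Z. z \<le> s} = card {z \<in> Z. z \<le> t}"
    using eq by (auto simp: cell_index_def)
  moreover have "{z \<in> Z. z < s} \<subseteq> {z \<in> Z. z < t}" "{z \<in> Z. z \<le> s} \<subseteq> {z \<in> Z. z \<le> t}"
    using \<open>s < t\<close> by auto
  ultimately have "{z \<in> Z. z < s} = {z \<in> Z. z < t}" "{z \<in> Z. z \<le> s} = {z \<in> Z. z \<le> t}"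
    using fin by (simp_all add: card_subset_eq)
  then have "(z < s \<longleftrightarrow> z < t) \<and> (z \<le> s \<longleftrightarrow> z \<le> t)" if "z \<in> Z" for z
    using that by blast
  then have "\<not> (s \<le> z \<and> z \<le> t)" if "z \<in> Z" for z
    using that \<open>s < t\<close> by (metis le_less not_le order_less_imp_le)
  then show "Z \<inter> {s..t} = {}" by auto
qed

lemma cell_index_eq_iff_segment:
  assumes "finite Z" "s \<noteq> t"
  shows "cell_index Z s = cell_index Z t \<longleftrightarrow> Z \<inter> closed_segment s t = {}"
  using assms cell_index_eq_iff[of Z s t] cell_index_eq_iff[of Z t s]
  by (cases s t rule: linorder_cases) (auto simp: closed_segment_eq_real_ivl)

lemma cell_index_eq_imp_eq:
  "finite Z \<Longrightarrow> y \<in> Z \<Longrightarrow> cell_index Z y = cell_index Z t \<Longrightarrow> t = y"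
  using cell_index_eq_iff_segment[of Z y t] by (auto simp: disjoint_iff)

lemma cell_index_next:
  assumes "finite Z" "y \<notin> Z" "r \<in> Z" "y < r" "Z \<inter> {y<..<r} = {}"
  shows "cell_index Z r = Suc (cell_index Z y)"
proof -
  have "{z \<in> Z. z < r} = {z \<in> Z. z < y}" "{z \<in> Z. z \<le> r} = insert r {z \<in> Z. z \<le> y}"
    using assms by (auto simp: disjoint_iff not_less le_less)
  then show ?thesis using assms(1,4) by (simp add: cell_index_def)
qed

lemma cell_index_uminus:
  assumes "finite Z" shows "cell_index (uminus ` Z) y + cell_index Z (- y) = 2 * card Z"
proof -
  have "card {z \<in> uminus ` Z. P z} = card {z \<in> Z. P (- z)}" for P
    by (rule bij_betw_same_card[OF bij_betwI[of uminus _ _ uminus]]) auto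
  moreover have "card {z \<in> Z. \<not> P z} = card Z - card {z \<in> Z. P z}" "card {z \<in> Z. P z} \<le> card Z" for P
  proof -
    have "{z \<in> Z. \<not> P z} = Z - {z \<in> Z. P z}" by auto
    then show "card {z \<in> Z. \<not> P z} = card Z - card {z \<in> Z. P z}" using assms
      by (simp add: card_Diff_subset)
  qed (use assms in \<open>auto intro: card_mono\<close>)
  from this[of "\<lambda>z. z < - y"] this[of "\<lambda>z. z \<le> - y"]
  have "card {z \<in> Z. - y \<le> z} + card {z \<in> Z. z < - y} = card Z"
    "card {z \<in> Z. - y < z} + card {z \<in> Z. z \<le> - y} = card Z" by (simp_all add: not_less not_le)
  ultimately show ?thesis by (simp add: cell_index_def minus_less_iff[of _ y] minus_le_iff[of _ y])
qed

lemma cell_index_mono_image: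
  fixes i :: "real \<Rightarrow> real"
  assumes i: "mono i" and fin: "finite Z" and saturated: "\<And>y t. y \<in> Z \<Longrightarrow> i t = i y \<Longrightarrow> t \<in> Z"
  shows "cell_index Z y = card {l \<in> i ` Z. l < i y} + card {l \<in> i ` Z. l \<le> i y}"
proof -
  have fiber: "t = y" if "y \<in> Z" "i t = i y" for y t
  proof (rule ccontr)
    assume "t \<noteq> y"
    have "closed_segment t y \<subseteq> Z"
    proof
      fix u assume "u \<in> closed_segment t y"
      then have "i (min t y) \<le> i u" "i u \<le> i (max t y)"
        using i by (auto simp: mono_def closed_segment_eq_real_ivl split: if_splits)
      then have "i u = i y" using that(2) by (auto simp: min_def max_def split: if_splits)
      then show "u \<in> Z" using saturated that(1) by blast
    qed
    moreover have "infinite (closed_segment t y)"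
      using \<open>t \<noteq> y\<close> by (auto simp: closed_segment_eq_real_ivl infinite_Icc_iff)
    ultimately show False using fin finite_subset by blast
  qed
  have order: "(z < y \<longleftrightarrow> i z < i y) \<and> (z \<le> y \<longleftrightarrow> i z \<le> i y)" if "z \<in> Z" for z
    using monoD[OF i, of z y] monoD[OF i, of y z] fiber[OF that, of y]
    by (cases z y rule: linorder_cases) force+
  have "{l \<in> i ` Z. l < i y} = i ` {z \<in> Z. z < y}" "{l \<in> i ` Z. l \<le> i y} = i ` {z \<in> Z. z \<le> y}"
    using order by auto
  moreover have "inj_on i Z" using fiber by (auto simp: inj_on_def)
  then have "card (i ` {z \<in> Z. P z}) = card {z \<in> Z. P z}" for P
    by (intro card_image) (rule inj_on_subset, auto)
  ultimately show ?thesis by (simp add: cell_index_def)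
qed

lemma sgn_poly_eq_on_segment:
  fixes q :: "real poly"
  assumes "\<And>t. t \<in> closed_segment a b \<Longrightarrow> poly q t \<noteq> 0"
  shows "sgn (poly q a) = sgn (poly q b)"
proof (rule ccontr)
  assume "sgn (poly q a) \<noteq> sgn (poly q b)"
  moreover have "poly q a \<noteq> 0" "poly q b \<noteq> 0" using assms by auto
  ultimately have "poly q a * poly q b < 0" "a \<noteq> b"
    by (auto simp: sgn_if mult_less_0_iff split: if_splits)
  then have "poly q (min a b) * poly q (max a b) < 0" "min a b < max a b"
    by (auto simp: min_def max_def mult.commute)
  then obtain t where "min a b < t" "t < max a b" "poly q t = 0" using poly_IVT by blast
  then show False using assms[of t] by (cases "a \<le> b") (auto simp: closed_segment_eq_real_ivl)
qed

lemma sgn_poly_eq_on_cell: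
  assumes "finite Z" "\<And>u. poly q u = 0 \<Longrightarrow> u \<in> Z" "cell_index Z s = cell_index Z t"
  shows "sgn (poly q s) = sgn (poly q t)"
proof (cases "s = t")
  case False
  then have "Z \<inter> closed_segment s t = {}" using cell_index_eq_iff_segment assms(1,3) by blast
  then show ?thesis by (intro sgn_poly_eq_on_segment) (use assms(2) in blast)
qed simp

lemma ex_poly_pos_if_pderiv_pos:
  fixes q :: "real poly"
  assumes pos: "\<And>t. y \<le> t \<Longrightarrow> 0 < poly (pderiv q) t"
  shows "\<exists>t\<ge>y. 0 < poly q t"
proof -
  have large: "\<exists>t\<ge>y. 0 < poly r t" if lc: "0 < lead_coeff r" for r :: "real poly"
  proof -
    obtain n where n: "\<forall>t\<ge>n. lead_coeff r \<le> poly r t" using poly_pinfty_gt_lc[OF lc] by blast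
    have "0 < poly r (max n y)" using spec[OF n, of "max n y"] lc by simp
    then show ?thesis by (intro exI[of _ "max n y"]) simp
  qed
  have "0 < lead_coeff q"
  proof (rule ccontr)
    assume "\<not> 0 < lead_coeff q"
    moreover have "pderiv q \<noteq> 0" using pos[of y] by auto
    then have "degree q \<noteq> 0" "q \<noteq> 0" by (auto simp: pderiv_eq_0_iff)
    ultimately have "lead_coeff q < 0" by (meson leading_coeff_0_iff linorder_neqE)
    then have "0 < real (degree q) * - lead_coeff q"
      using \<open>degree q \<noteq> 0\<close> by (intro mult_pos_pos) simp_all
    also have "\<dots> = lead_coeff (pderiv (- q))"
      using \<open>degree q \<noteq> 0\<close> by (simp add: coeff_pderiv degree_pderiv)
    finally obtain t where "y \<le> t" "0 < poly (pderiv (- q)) t" using large by blast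
    then show False using pos[of t] by (simp add: pderiv_minus)
  qed
  then show ?thesis by (rule large)
qed

lemma cell_index_uminus_eq_iff:
  assumes "finite Z"
  shows "cell_index (uminus ` Z) s = cell_index (uminus ` Z) t \<longleftrightarrow>
    cell_index Z (- s) = cell_index Z (- t)"
    and "cell_index (uminus ` Z) s = Suc (cell_index (uminus ` Z) t) \<longleftrightarrow>
      Suc (cell_index Z (- s)) = cell_index Z (- t)"
  using cell_index_uminus[OF assms, of s] cell_index_uminus[OF assms, of t] by auto

context
  fixes p :: "real poly" and Z :: "real set" and y :: real
  assumes fin: "finite Z" and y: "y \<notin> Z"
    and increasing: "\<And>u. cell_index Z u = cell_index Z y \<Longrightarrow> 0 < poly (pderiv p) u"
begin

lemma poly_pos_at_next_root:
  assumes "0 \<le> poly p y" and r: "cell_index Z r = Suc (cell_index Z y)" shows "0 < poly p r"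
proof -
  have "y < r" using r by (intro cell_index_less_imp_less[OF fin]) simp
  then obtain x where x: "y < x" "x < r" "poly p r - poly p y = (r - y) * poly (pderiv p) x"
    using poly_MVT by blast
  have "r \<in> Z" using r y odd_cell_index_iff[OF fin] by (metis even_Suc)
  then have "cell_index Z x \<noteq> cell_index Z r" using x(2) cell_index_eq_imp_eq[OF fin, of r x] by auto
  moreover have "cell_index Z y \<le> cell_index Z x" "cell_index Z x \<le> cell_index Z r"
    using x monoD[OF mono_cell_index[OF fin]] by simp_all
  ultimately have "0 < poly (pderiv p) x" using r by (intro increasing) simp
  then have "0 < (r - y) * poly (pderiv p) x" using \<open>y < r\<close> by simp
  then show ?thesis using x(3) assms(1) by linarith
qed

lemma ex_poly_pos_in_cell:
  assumes "\<And>r. cell_index Z r = Suc (cell_index Z y) \<Longrightarrow> 0 < poly p r"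
  shows "\<exists>t. cell_index Z t = cell_index Z y \<and> 0 < poly p t"
proof -
  have in_cell: "cell_index Z t = cell_index Z y" if "y < t" "Z \<inter> {y<..t} = {}" for t
  proof -
    have "Z \<inter> {y..t} = {}" using that y by (auto simp: disjoint_iff le_less)
    then show ?thesis using cell_index_eq_iff[OF fin that(1)] by simp
  qed
  define U where "U = {z \<in> Z. y < z}"
  show ?thesis
  proof (cases "U = {}")
    case True
    then have cell: "cell_index Z t = cell_index Z y" if "y \<le> t" for t
      using that in_cell[of t] by (cases "t = y") (auto simp: U_def disjoint_iff)
    then have "\<exists>t\<ge>y. 0 < poly p t" by (intro ex_poly_pos_if_pderiv_pos increasing)
    then show ?thesis using cell by blast
  next
    case False
    define r where "r = Min U"
    have "finite U" using fin by (simp add: U_def)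
    then have "r \<in> U" "\<And>z. z \<in> U \<Longrightarrow> r \<le> z" using False by (simp_all add: r_def)
    then have r: "r \<in> Z" "y < r" "Z \<inter> {y<..<r} = {}" by (force simp: U_def disjoint_iff)+
    then have "0 < poly p r" by (intro assms cell_index_next fin y)
    moreover have "(poly p \<longlongrightarrow> poly p r) (at_left r)"
      using poly_isCont[of r p] unfolding isCont_def
      by (rule filterlim_mono[OF _ order_refl at_le]) simp
    ultimately have "eventually (\<lambda>t. 0 < poly p t) (at_left r)" by (auto dest: order_tendstoD)
    moreover have "eventually (\<lambda>t. t \<in> {y<..<r}) (at_left r)" using r(2)
      by (intro eventually_at_leftI) auto
    ultimately have "eventually (\<lambda>t. 0 < poly p t \<and> t \<in> {y<..<r}) (at_left r)" by (rule eventually_conj)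
    then obtain t where t: "0 < poly p t" "y < t" "t < r" by (auto dest!: eventually_happens)
    then have "Z \<inter> {y<..t} = {}" using r(3) by force
    then show ?thesis using in_cell t by blast
  qed
qed

end

context
  fixes p :: "real poly" and Z :: "real set" and y :: real
  assumes fin: "finite Z" and y: "y \<notin> Z"
    and increasing: "\<And>u. cell_index Z u = cell_index Z y \<Longrightarrow> 0 < poly (pderiv p) u"
begin

lemma reflected_increasing:
  "cell_index (uminus ` Z) u = cell_index (uminus ` Z) (- y) \<Longrightarrow>
    0 < poly (pderiv (- (p \<circ>\<^sub>p [:0, -1:]))) u"
  using increasing by (simp add: cell_index_uminus_eq_iff[OF fin] pderiv_minus pderiv_pcompose
    pderiv_pCons poly_pcompose)

lemma poly_neg_at_previous_root:
  assumes "poly p y \<le> 0" "Suc (cell_index Z r) = cell_index Z y" shows "poly p r < 0"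
  using assms fin y
    poly_pos_at_next_root[of "uminus ` Z" "- y" "- (p \<circ>\<^sub>p [:0,
      -1:])" "- r", OF _ _ reflected_increasing]
  by (auto simp: cell_index_uminus_eq_iff poly_pcompose image_iff)

lemma ex_poly_neg_in_cell:
  assumes "\<And>r. Suc (cell_index Z r) = cell_index Z y \<Longrightarrow> poly p r < 0"
  shows "\<exists>t. cell_index Z t = cell_index Z y \<and> poly p t < 0"
proof -
  have "\<exists>t. cell_index (uminus ` Z) t = cell_index (uminus ` Z) (- y) \<and>
    0 < poly (- (p \<circ>\<^sub>p [:0, -1:])) t"
  proof (rule ex_poly_pos_in_cell[OF _ _ reflected_increasing])
    show "0 < poly (- (p \<circ>\<^sub>p [:0, -1:])) r"
      if "cell_index (uminus ` Z) r = Suc (cell_index (uminus ` Z) (- y))" for r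
      using assms[of "- r"] that by (simp add: cell_index_uminus_eq_iff[OF fin] poly_pcompose)
  qed (use fin y in auto)
  then show ?thesis by (auto simp: cell_index_uminus_eq_iff[OF fin] poly_pcompose)
qed

end

lemma ex_poly_zero_in_cell:
  assumes fin: "finite Z" and eq: "cell_index Z s = cell_index Z t"
    and sgn: "0 < poly p s" "poly p t < 0"
  shows "\<exists>u. cell_index Z u = cell_index Z s \<and> poly p u = 0"
proof -
  have "min s t < max s t" using sgn by (cases "s = t") auto
  moreover have "poly p (min s t) * poly p (max s t) < 0" using sgn
    by (auto simp: min_def max_def mult_less_0_iff)
  ultimately obtain u where u: "min s t < u" "u < max s t" "poly p u = 0" using poly_IVT by blast
  then have "cell_index Z (min s t) \<le> cell_index Z u" "cell_index Z u \<le> cell_index Z (max s t)"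
    by (auto intro!: monoD[OF mono_cell_index[OF fin]])
  then have "cell_index Z u = cell_index Z s" using eq by (auto simp: min_def max_def split: if_splits)
  then show ?thesis using u(3) by blast
qed

locale matched_cells =
  fixes Z Z' :: "real set" and p p' :: "real poly"
  assumes fin: "finite Z" "finite Z'" and range: "range (cell_index Z) = range (cell_index Z')"
    and critical: "\<And>y. poly (pderiv p) y = 0 \<Longrightarrow> y \<in> Z" "\<And>y. poly (pderiv p') y = 0 \<Longrightarrow> y \<in> Z'"
    and sgn_pderiv: "\<And>y y'. cell_index Z y = cell_index Z' y' \<Longrightarrow>
      sgn (poly (pderiv p) y) = sgn (poly (pderiv p') y')"
    and sgn_at_root: "\<And>y y'. cell_index Z y = cell_index Z' y' \<Longrightarrow> y \<in> Z \<Longrightarrow>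
      sgn (poly p y) = sgn (poly p' y')"
begin

lemma mem_iff: "cell_index Z y = cell_index Z' y' \<Longrightarrow> y \<in> Z \<longleftrightarrow> y' \<in> Z'"
  using odd_cell_index_iff fin by metis

lemma matched_cells_sym: "matched_cells Z' Z p' p"
proof
  show "sgn (poly p' y') = sgn (poly p y)" if "cell_index Z' y' = cell_index Z y" "y' \<in> Z'" for y y'
    using sgn_at_root[of y y'] mem_iff[of y y'] that by simp
qed (use fin range critical sgn_pderiv in \<open>auto dest: sym\<close>)

lemma matched_cells_uminus: "matched_cells Z Z' (- p) (- p')"
  using fin range critical sgn_pderiv sgn_at_root
  by unfold_locales (auto simp: pderiv_minus sgn_minus)

lemma sgn_attained_increasing:
  assumes eq: "cell_index Z y = cell_index Z' y'" and y: "y \<notin> Z" and pos: "0 < poly (pderiv p) y"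
  shows "\<exists>t'. cell_index Z' t' = cell_index Z' y' \<and> sgn (poly p' t') = sgn (poly p y)"
proof -
  have y': "y' \<notin> Z'" using mem_iff eq y by blast
  have incr': "0 < poly (pderiv p') u" if "cell_index Z' u = cell_index Z' y'" for u
    using sgn_pderiv[of y u] that eq pos by (simp add: sgn_1_pos flip: sgn_1_pos)
  have incr: "0 < poly (pderiv p) u" if "cell_index Z u = cell_index Z y" for u
    using sgn_pderiv[of u y'] incr'[of y'] that eq by (simp add: sgn_1_pos flip: sgn_1_pos)
  have sgn_root: "sgn (poly p r) = sgn (poly p' r')"
    if "cell_index Z r = cell_index Z' r'" "odd (cell_index Z r)" for r r'
    using sgn_at_root that odd_cell_index_iff[OF fin(1)] by blast
  have even: "even (cell_index Z y)" using odd_cell_index_iff[OF fin(1)] y by blast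
  have ex_root: "\<exists>r. cell_index Z r = cell_index Z' r'" for r' using range by (metis rangeE rangeI)
  have ex_pos: "\<exists>t'. cell_index Z' t' = cell_index Z' y' \<and> 0 < poly p' t'" if "0 \<le> poly p y"
  proof (rule ex_poly_pos_in_cell[OF fin(2) y' incr'])
    fix r' assume "cell_index Z' r' = Suc (cell_index Z' y')"
    with ex_root obtain r where r: "cell_index Z r = cell_index Z' r'"
      "cell_index Z r = Suc (cell_index Z y)"
      using eq by metis
    then have "0 < poly p r" by (intro poly_pos_at_next_root[OF fin(1) y incr that])
    then show "0 < poly p' r'" using sgn_root[OF r(1)] r(2) even by (simp flip: sgn_1_pos)
  qed
  have ex_neg: "\<exists>t'. cell_index Z' t' = cell_index Z' y' \<and> poly p' t' < 0" if "poly p y \<le> 0"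
  proof (rule ex_poly_neg_in_cell[OF fin(2) y' incr'])
    fix r' assume "Suc (cell_index Z' r') = cell_index Z' y'"
    with ex_root obtain r where r: "cell_index Z r = cell_index Z' r'"
      "Suc (cell_index Z r) = cell_index Z y"
      using eq by metis
    then have "poly p r < 0" by (intro poly_neg_at_previous_root[OF fin(1) y incr that])
    moreover have "odd (cell_index Z r)" using even unfolding r(2)[symmetric] by simp
    ultimately show "poly p' r' < 0" using sgn_root[OF r(1)] by (simp flip: sgn_1_neg)
  qed
  consider (pos) "0 < poly p y" | (neg) "poly p y < 0" | (zero) "poly p y = 0" by linarith
  then show ?thesis
  proof cases
    case zero
    then show ?thesis using ex_pos ex_neg ex_poly_zero_in_cell[OF fin(2)] by (metis order_refl)
  qed (use ex_pos ex_neg in force)+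
qed

end

lemma (in matched_cells) sgn_attained:
  assumes eq: "cell_index Z y = cell_index Z' y'"
  shows "\<exists>t'. cell_index Z' t' = cell_index Z' y' \<and> sgn (poly p' t') = sgn (poly p y)"
proof -
  consider (root) "y \<in> Z" | (increasing) "y \<notin> Z" "0 < poly (pderiv p) y"
    | (decreasing) "y \<notin> Z" "0 < poly (pderiv (- p)) y"
    using critical(1)[of y] by (force simp: pderiv_minus)
  then show ?thesis
  proof cases
    case root
    then show ?thesis using sgn_at_root[OF eq] by metis
  next
    case increasing
    then show ?thesis by (rule sgn_attained_increasing[OF eq])
  next
    case decreasing
    then show ?thesis
      using matched_cells.sgn_attained_increasing[OF matched_cells_uminus eq] by (simp add: sgn_minus)
  qed
qed

text \<open>On an open cell \<open>p\<close> is monotone, so that \<open>p * pderiv p\<close> is negative before the root of \<open>p\<close> in it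
  and positive after it.\<close>

definition refined_index :: "real set \<Rightarrow> real poly \<Rightarrow> real \<Rightarrow> real" where
  "refined_index Z p y = 3 * real (cell_index Z y) + sgn (poly (pderiv p) y * poly p y)"

lemma refined_index_eq_iff:
  "refined_index Z p y = refined_index Z' p' y' \<longleftrightarrow> cell_index Z y = cell_index Z' y' \<and>
    sgn (poly (pderiv p) y * poly p y) = sgn (poly (pderiv p') y' * poly p' y')"
proof
  assume eq: "refined_index Z p y = refined_index Z' p' y'"
  have "\<bar>sgn x\<bar> \<le> 1" for x :: real by (simp add: sgn_if)
  from this[of "poly (pderiv p) y * poly p y"] this[of "poly (pderiv p') y' * poly p' y'"]
  have "cell_index Z y = cell_index Z' y'" using eq unfolding refined_index_def by linarith
  then show "cell_index Z y = cell_index Z' y' \<and>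
    sgn (poly (pderiv p) y * poly p y) = sgn (poly (pderiv p') y' * poly p' y')"
    using eq by (simp add: refined_index_def)
qed (simp add: refined_index_def)

lemma mono_refined_index:
  assumes fin: "finite Z" and critical: "\<And>y. poly (pderiv p) y = 0 \<Longrightarrow> y \<in> Z"
  shows "mono (refined_index Z p)"
proof (rule monoI)
  fix s t :: real assume "s \<le> t"
  then have le: "cell_index Z s \<le> cell_index Z t" by (rule monoD[OF mono_cell_index[OF fin]])
  show "refined_index Z p s \<le> refined_index Z p t"
  proof (cases "cell_index Z s = cell_index Z t \<and> s \<noteq> t")
    case False
    then show ?thesis using le by (cases "s = t") (auto simp: refined_index_def sgn_if)
  next
    case True
    then have "s < t" using \<open>s \<le> t\<close> by simp
    then obtain x where x: "s < x" "x < t" "poly p t - poly p s = (t - s) * poly (pderiv p) x"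
      using poly_MVT by blast
    have "cell_index Z x = cell_index Z s"
      using True x monoD[OF mono_cell_index[OF fin], of s x] monoD[OF mono_cell_index[OF fin], of x t]
      by auto
    then have sgn: "sgn (poly (pderiv p) s) = sgn (poly (pderiv p) x)"
      "sgn (poly (pderiv p) t) = sgn (poly (pderiv p) x)"
      by (auto intro!: sgn_poly_eq_on_cell[OF fin critical] simp: True)
    have "poly (pderiv p) x * poly p t - poly (pderiv p) x * poly p s = (t - s) * (poly (pderiv p) x)\<^sup>2"
      unfolding right_diff_distrib[symmetric] x(3) by (simp add: power2_eq_square)
    then have "poly (pderiv p) x * poly p s \<le> poly (pderiv p) x * poly p t"
      using \<open>s < t\<close> by (metis diff_ge_0_iff_ge less_imp_le mult_nonneg_nonneg zero_le_power2)
    then have "sgn (poly (pderiv p) x * poly p s) \<le> sgn (poly (pderiv p) x * poly p t)"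
      by (auto simp: sgn_if)
    then show ?thesis using True sgn by (simp add: refined_index_def sgn_mult)
  qed
qed

text \<open>The maps \<open>i\<close> and \<open>i'\<close> number the cells of two subdivisions of the line on which all signs are
  constant; the common range says that the cells correspond in order.\<close>

definition sign_equivalent :: "(real poly \<times> real poly) set \<Rightarrow> bool" where
  "sign_equivalent B \<longleftrightarrow> (\<exists>(i :: real \<Rightarrow> real) i'. mono i \<and> mono i' \<and> range i = range i' \<and>
     (\<forall>(q, q')\<in>B. \<forall>y y'. i y = i' y' \<longrightarrow> sgn (poly q y) = sgn (poly q' y')))"

lemma (in matched_cells) range_refined_index_subset:
  "range (refined_index Z p) \<subseteq> range (refined_index Z' p')"
proof (rule image_subsetI)
  fix y
  obtain y' where y': "cell_index Z y = cell_index Z' y'" using range by (metis rangeE rangeI)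
  obtain t' where t': "cell_index Z' t' = cell_index Z' y'" "sgn (poly p' t') = sgn (poly p y)"
    using sgn_attained[OF y'] by blast
  then have "refined_index Z p y = refined_index Z' p' t'"
    using sgn_pderiv[of y t'] y' by (simp add: refined_index_def sgn_mult)
  then show "refined_index Z p y \<in> range (refined_index Z' p')" by simp
qed

lemma (in matched_cells) sign_equivalent_insert_matched:
  assumes A: "\<And>q q' y y'. (q, q') \<in> A \<Longrightarrow> cell_index Z y = cell_index Z' y' \<Longrightarrow>
    sgn (poly q y) = sgn (poly q' y')"
  shows "sign_equivalent (insert (p, p') A)"
proof -
  interpret sym: matched_cells Z' Z p' p by (rule matched_cells_sym)
  have "sgn (poly p y) = sgn (poly p' y')" if "refined_index Z p y = refined_index Z' p' y'" for y y'
  proof -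
    have eq: "cell_index Z y = cell_index Z' y'"
      "sgn (poly (pderiv p) y) * sgn (poly p y) = sgn (poly (pderiv p') y') * sgn (poly p' y')"
      using that by (simp_all add: refined_index_eq_iff sgn_mult)
    show ?thesis
    proof (cases "poly (pderiv p) y = 0")
      case True
      then show ?thesis using critical(1) sgn_at_root[OF eq(1)] by blast
    next
      case False
      then show ?thesis using eq(2) sgn_pderiv[OF eq(1)] by (metis mult_left_cancel sgn_zero_iff)
    qed
  qed
  then have "\<forall>(q, q')\<in>insert (p, p') A. \<forall>y y'. refined_index Z p y = refined_index Z' p' y' \<longrightarrow>
      sgn (poly q y) = sgn (poly q' y')"
    using A by (auto simp: refined_index_eq_iff)
  moreover have "mono (refined_index Z p)" "mono (refined_index Z' p')"
    using fin critical by (auto intro: mono_refined_index)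
  moreover have "range (refined_index Z p) = range (refined_index Z' p')"
    using range_refined_index_subset sym.range_refined_index_subset by (rule subset_antisym)
  ultimately show ?thesis unfolding sign_equivalent_def by blast
qed

lemma sign_equivalent_subset: "sign_equivalent B \<Longrightarrow> A \<subseteq> insert (0, 0) B \<Longrightarrow> sign_equivalent A"
  unfolding sign_equivalent_def by (elim ex_forward conj_forward) force+

locale sign_matching =
  fixes i i' :: "real \<Rightarrow> real" and A :: "(real poly \<times> real poly) set"
  assumes mono: "mono i" "mono i'" and range_eq: "range i = range i'"
    and finite_A: "finite A" and nonzero: "0 \<notin> fst ` A" "0 \<notin> snd ` A"
    and sgn_eq: "\<And>q q' y y'. (q, q') \<in> A \<Longrightarrow> i y = i' y' \<Longrightarrow> sgn (poly q y) = sgn (poly q' y')"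
begin

definition Z :: "real set" where "Z = {y. \<exists>(q, q')\<in>A. poly q y = 0}"

definition Z' :: "real set" where "Z' = {y. \<exists>(q, q')\<in>A. poly q' y = 0}"

lemma finite_Z: "finite Z" "finite Z'"
proof -
  have "Z = (\<Union>q\<in>fst ` A. {y. poly q y = 0})" "Z' = (\<Union>q\<in>snd ` A. {y. poly q y = 0})"
    by (force simp: Z_def Z'_def)+
  moreover have "finite {y. poly q y = 0}" if "q \<in> fst ` A \<union> snd ` A" for q
    using nonzero that by (intro poly_roots_finite) auto
  ultimately show "finite Z" "finite Z'" using finite_A by auto
qed

lemma zero_iff: "(q, q') \<in> A \<Longrightarrow> i y = i' y' \<Longrightarrow> poly q y = 0 \<longleftrightarrow> poly q' y' = 0"
  using sgn_eq by (metis sgn_zero_iff)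

lemma mem_Z_iff: "i y = i' y' \<Longrightarrow> y \<in> Z \<longleftrightarrow> y' \<in> Z'"
  using zero_iff by (fastforce simp: Z_def Z'_def)

lemma ex_index_eq: "\<exists>y. i y = i' y'" "\<exists>y'. i y = i' y'"
  using range_eq by (metis rangeE rangeI)+

lemma cell_index_eq: assumes eq: "i y = i' y'" shows "cell_index Z y = cell_index Z' y'"
proof -
  have image: "i ` Z = i' ` Z'"
  proof (intro subset_antisym image_subsetI)
    show "i y \<in> i' ` Z'" if "y \<in> Z" for y using ex_index_eq(2)[of y] mem_Z_iff that by auto
    show "i' y' \<in> i ` Z" if "y' \<in> Z'" for y' using ex_index_eq(1)[of y'] mem_Z_iff that
      by (metis imageI)
  qed
  have "t \<in> Z" if "y \<in> Z" "i t = i y" for t y using ex_index_eq(2)[of y] mem_Z_iff that by metis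
  then have "cell_index Z y = card {l \<in> i ` Z. l < i y} + card {l \<in> i ` Z. l \<le> i y}"
    by (rule cell_index_mono_image[OF mono(1) finite_Z(1)])
  moreover have "t \<in> Z'" if "y \<in> Z'" "i' t = i' y" for t y
    using ex_index_eq(1)[of y] mem_Z_iff that by metis
  then have "cell_index Z' y' = card {l \<in> i' ` Z'. l < i' y'} + card {l \<in> i' ` Z'. l \<le> i' y'}"
    by (rule cell_index_mono_image[OF mono(2) finite_Z(2)])
  ultimately show ?thesis by (simp add: image eq)
qed

lemma range_cell_index: "range (cell_index Z) = range (cell_index Z')"
proof (intro subset_antisym image_subsetI)
  show "cell_index Z y \<in> range (cell_index Z')" for y using ex_index_eq(2)[of y] cell_index_eq by auto
  show "cell_index Z' y' \<in> range (cell_index Z)" for y' using ex_index_eq(1)[of y'] cell_index_eq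
    by (metis rangeI)
qed

lemma sgn_eq_if_cell_index_eq:
  assumes q: "(q, q') \<in> A" and eq: "cell_index Z y = cell_index Z' y'"
  shows "sgn (poly q y) = sgn (poly q' y')"
proof -
  obtain t where t: "i t = i' y'" using ex_index_eq by blast
  have "sgn (poly q y) = sgn (poly q t)"
  proof (rule sgn_poly_eq_on_cell[OF finite_Z(1)])
    show "u \<in> Z" if "poly q u = 0" for u using that q by (auto simp: Z_def)
    show "cell_index Z y = cell_index Z t" using eq cell_index_eq[OF t] by simp
  qed
  then show ?thesis using sgn_eq[OF q t] by simp
qed

lemma index_eq_at_root:
  assumes "y \<in> Z" and eq: "cell_index Z y = cell_index Z' y'" shows "i y = i' y'"
proof -
  obtain t where t: "i t = i' y'" using ex_index_eq by blast
  then have "t = y" using cell_index_eq_imp_eq[OF finite_Z(1) \<open>y \<in> Z\<close>] eq cell_index_eq by simp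
  then show ?thesis using t by simp
qed

end

text \<open>The inductive step of Hoermander's proof of quantifier elimination: the roots of the polynomials
  in \<open>A\<close> cut the line into intervals on which \<open>p\<close> is monotone, and the sign of \<open>p\<close> at such a root is
  the sign of a remainder.\<close>

lemma sign_equivalent_insert:
  assumes B: "sign_equivalent B" and A: "A \<subseteq> B" "finite A" and nonzero: "0 \<notin> fst ` A" "0 \<notin> snd ` A"
    and pderiv: "(pderiv p, pderiv p') \<in> A"
    and remainder: "\<And>q q'. (q, q') \<in> A \<Longrightarrow> \<exists>(r, r')\<in>B.
      (\<forall>y. poly q y = 0 \<longrightarrow> sgn (poly p y) = sgn (poly r y)) \<and>
      (\<forall>y. poly q' y = 0 \<longrightarrow> sgn (poly p' y) = sgn (poly r' y))"
  shows "sign_equivalent (insert (p, p') A)"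
proof -
  obtain i i' :: "real \<Rightarrow> real" where i: "mono i" "mono i'" "range i = range i'"
    and sgn: "\<And>q q' y y'. (q, q') \<in> B \<Longrightarrow> i y = i' y' \<Longrightarrow> sgn (poly q y) = sgn (poly q' y')"
    using B unfolding sign_equivalent_def by blast
  interpret sign_matching i i' A
    by unfold_locales (use i A nonzero sgn in blast)+
  interpret matched_cells Z Z' p p'
  proof
    show "sgn (poly p y) = sgn (poly p' y')" if eq: "cell_index Z y = cell_index Z' y'"
      and y: "y \<in> Z" for y y'
    proof -
      have iy: "i y = i' y'" using y eq by (rule index_eq_at_root)
      obtain q q' where q: "(q, q') \<in> A" "poly q y = 0" using y by (auto simp: Z_def)
      obtain r r' where "(r, r') \<in> B" "sgn (poly p y) = sgn (poly r y)"
        "sgn (poly p' y') = sgn (poly r' y')"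
        using remainder[OF q(1)] q zero_iff[OF q(1) iy] by blast
      then show ?thesis using sgn iy by simp
    qed
    show "y \<in> Z" if "poly (pderiv p) y = 0" for y using that pderiv by (auto simp: Z_def)
    show "y \<in> Z'" if "poly (pderiv p') y = 0" for y using that pderiv by (auto simp: Z'_def)
  qed (fact finite_Z range_cell_index sgn_eq_if_cell_index_eq[OF pderiv])+
  show ?thesis by (rule sign_equivalent_insert_matched) (rule sgn_eq_if_cell_index_eq)
qed

section \<open>Polynomial functions and ISD functions\<close>

lemma poly_fun_uminus: "poly_fun N f \<Longrightarrow> poly_fun N (\<lambda>x. - f x)"
  using pf_mult[OF pf_const[of N "- 1"], of f] by simp

lemma poly_fun_diff: "poly_fun N f \<Longrightarrow> poly_fun N g \<Longrightarrow> poly_fun N (\<lambda>x. f x - g x)"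
  using pf_add[OF _ poly_fun_uminus, of N f g] by simp

lemma poly_fun_sum: "(\<And>i. i \<in> I \<Longrightarrow> poly_fun N (f i)) \<Longrightarrow> poly_fun N (\<lambda>x. \<Sum>i\<in>I. f i x)"
  by (induction I rule: infinite_finite_induct) (auto intro: pf_const pf_add)

lemma poly_fun_power: "poly_fun N f \<Longrightarrow> poly_fun N (\<lambda>x. f x ^ k)"
  by (induction k) (auto intro: pf_const pf_mult)

lemma poly_fun_mono: "poly_fun N f \<Longrightarrow> N \<le> N' \<Longrightarrow> poly_fun N' f"
  by (induction rule: poly_fun.induct) (auto intro: poly_fun.intros)

lemma poly_fun_append: "poly_fun N f \<Longrightarrow> length x = N \<Longrightarrow> f (x @ y) = f x"
  by (induction rule: poly_fun.induct) (auto simp: nth_append)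

lemma poly_fun_select:
  assumes "poly_fun N f" "\<And>i. i < N \<Longrightarrow> e i < N'"
  shows "poly_fun N' (\<lambda>w. f (map (\<lambda>i. w ! e i) [0..<N]))"
  using assms by (induction rule: poly_fun.induct) (auto intro: poly_fun.intros)

lemma isd_const: "isd_gen N (\<lambda>x. c)"
  by (intro isd_poly pf_const)

lemma isd_nth: "i < N \<Longrightarrow> isd_gen N (\<lambda>x. x ! i)"
  by (intro isd_poly pf_proj)

lemma isd_add_poly: "isd_gen N f \<Longrightarrow> poly_fun N p \<Longrightarrow> isd_gen N (\<lambda>x. p x + f x)"
proof (induction rule: isd_gen.induct)
  case (isd_poly q)
  then show ?case by (intro isd_gen.isd_poly pf_add)
next
  case (isd_min f g)
  then show ?case using isd_gen.isd_min[of N "\<lambda>x. p x + f x" "\<lambda>x. p x + g x"]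
    by (simp add: min_add_distrib_right)
next
  case (isd_max f g)
  then show ?case using isd_gen.isd_max[of N "\<lambda>x. p x + f x" "\<lambda>x. p x + g x"]
    by (simp add: max_add_distrib_right)
qed

lemma isd_add: "isd_gen N f \<Longrightarrow> isd_gen N g \<Longrightarrow> isd_gen N (\<lambda>x. f x + g x)"
proof (induction rule: isd_gen.induct)
  case (isd_poly p)
  then show ?case by (simp add: isd_add_poly)
next
  case (isd_min f h)
  then show ?case using isd_gen.isd_min[of N "\<lambda>x. f x + g x" "\<lambda>x. h x + g x"]
    by (simp add: min_add_distrib_left)
next
  case (isd_max f h)
  then show ?case using isd_gen.isd_max[of N "\<lambda>x. f x + g x" "\<lambda>x. h x + g x"]
    by (simp add: max_add_distrib_left)
qed

lemma isd_uminus: "isd_gen N f \<Longrightarrow> isd_gen N (\<lambda>x. - f x)"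
proof (induction rule: isd_gen.induct)
  case (isd_poly p)
  then show ?case by (intro isd_gen.isd_poly poly_fun_uminus)
next
  case (isd_min f g)
  then show ?case using isd_gen.isd_max[of N "\<lambda>x. - f x" "\<lambda>x. - g x"] by (simp add: minus_min_eq_max)
next
  case (isd_max f g)
  then show ?case using isd_gen.isd_min[of N "\<lambda>x. - f x" "\<lambda>x. - g x"] by (simp add: minus_max_eq_min)
qed

lemma isd_diff: "isd_gen N f \<Longrightarrow> isd_gen N g \<Longrightarrow> isd_gen N (\<lambda>x. f x - g x)"
  using isd_add[OF _ isd_uminus, of N f g] by simp

text \<open>The factor \<open>1 + f\<^sup>2\<close> dominates \<open>f\<close> and preserves the sign of \<open>p\<close>, so the minimum picks
  out the quadrant where both factors are positive.\<close>

lemma pos_part_mult_pos_part: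
  fixes f p :: real
  shows "max f 0 * max p 0 = min (max (f * p) 0) (max (p * (1 + f\<^sup>2)) 0)"
proof -
  have "0 \<le> (f - 1 / 2)\<^sup>2" by simp
  then have ge: "f \<le> 1 + f\<^sup>2" by (simp add: power2_eq_square algebra_simps)
  have pos: "0 < 1 + f\<^sup>2" by (simp add: add_pos_nonneg)
  show ?thesis
  proof (cases "p > 0")
    case True
    then have "f * p \<le> p * (1 + f\<^sup>2)" "0 \<le> p * (1 + f\<^sup>2)" using ge pos by (simp_all add: mult.commute)
    then show ?thesis using True
      by (cases "f > 0") (auto simp: min_def max_def zero_le_mult_iff mult_le_0_iff)
  next
    case False
    then have "p * (1 + f\<^sup>2) \<le> 0" using pos by (simp add: mult_le_0_iff)
    then show ?thesis using False by (simp add: max_def)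
  qed
qed

lemma isd_mult_pos_poly:
  assumes "isd_gen N f" "poly_fun N p" shows "isd_gen N (\<lambda>x. f x * max (p x) 0)"
  using assms
proof (induction rule: isd_gen.induct)
  case (isd_poly q)
  have pp: "isd_gen N (\<lambda>x. max (r x) 0 * max (p x) 0)" if "poly_fun N r" for r
    unfolding pos_part_mult_pos_part using that isd_poly
    by (intro isd_min isd_max isd_const isd_gen.isd_poly pf_mult pf_add pf_const poly_fun_power)
  have "(\<lambda>x. q x * max (p x) 0) = (\<lambda>x. max (q x) 0 * max (p x) 0 - max (- q x) 0 * max (p x) 0)"
    by (auto simp: max_def)
  moreover have "isd_gen N (\<lambda>x. max (q x) 0 * max (p x) 0 - max (- q x) 0 * max (p x) 0)"
    using isd_poly by (intro isd_diff pp poly_fun_uminus)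
  ultimately show ?case by simp
next
  case (isd_min f g)
  then show ?case using isd_gen.isd_min[of N "\<lambda>x. f x * max (p x) 0" "\<lambda>x. g x * max (p x) 0"]
    by (simp add: min_mult_distrib_right)
next
  case (isd_max f g)
  then show ?case using isd_gen.isd_max[of N "\<lambda>x. f x * max (p x) 0" "\<lambda>x. g x * max (p x) 0"]
    by (simp add: max_mult_distrib_right)
qed

lemma isd_mult_poly:
  assumes "isd_gen N f" "poly_fun N p" shows "isd_gen N (\<lambda>x. f x * p x)"
proof -
  have "(\<lambda>x. f x * p x) = (\<lambda>x. f x * max (p x) 0 - f x * max (- p x) 0)" by (auto simp: max_def)
  then show ?thesis using isd_diff[OF isd_mult_pos_poly isd_mult_pos_poly, of N f p f "\<lambda>x. - p x"]
      assms poly_fun_uminus by simp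
qed

lemma isd_mult_nonneg:
  assumes "isd_gen N g" "isd_gen N f" "\<And>x. 0 \<le> f x" shows "isd_gen N (\<lambda>x. f x * g x)"
  using assms
proof (induction rule: isd_gen.induct)
  case (isd_poly p)
  then show ?case by (simp add: isd_mult_poly)
next
  case (isd_min g h)
  then show ?case using isd_gen.isd_min[of N "\<lambda>x. f x * g x" "\<lambda>x. f x * h x"]
    by (simp add: min_mult_distrib_left)
next
  case (isd_max g h)
  then show ?case using isd_gen.isd_max[of N "\<lambda>x. f x * g x" "\<lambda>x. f x * h x"]
    by (simp add: max_mult_distrib_left)
qed

lemma isd_mult:
  assumes "isd_gen N f" "isd_gen N g" shows "isd_gen N (\<lambda>x. f x * g x)"
proof -
  have "isd_gen N (\<lambda>x. max (f x) 0 * g x)" "isd_gen N (\<lambda>x. max (- f x) 0 * g x)"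
    using assms by (auto intro!: isd_mult_nonneg isd_max isd_uminus isd_const)
  moreover have "(\<lambda>x. f x * g x) = (\<lambda>x. max (f x) 0 * g x - max (- f x) 0 * g x)"
    by (auto simp: max_def)
  ultimately show ?thesis using isd_diff by simp
qed

lemma isd_sum: "(\<And>i. i \<in> I \<Longrightarrow> isd_gen N (f i)) \<Longrightarrow> isd_gen N (\<lambda>x. \<Sum>i\<in>I. f i x)"
  by (induction I rule: infinite_finite_induct) (auto intro: isd_const isd_add)

lemma isd_power: "isd_gen N f \<Longrightarrow> isd_gen N (\<lambda>x. f x ^ k)"
  by (induction k) (auto intro: isd_const isd_mult)

lemma isd_abs: assumes "isd_gen N f" shows "isd_gen N (\<lambda>x. \<bar>f x\<bar>)"
proof -
  have "(\<lambda>x. \<bar>f x\<bar>) = (\<lambda>x. max (f x) (- f x))" by (auto simp: max_def)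
  then show ?thesis using isd_max[OF assms isd_uminus[OF assms]] by simp
qed

section \<open>Polynomials with parameters\<close>

abbreviation poly_funs :: "nat \<Rightarrow> (real list \<Rightarrow> real) list \<Rightarrow> bool" where
  "poly_funs N cs \<equiv> \<forall>c\<in>set cs. poly_fun N c"

definition specialize :: "(real list \<Rightarrow> real) list \<Rightarrow> real list \<Rightarrow> real poly" where
  "specialize cs x = Poly (map (\<lambda>c. c x) cs)"

lemma coeff_specialize: "coeff (specialize cs x) i = (if i < length cs then (cs ! i) x else 0)"
  by (simp add: specialize_def nth_default_def)

lemma specialize_Nil [simp]: "specialize [] x = 0"
  by (simp add: specialize_def)

lemma specialize_Cons [simp]: "specialize (c # cs) x = pCons (c x) (specialize cs x)"
  by (simp add: specialize_def)

lemma degree_specialize_le: "degree (specialize cs x) \<le> length cs"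
  by (rule degree_le) (simp add: coeff_specialize)

lemma specialize_nonzero: "cs \<noteq> [] \<Longrightarrow> last cs x \<noteq> 0 \<Longrightarrow> specialize cs x \<noteq> 0"
  using coeff_specialize[of cs x "length cs - 1"] by (auto simp: last_conv_nth)

lemma specialize_butlast: "last cs x = 0 \<Longrightarrow> specialize (butlast cs) x = specialize cs x"
  by (induction cs) auto

lemma specialize_append: "poly_funs N cs \<Longrightarrow> length x = N \<Longrightarrow> specialize cs (x @ y) = specialize cs x"
  by (induction cs) (auto intro: poly_fun_append)

lemma poly_fun_coeff_specialize: "poly_funs N cs \<Longrightarrow> poly_fun N (\<lambda>x. coeff (specialize cs x) i)"
  by (cases "i < length cs") (simp_all add: coeff_specialize pf_const)

lemma poly_fun_poly_specialize:
  assumes "poly_funs N cs" "poly_fun N e" shows "poly_fun N (\<lambda>w. poly (specialize cs w) (e w))"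
  using assms by (induction cs) (auto intro!: pf_const pf_add pf_mult)

lemma ex_specialize_eq:
  assumes coeff: "\<And>i. poly_fun N (\<lambda>x. coeff (q x) i)" and degree: "\<And>x. degree (q x) \<le> n"
  shows "\<exists>cs. poly_funs N cs \<and> (\<forall>x. specialize cs x = q x)"
proof (intro exI conjI allI)
  let ?cs = "map (\<lambda>i x. coeff (q x) i) [0..<Suc n]"
  show "poly_funs N ?cs" using coeff by auto
  show "specialize ?cs x = q x" for x
    using degree[of x] by (intro poly_eqI) (auto simp: coeff_specialize coeff_eq_0 simp del: upt_Suc)
qed

definition deriv_coeffs :: "(real list \<Rightarrow> real) list \<Rightarrow> (real list \<Rightarrow> real) list" where
  "deriv_coeffs cs = map (\<lambda>i x. real (Suc i) * (cs ! Suc i) x) [0..<length cs - 1]"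

lemma length_deriv_coeffs [simp]: "length (deriv_coeffs cs) = length cs - 1"
  by (simp add: deriv_coeffs_def)

lemma deriv_coeffs_eq_Nil_iff: "deriv_coeffs cs = [] \<longleftrightarrow> length cs \<le> 1"
  by (auto simp: deriv_coeffs_def)

lemma specialize_deriv_coeffs: "specialize (deriv_coeffs cs) x = pderiv (specialize cs x)"
  by (rule poly_eqI) (auto simp: coeff_specialize coeff_pderiv deriv_coeffs_def)

lemma poly_funs_deriv_coeffs: "poly_funs N cs \<Longrightarrow> poly_funs N (deriv_coeffs cs)"
  by (auto simp: deriv_coeffs_def less_diff_conv simp del: of_nat_Suc intro!: pf_mult pf_const)

lemma last_deriv_coeffs:
  assumes "2 \<le> length cs" shows "last (deriv_coeffs cs) x = real (length cs - 1) * last cs x"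
proof -
  have "deriv_coeffs cs \<noteq> []" "cs \<noteq> []" using assms by (auto simp: deriv_coeffs_eq_Nil_iff)
  moreover obtain k where "length cs = Suc (Suc k)" using assms by (metis add_2_eq_Suc le_Suc_ex)
  ultimately show ?thesis by (simp add: last_conv_nth deriv_coeffs_def)
qed

text \<open>A step of pseudo-division of \<open>p\<close> by \<open>q\<close>; the dividend is multiplied by the square of the leading
  coefficient of \<open>q\<close>, so that its sign is not changed.\<close>

definition cancel_lead ::
  "(real list \<Rightarrow> real) list \<Rightarrow> (real list \<Rightarrow> real) list \<Rightarrow> (real list \<Rightarrow> real) list" where
  "cancel_lead p q = map (\<lambda>i x. (last q x)\<^sup>2 * (p ! i) x -
     last q x * last p x * ((replicate (length p - length q) (\<lambda>_. 0) @ q) ! i) x) [0..<length p - 1]"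

lemma length_cancel_lead [simp]: "length (cancel_lead p q) = length p - 1"
  by (simp add: cancel_lead_def)

lemma poly_specialize_replicate_append:
  "poly (specialize (replicate k (\<lambda>_. 0) @ q) x) y = y ^ k * poly (specialize q x) y"
  by (induction k) simp_all

lemma specialize_cancel_lead:
  assumes "q \<noteq> []" "length q \<le> length p"
  shows "specialize (cancel_lead p q) x = smult ((last q x)\<^sup>2) (specialize p x) -
    smult (last q x * last p x) (specialize (replicate (length p - length q) (\<lambda>_. 0) @ q) x)"
proof (rule poly_eqI)
  fix i
  define r where "r = replicate (length p - length q) (\<lambda>_. 0) @ q"
  have r: "length r = length p" "last r = last q" "r \<noteq> []" "p \<noteq> []" using assms by (auto simp: r_def)
  consider (low) "i < length p - 1" | (top) "i = length p - 1" | (high) "length p \<le> i" by linarith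
  then show "coeff (specialize (cancel_lead p q) x) i = coeff (smult ((last q x)\<^sup>2) (specialize p x) -
    smult (last q x * last p x) (specialize r x)) i"
  proof cases
    case top
    then have "(p ! i) x = last p x" "(r ! i) x = last q x" "i < length p"
      using r by (simp_all add: last_conv_nth flip: r(2))
    then show ?thesis using r(1) top by (simp add: coeff_specialize power2_eq_square)
  qed (use r(1) in \<open>auto simp: coeff_specialize cancel_lead_def r_def\<close>)
qed

lemma sgn_poly_cancel_lead:
  assumes "q \<noteq> []" "length q \<le> length p" "last q x \<noteq> 0" "poly (specialize q x) y = 0"
  shows "sgn (poly (specialize p x) y) = sgn (poly (specialize (cancel_lead p q) x) y)"
proof -
  have "poly (specialize (cancel_lead p q) x) y = (last q x)\<^sup>2 * poly (specialize p x) y"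
    using assms by (simp add: specialize_cancel_lead poly_specialize_replicate_append)
  moreover have "sgn ((last q x)\<^sup>2) = 1" using assms(3) by (intro sgn_pos) simp
  ultimately show ?thesis by (simp only: sgn_mult mult_1_left)
qed

lemma poly_funs_cancel_lead:
  assumes p: "poly_funs N p" and q: "poly_funs N q" and "q \<noteq> []" "length q \<le> length p"
  shows "poly_funs N (cancel_lead p q)"
proof -
  let ?r = "replicate (length p - length q) (\<lambda>_. 0) @ q"
  have "poly_fun N (?r ! i)" if "i < length p" for i
    using that assms(4) q nth_mem[of i ?r] by (auto intro: pf_const simp del: nth_append)
  moreover have "poly_fun N (last p)" "poly_fun N (last q)"
    using assms by (cases "p = []"; auto)+
  ultimately show ?thesis
    using p by (auto simp: cancel_lead_def intro!: poly_fun_diff pf_mult poly_fun_power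
      simp del: nth_append)
qed

section \<open>Sign-determined relations\<close>

definition sign_determined :: "nat \<Rightarrow> (real list \<Rightarrow> real list \<Rightarrow> bool) \<Rightarrow> bool" where
  "sign_determined N R \<longleftrightarrow> (\<exists>G. finite G \<and> (\<forall>g\<in>G. poly_fun N g) \<and>
     (\<forall>u v. length u = N \<longrightarrow> length v = N \<longrightarrow> (\<forall>g\<in>G. sgn (g u) = sgn (g v)) \<longrightarrow> R u v))"

lemma sign_determined_sgn: "poly_fun N p \<Longrightarrow> sign_determined N (\<lambda>u v. sgn (p u) = sgn (p v))"
  unfolding sign_determined_def by (intro exI[of _ "{p}"]) simp

lemma sign_determined_mono:
  assumes "sign_determined N R" "\<And>u v. length u = N \<Longrightarrow> length v = N \<Longrightarrow> R u v \<Longrightarrow> R' u v"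
  shows "sign_determined N R'"
  using assms unfolding sign_determined_def by meson

lemma sign_determined_ball:
  assumes "finite I" "\<And>i. i \<in> I \<Longrightarrow> sign_determined N (R i)"
  shows "sign_determined N (\<lambda>u v. \<forall>i\<in>I. R i u v)"
proof -
  have "\<forall>i\<in>I. \<exists>G. finite G \<and> (\<forall>g\<in>G. poly_fun N g) \<and>
     (\<forall>u v. length u = N \<longrightarrow> length v = N \<longrightarrow> (\<forall>g\<in>G. sgn (g u) = sgn (g v)) \<longrightarrow> R i u v)"
    using assms(2) by (simp add: sign_determined_def)
  from bchoice[OF this] obtain G where "\<forall>i\<in>I. finite (G i) \<and> (\<forall>g\<in>G i. poly_fun N g) \<and>
     (\<forall>u v. length u = N \<longrightarrow> length v = N \<longrightarrow> (\<forall>g\<in>G i. sgn (g u) = sgn (g v)) \<longrightarrow> R i u v)" ..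
  then show ?thesis
    unfolding sign_determined_def using \<open>finite I\<close> by (intro exI[of _ "\<Union>i\<in>I. G i"]) auto
qed

lemma sign_determined_conj:
  assumes "sign_determined N R" "sign_determined N S" shows "sign_determined N (\<lambda>u v. R u v \<and> S u v)"
  using sign_determined_ball[of "{0, 1 :: nat}" N "\<lambda>i. if i = 0 then R else S"] assms by simp

abbreviation specializations ::
  "(real list \<Rightarrow> real) list set \<Rightarrow> real list \<Rightarrow> real list \<Rightarrow> (real poly \<times> real poly) set" where
  "specializations P x x' \<equiv> (\<lambda>cs. (specialize cs x, specialize cs x')) ` P"

lemma sign_equivalent_constants:
  assumes "\<And>cs. cs \<in> P \<Longrightarrow> length cs \<le> 1" "\<And>cs c. cs \<in> P \<Longrightarrow> c \<in> set cs \<Longrightarrow> sgn (c x) = sgn (c x')"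
  shows "sign_equivalent (specializations P x x')"
proof -
  have "sgn (poly (specialize cs x) y) = sgn (poly (specialize cs x') y')" if "cs \<in> P" for cs y y'
    using assms(1)[OF that] assms(2)[OF that] by (cases cs) auto
  then show ?thesis unfolding sign_equivalent_def by (intro exI[of _ "\<lambda>_. 0"]) (auto simp: mono_def)
qed

lemma sign_equivalent_butlast:
  assumes "cs \<in> P" "last cs x = 0" "last cs x' = 0"
    and "sign_equivalent (specializations (insert (butlast cs) (P - {cs})) x x')"
  shows "sign_equivalent (specializations P x x')"
proof -
  have "specializations (insert (butlast cs) (P - {cs})) x x' = specializations P x x'"
    using assms(1-3) by (auto simp: specialize_butlast)
  then show ?thesis using assms(4) by simp
qed

lemma sign_equivalent_cancel_lead:
  assumes P: "finite P" "p \<in> P" "2 \<le> length p" and longest: "\<And>cs. cs \<in> P \<Longrightarrow> length cs \<le> length p"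
    and lead: "\<And>cs. cs \<in> P - {[]} \<Longrightarrow> last cs x \<noteq> 0 \<and> last cs x' \<noteq> 0"
    and D: "D = insert (deriv_coeffs p) (P - {[], p})"
    and eq: "sign_equivalent (specializations (D \<union> cancel_lead p ` D) x x')"
  shows "sign_equivalent (specializations P x x')"
proof -
  have D_lead: "cs \<noteq> [] \<and> last cs x \<noteq> 0 \<and> last cs x' \<noteq> 0 \<and> length cs \<le> length p" if "cs \<in> D" for cs
  proof (cases "cs = deriv_coeffs p")
    case True
    then have "cs \<noteq> []" using P(3) by (simp add: deriv_coeffs_eq_Nil_iff)
    moreover have "p \<in> P - {[]}" using P(2,3) by auto
    ultimately show ?thesis using True lead[of p] P(3) by (simp add: last_deriv_coeffs)
  qed (use that lead longest in \<open>auto simp: D\<close>)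
  have "sign_equivalent (insert (specialize p x, specialize p x') (specializations D x x'))"
  proof (rule sign_equivalent_insert[OF eq])
    show "(pderiv (specialize p x), pderiv (specialize p x')) \<in> specializations D x x'"
      by (auto simp: D specialize_deriv_coeffs)
    show "finite (specializations D x x')" using P(1) by (simp add: D)
    show "0 \<notin> fst ` specializations D x x'" "0 \<notin> snd ` specializations D x x'"
      using D_lead by (auto dest!: sym[of 0] simp: specialize_nonzero)
    fix q q' assume "(q, q') \<in> specializations D x x'"
    then obtain cs where cs: "cs \<in> D" "q = specialize cs x" "q' = specialize cs x'" by auto
    then show "\<exists>(r, r')\<in>specializations (D \<union> cancel_lead p ` D) x x'.
        (\<forall>y. poly q y = 0 \<longrightarrow> sgn (poly (specialize p x) y) = sgn (poly r y)) \<and>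
        (\<forall>y. poly q' y = 0 \<longrightarrow> sgn (poly (specialize p x') y) = sgn (poly r' y))"
      using D_lead[OF cs(1)]
      by (intro bexI[of _ "(specialize (cancel_lead p cs) x, specialize (cancel_lead p cs) x')"])
        (auto intro: sgn_poly_cancel_lead)
  qed auto
  moreover have "(specialize cs x, specialize cs x') \<in>
      insert (0, 0) (insert (specialize p x, specialize p x') (specializations D x x'))"
    if "cs \<in> P" for cs
    using that by (cases "cs = []"; cases "cs = p") (simp_all add: D)
  ultimately show ?thesis by (rule sign_equivalent_subset[OF _ image_subsetI])
qed

lemma mult_less_than_replace:
  fixes h :: "'a \<Rightarrow> nat"
  assumes fin: "finite P" "finite Q" and p: "p \<in> P" and Q: "\<And>q. q \<in> Q \<Longrightarrow> q \<in> P - {p} \<or> h q < h p"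
  shows "(image_mset h (mset_set Q), image_mset h (mset_set P)) \<in> mult less_than"
proof -
  let ?kept = "Q \<inter> (P - {p})"
  have split: "image_mset h (mset_set X) =
    image_mset h (mset_set ?kept) + image_mset h (mset_set (X - ?kept))"
    if "finite X" "?kept \<subseteq> X" for X
    using that by (metis Diff_disjoint Un_Diff_cancel finite_Diff finite_subset image_mset_union
      mset_set_Union sup.absorb_iff2)
  have "(image_mset h (mset_set ?kept) + image_mset h (mset_set (Q - ?kept)),
      image_mset h (mset_set ?kept) + image_mset h (mset_set (P - ?kept))) \<in> mult less_than"
    by (rule one_step_implies_mult) (use fin p Q in \<open>auto simp: mset_set_empty_iff\<close>)
  moreover have "?kept \<subseteq> P" by auto
  ultimately show ?thesis using split[of P] split[of Q] fin by simp
qed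

abbreviation lengths :: "'a list set \<Rightarrow> nat multiset" where
  "lengths P \<equiv> image_mset length (mset_set P)"

lemma sign_determined_sign_equivalent_step:
  assumes P: "finite P" "\<forall>cs\<in>P. poly_funs N cs"
    and p: "p \<in> P" "2 \<le> length p" "\<And>cs. cs \<in> P \<Longrightarrow> length cs \<le> length p"
    and D: "D = insert (deriv_coeffs p) (P - {[], p})"
    and cancelled:
      "sign_determined N (\<lambda>x x'. sign_equivalent (specializations (D \<union> cancel_lead p ` D) x x'))"
    and truncated: "\<And>cs. cs \<in> P - {[]} \<Longrightarrow>
      sign_determined N
        (\<lambda>x x'. sign_equivalent (specializations (insert (butlast cs) (P - {cs})) x x'))"
  shows "sign_determined N (\<lambda>x x'. sign_equivalent (specializations P x x'))"
proof -
  have "sign_determined N (\<lambda>x x'. \<forall>cs\<in>P - {[]}. sgn (last cs x) = sgn (last cs x') \<and>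
      sign_equivalent (specializations (insert (butlast cs) (P - {cs})) x x'))"
    using P by (intro sign_determined_ball sign_determined_conj sign_determined_sgn truncated) auto
  from sign_determined_conj[OF cancelled this] show ?thesis
  proof (rule sign_determined_mono)
    fix x x'
    assume eq: "sign_equivalent (specializations (D \<union> cancel_lead p ` D) x x') \<and>
      (\<forall>cs\<in>P - {[]}. sgn (last cs x) = sgn (last cs x') \<and>
        sign_equivalent (specializations (insert (butlast cs) (P - {cs})) x x'))"
    then have lead: "last cs x = 0 \<longleftrightarrow> last cs x' = 0" if "cs \<in> P - {[]}" for cs
      using that by (metis sgn_zero_iff)
    show "sign_equivalent (specializations P x x')"
    proof (cases "\<exists>cs\<in>P - {[]}. last cs x = 0")
      case True
      then show ?thesis using eq lead sign_equivalent_butlast by blast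
    next
      case False
      then show ?thesis
        using sign_equivalent_cancel_lead[OF P(1) p(1,2) p(3) _ D] eq lead by blast
    qed
  qed
qed

theorem sign_determined_sign_equivalent:
  assumes "finite P" "\<forall>cs\<in>P. poly_funs N cs"
  shows "sign_determined N (\<lambda>x x'. sign_equivalent (specializations P x x'))"
  using assms
proof (induction "lengths P" arbitrary: P
    rule: wf_induct_rule[OF wf_mult[OF wf_less_than], consumes 0, case_names less])
  case (less P)
  show ?case
  proof (cases "\<forall>cs\<in>P. length cs \<le> 1")
    case True
    have "sign_determined N (\<lambda>x x'. \<forall>cs\<in>P. \<forall>c\<in>set cs. sgn (c x) = sgn (c x'))"
      using less.prems by (intro sign_determined_ball sign_determined_sgn) auto
    then show ?thesis by (rule sign_determined_mono)
      (use True in \<open>intro sign_equivalent_constants; blast\<close>)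
  next
    case False
    then have "Max (length ` P) \<in> length ` P" using less.prems(1) by (intro Max_in) auto
    then obtain p where "p \<in> P" "length p = Max (length ` P)" by auto
    then have p: "p \<in> P" "\<And>cs. cs \<in> P \<Longrightarrow> length cs \<le> length p" using less.prems(1) by simp_all
    have length_p: "2 \<le> length p" using False p(2) by fastforce
    define D where "D = insert (deriv_coeffs p) (P - {[], p})"
    have D: "poly_funs N cs \<and> cs \<noteq> [] \<and> length cs \<le> length p" if "cs \<in> D" for cs
      using that less.prems(2) p length_p
      by (cases "cs = deriv_coeffs p") (auto simp: D_def poly_funs_deriv_coeffs deriv_coeffs_eq_Nil_iff)
    show ?thesis
    proof (rule sign_determined_sign_equivalent_step[OF less.prems p(1) length_p p(2) D_def])
      show "sign_determined N (\<lambda>x x'. sign_equivalent (specializations (D \<union> cancel_lead p ` D) x x'))"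
      proof (rule less.hyps)
        show "(lengths (D \<union> cancel_lead p ` D), lengths P) \<in> mult less_than"
          by (rule mult_less_than_replace[where p = p])
            (use less.prems(1) p(1) length_p in \<open>auto simp: D_def dest!: arg_cong[of _ p length]\<close>)
        show "\<forall>cs\<in>D \<union> cancel_lead p ` D. poly_funs N cs"
          using D poly_funs_cancel_lead[of p N] less.prems(2) p(1) by blast
      qed (use less.prems(1) in \<open>simp add: D_def\<close>)
      fix cs assume cs: "cs \<in> P - {[]}"
      show "sign_determined N
          (\<lambda>x x'. sign_equivalent (specializations (insert (butlast cs) (P - {cs})) x x'))"
      proof (rule less.hyps)
        show "(lengths (insert (butlast cs) (P - {cs})), lengths P) \<in> mult less_than"
          by (rule mult_less_than_replace[where p = cs])
            (use less.prems(1) cs in \<open>auto dest!: arg_cong[of _ cs length]\<close>)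
        show "\<forall>ds\<in>insert (butlast cs) (P - {cs}). poly_funs N ds"
          using less.prems(2) cs by (auto dest: in_set_butlastD)
      qed (use less.prems(1) in simp)
    qed
  qed
qed

section \<open>The Tarski--Seidenberg theorem\<close>

lemma ex_specialize_add:
  assumes "poly_funs N a" "poly_funs N b"
  shows "\<exists>cs. poly_funs N cs \<and> (\<forall>x. specialize cs x = specialize a x + specialize b x)"
proof (rule ex_specialize_eq)
  show "poly_fun N (\<lambda>x. coeff (specialize a x + specialize b x) i)" for i
    using assms by (simp add: pf_add poly_fun_coeff_specialize)
  show "degree (specialize a x + specialize b x) \<le> max (length a) (length b)" for x
    by (intro degree_add_le) (simp_all add: degree_specialize_le le_max_iff_disj)
qed

lemma ex_specialize_mult:
  assumes "poly_funs N a" "poly_funs N b"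
  shows "\<exists>cs. poly_funs N cs \<and> (\<forall>x. specialize cs x = specialize a x * specialize b x)"
proof (rule ex_specialize_eq)
  show "poly_fun N (\<lambda>x. coeff (specialize a x * specialize b x) i)" for i
    unfolding coeff_mult using assms by (intro poly_fun_sum pf_mult poly_fun_coeff_specialize)
  show "degree (specialize a x * specialize b x) \<le> length a + length b" for x
    using degree_mult_le add_mono[OF degree_specialize_le degree_specialize_le] by (rule order_trans)
qed

lemma poly_fun_expand_last:
  assumes "poly_fun (Suc N) p"
  shows "\<exists>cs. poly_funs N cs \<and> (\<forall>x y. length x = N \<longrightarrow> p (x @ [y]) = poly (specialize cs x) y)"
  using assms
proof (induction rule: poly_fun.induct)
  case (pf_const c)
  show ?case by (intro exI[of _ "[\<lambda>_. c]"]) (simp add: poly_fun.pf_const)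
next
  case (pf_proj i)
  show ?case
  proof (cases "i < N")
    case True
    then show ?thesis by (intro exI[of _ "[\<lambda>x. x ! i]"]) (simp add: nth_append poly_fun.pf_proj)
  next
    case False
    then have "i = N" using pf_proj by simp
    then show ?thesis by (intro exI[of _ "[\<lambda>_. 0, \<lambda>_. 1]"]) (simp add: nth_append poly_fun.pf_const)
  qed
next
  case (pf_add p q)
  then obtain a b where "poly_funs N a" "poly_funs N b"
    and eq: "\<And>x y. length x = N \<Longrightarrow> p (x @ [y]) = poly (specialize a x) y"
      "\<And>x y. length x = N \<Longrightarrow> q (x @ [y]) = poly (specialize b x) y" by blast
  then show ?case using ex_specialize_add[of a N b] by force
next
  case (pf_mult p q)
  then obtain a b where "poly_funs N a" "poly_funs N b"
    and eq: "\<And>x y. length x = N \<Longrightarrow> p (x @ [y]) = poly (specialize a x) y"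
      "\<And>x y. length x = N \<Longrightarrow> q (x @ [y]) = poly (specialize b x) y" by blast
  then show ?case using ex_specialize_mult[of a N b] by force
qed

definition last_coeffs :: "nat \<Rightarrow> (real list \<Rightarrow> real) \<Rightarrow> (real list \<Rightarrow> real) list" where
  "last_coeffs N p = (SOME cs. poly_funs N cs \<and>
     (\<forall>x y. length x = N \<longrightarrow> p (x @ [y]) = poly (specialize cs x) y))"

lemma last_coeffs:
  assumes "poly_fun (Suc N) p"
  shows "poly_funs N (last_coeffs N p)"
    and "length x = N \<Longrightarrow> poly (specialize (last_coeffs N p) x) y = p (x @ [y])"
proof -
  have "poly_funs N (last_coeffs N p) \<and>
    (\<forall>x y. length x = N \<longrightarrow> p (x @ [y]) = poly (specialize (last_coeffs N p) x) y)"
    unfolding last_coeffs_def by (rule someI_ex[OF poly_fun_expand_last[OF assms]])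
  then show "poly_funs N (last_coeffs N p)"
    and "length x = N \<Longrightarrow> poly (specialize (last_coeffs N p) x) y = p (x @ [y])" by simp_all
qed

lemma sign_determinedE_positivity:
  assumes "sign_determined N R"
  obtains gs where "gs \<noteq> []" "poly_funs N gs"
    "\<And>u v. length u = N \<Longrightarrow> length v = N \<Longrightarrow> \<forall>g\<in>set gs. 0 < g u \<longleftrightarrow> 0 < g v \<Longrightarrow> R u v"
proof -
  obtain G where G: "finite G" "\<forall>g\<in>G. poly_fun N g"
    and R: "\<And>u v. length u = N \<Longrightarrow> length v = N \<Longrightarrow> \<forall>g\<in>G. sgn (g u) = sgn (g v) \<Longrightarrow> R u v"
    using assms unfolding sign_determined_def by blast
  obtain gs where gs: "set gs = insert (\<lambda>_. 0) (G \<union> (\<lambda>g x. - g x) ` G)"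
    using finite_list[of "insert (\<lambda>_. 0) (G \<union> (\<lambda>g x. - g x) ` G)"] G(1) by auto
  show thesis
  proof (rule that)
    show "gs \<noteq> []" using gs by auto
    show "poly_funs N gs" using G(2) by (auto simp: gs intro: pf_const poly_fun_uminus)
    fix u v :: "real list"
    assume len: "length u = N" "length v = N" and pos: "\<forall>g\<in>set gs. 0 < g u \<longleftrightarrow> 0 < g v"
    have "sgn (g u) = sgn (g v)" if "g \<in> G" for g
    proof -
      have mem: "g \<in> set gs" "(\<lambda>x. - g x) \<in> set gs" using that by (simp_all add: gs)
      have "0 < g u \<longleftrightarrow> 0 < g v" "0 < - g u \<longleftrightarrow> 0 < - g v"
        using bspec[OF pos mem(1)] bspec[OF pos mem(2)] by simp_all
      then show ?thesis by (auto simp: sgn_if)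
    qed
    then show "R u v" using R[OF len] by blast
  qed
qed

abbreviation sign_definable :: "nat \<Rightarrow> (real list \<Rightarrow> bool) \<Rightarrow> bool" where
  "sign_definable N P \<equiv> sign_determined N (\<lambda>u v. P u \<longleftrightarrow> P v)"

lemma sign_definable_sgn: "poly_fun N p \<Longrightarrow> sign_definable N (\<lambda>x. Q (sgn (p x)))"
  by (rule sign_determined_mono[OF sign_determined_sgn]) (assumption, simp only:)

lemma sign_definable_conj:
  assumes "sign_definable N P" "sign_definable N Q" shows "sign_definable N (\<lambda>x. P x \<and> Q x)"
  by (rule sign_determined_mono[OF sign_determined_conj[OF assms]]) auto

lemma sign_definable_mem_semialg_set: "semialg_set N S \<Longrightarrow> sign_definable N (\<lambda>x. x \<in> S)"
proof (induction rule: semialg_set.induct)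
  case (sa_basic p)
  show ?case
    by (rule sign_determined_mono[OF sign_definable_sgn[OF sa_basic, of "\<lambda>s. s = 1"]])
      (simp add: sgn_1_pos)
next
  case (sa_compl S)
  show ?case by (rule sign_determined_mono[OF sa_compl.IH]) simp
next
  case (sa_union S T)
  show ?case by (rule sign_determined_mono[OF sign_determined_conj[OF sa_union.IH]]) simp
next
  case (sa_inter S T)
  show ?case by (rule sign_determined_mono[OF sign_determined_conj[OF sa_inter.IH]]) simp
qed

lemma sign_definable_ex_last:
  assumes "sign_definable (Suc N) P" shows "sign_definable N (\<lambda>x. \<exists>y. P (x @ [y]))"
proof -
  obtain G where G: "finite G" "\<forall>g\<in>G. poly_fun (Suc N) g"
    and P: "\<And>u v. length u = Suc N \<Longrightarrow> length v = Suc N \<Longrightarrow> \<forall>g\<in>G. sgn (g u) = sgn (g v) \<Longrightarrow> P u \<longleftrightarrow> P v"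
    using assms unfolding sign_determined_def by blast
  have "sign_determined N (\<lambda>x x'. sign_equivalent (specializations (last_coeffs N ` G) x x'))"
    using G by (intro sign_determined_sign_equivalent) (auto dest: last_coeffs(1))
  then show ?thesis
  proof (rule sign_determined_mono)
    fix x x' :: "real list" assume len: "length x = N" "length x' = N"
    assume "sign_equivalent (specializations (last_coeffs N ` G) x x')"
    then obtain i i' :: "real \<Rightarrow> real" where range: "range i = range i'"
      and sgn: "\<And>g y y'. g \<in> G \<Longrightarrow> i y = i' y' \<Longrightarrow>
        sgn (poly (specialize (last_coeffs N g) x) y) = sgn (poly (specialize (last_coeffs N g) x') y')"
      unfolding sign_equivalent_def by force
    have "P (x @ [y]) \<longleftrightarrow> P (x' @ [y'])" if "i y = i' y'" for y y'
      using sgn[OF _ that] len G(2) by (intro P) (simp_all add: last_coeffs(2))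
    moreover have "\<exists>y'. i y = i' y'" "\<exists>y. i y = i' y'" for y y' using range by (metis rangeE rangeI)+
    ultimately show "(\<exists>y. P (x @ [y])) \<longleftrightarrow> (\<exists>y. P (x' @ [y]))" by metis
  qed
qed

lemma sign_definable_ex:
  assumes "sign_definable (N + k) P" shows "sign_definable N (\<lambda>x. \<exists>y. length y = k \<and> P (x @ y))"
  using assms
proof (induction k arbitrary: N)
  case (Suc k)
  have "sign_definable (Suc N) (\<lambda>x. \<exists>y. length y = k \<and> P (x @ y))"
    using Suc.IH[of "Suc N"] Suc.prems by simp
  from sign_definable_ex_last[OF this]
  have "sign_definable N (\<lambda>x. \<exists>y1 y. length y = k \<and> P (x @ y1 # y))" by simp
  moreover have "(\<exists>y1 y. length y = k \<and> P (x @ y1 # y)) \<longleftrightarrow> (\<exists>y. length y = Suc k \<and> P (x @ y))" for x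
    by (auto simp: length_Suc_conv)
  ultimately show ?case by simp
qed simp

lemma sign_definable_select:
  assumes "sign_definable N P" "\<And>i. i < N \<Longrightarrow> e i < N'"
  shows "sign_definable N' (\<lambda>w. P (map (\<lambda>i. w ! e i) [0..<N]))"
proof -
  let ?sel = "\<lambda>w. map (\<lambda>i. w ! e i) [0..<N]"
  obtain G where G: "finite G" "\<forall>g\<in>G. poly_fun N g"
    and P: "\<And>u v. length u = N \<Longrightarrow> length v = N \<Longrightarrow> \<forall>g\<in>G. sgn (g u) = sgn (g v) \<Longrightarrow> P u \<longleftrightarrow> P v"
    using assms(1) unfolding sign_determined_def by blast
  have "sign_determined N' (\<lambda>u v. \<forall>g\<in>G. sgn (g (?sel u)) = sgn (g (?sel v)))"
    using G assms(2) by (intro sign_determined_ball sign_determined_sgn poly_fun_select) auto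
  then show ?thesis by (rule sign_determined_mono) (intro P; simp)
qed

lemma semialg_fun_length: "semialg_fun m n F \<Longrightarrow> length x = m \<Longrightarrow> length (F x) = n"
  by (simp add: semialg_fun_def)

lemma sign_definable_graph:
  assumes "semialg_fun m n F" shows "sign_definable (m + n) (\<lambda>w. w \<in> {x @ F x | x. length x = m})"
  using assms by (intro sign_definable_mem_semialg_set) (simp add: semialg_fun_def)

lemma sign_determined_sgn_semialg_fun:
  assumes F: "semialg_fun m n F" and h: "poly_fun (m + n) h"
  shows "sign_determined m (\<lambda>u v. sgn (h (u @ F u)) = sgn (h (v @ F v)))"
proof -
  let ?R = "\<lambda>\<sigma> x. \<exists>y. length y = n \<and> x @ y \<in> {x @ F x | x. length x = m} \<and> sgn (h (x @ y)) = \<sigma>"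
  have iff: "?R \<sigma> x \<longleftrightarrow> sgn (h (x @ F x)) = \<sigma>" if "length x = m" for \<sigma> x
    using that semialg_fun_length[OF F that] by auto
  have "sign_determined m (\<lambda>u v. \<forall>\<sigma>\<in>{- 1, 0, 1}. ?R \<sigma> u \<longleftrightarrow> ?R \<sigma> v)"
    by (intro sign_determined_ball sign_definable_ex sign_definable_conj sign_definable_graph[OF F]
      sign_definable_sgn[OF h]) simp
  then show ?thesis
  proof (rule sign_determined_mono)
    fix u v :: "real list" assume len: "length u = m" "length v = m"
    assume "\<forall>\<sigma>\<in>{- 1, 0, 1}. ?R \<sigma> u \<longleftrightarrow> ?R \<sigma> v"
    then have "\<forall>\<sigma>\<in>{- 1, 0, 1}. sgn (h (u @ F u)) = \<sigma> \<longleftrightarrow> sgn (h (v @ F v)) = \<sigma>"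
      unfolding iff[OF len(1)] iff[OF len(2)] .
    then show "sgn (h (u @ F u)) = sgn (h (v @ F v))" by (auto simp: sgn_if split: if_splits)
  qed
qed

lemma sign_determined_sgn_component:
  assumes F: "semialg_fun m n F" and cs: "poly_funs m cs" and i: "i < n"
  shows "sign_determined m (\<lambda>u v. sgn (poly (specialize cs u) (F u ! i)) =
    sgn (poly (specialize cs v) (F v ! i)))"
proof -
  have "poly_fun (m + n) (\<lambda>w. poly (specialize cs w) (w ! (m + i)))"
    using cs i by (intro poly_fun_poly_specialize pf_proj) (auto intro: poly_fun_mono)
  from sign_determined_sgn_semialg_fun[OF F this] show ?thesis
    by (rule sign_determined_mono) (simp add: specialize_append[OF cs] nth_append)
qed

lemma sign_definable_component_graph:
  assumes F: "semialg_fun m n F" and i: "i < n"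
  shows "sign_definable (Suc m) (\<lambda>w. w ! m = F (take m w) ! i)"
proof -
  let ?drop = "\<lambda>w. map (\<lambda>k. w ! (if k < m then k else Suc k)) [0..<m + n]"
  let ?R = "\<lambda>w. ?drop w \<in> {x @ F x | x. length x = m} \<and> sgn (w ! m - w ! (Suc m + i)) = 0"
  have "sign_definable (Suc m + n) ?R"
    using i by (intro sign_definable_conj sign_definable_select[OF sign_definable_graph[OF F]]
      sign_definable_sgn poly_fun_diff pf_proj) auto
  then have R: "sign_definable (Suc m) (\<lambda>w. \<exists>y. length y = n \<and> ?R (w @ y))" by (rule sign_definable_ex)
  have iff: "(\<exists>y. length y = n \<and> ?R (w @ y)) \<longleftrightarrow> w ! m = F (take m w) ! i" if w: "length w = Suc m" for w
  proof -
    have "?drop (w @ y) = take m w @ y" if "length y = n" for y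
      using w that by (intro nth_equalityI) (auto simp: nth_append)
    then have "?R (w @ y) \<longleftrightarrow> y = F (take m w) \<and> w ! m = y ! i" if "length y = n" for y
      using w that by (auto simp: nth_append sgn_zero_iff)
    then have "(\<exists>y. length y = n \<and> ?R (w @ y)) \<longleftrightarrow> (\<exists>y. length y = n \<and> y = F (take m w) \<and> w ! m = y ! i)"
      by blast
    then show ?thesis using semialg_fun_length[OF F, of "take m w"] w by simp
  qed
  show ?thesis by (rule sign_determined_mono[OF R]) (simp only: iff)
qed

section \<open>Isolating the values of a semialgebraic function\<close>

definition sign_compat :: "real \<Rightarrow> real \<Rightarrow> bool" where
  "sign_compat a b \<longleftrightarrow> (0 < a \<longrightarrow> 0 \<le> b) \<and> (a < 0 \<longrightarrow> b \<le> 0) \<and> (a = 0 \<longrightarrow> b = 0)"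

lemma sign_compat_between:
  assumes "sign_compat a b" "t \<in> closed_segment a b" shows "sign_compat a t"
  using assms by (auto simp: sign_compat_def closed_segment_eq_real_ivl split: if_splits)

lemma poly_between_if_sign_compat_pderiv:
  assumes d: "\<And>u. u \<in> closed_segment c y \<Longrightarrow> sign_compat (poly (pderiv p) c) (poly (pderiv p) u)"
    and t: "t \<in> closed_segment c y"
  shows "poly p t \<in> closed_segment (poly p c) (poly p y)"
proof -
  have seg: "closed_segment c y = {min c y..max c y}"
    by (simp add: closed_segment_eq_real_ivl min_def max_def)
  consider (increasing) "\<And>u. u \<in> {min c y..max c y} \<Longrightarrow> 0 \<le> poly (pderiv p) u"
    | (decreasing) "\<And>u. u \<in> {min c y..max c y} \<Longrightarrow> poly (pderiv p) u \<le> 0"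
    using d unfolding seg sign_compat_def by (metis linorder_cases order_refl)
  then show ?thesis
  proof cases
    case increasing
    have "poly p a \<le> poly p b" if "min c y \<le> a" "a \<le> b" "b \<le> max c y" for a b
      by (rule deriv_nonneg_imp_mono[OF poly_DERIV]) (use that increasing in auto)
    then have "poly p (min c y) \<le> poly p t" "poly p t \<le> poly p (max c y)" using t unfolding seg by auto
    then show ?thesis by (auto simp: closed_segment_eq_real_ivl min_def max_def split: if_splits)
  next
    case decreasing
    have "poly (- p) a \<le> poly (- p) b" if "min c y \<le> a" "a \<le> b" "b \<le> max c y" for a b
      by (rule deriv_nonneg_imp_mono[OF poly_DERIV]) (use that decreasing in \<open>auto simp: pderiv_minus\<close>)
    from this[of "min c y" t] this[of t "max c y"]
    have "poly p (max c y) \<le> poly p t" "poly p t \<le> poly p (min c y)" using t unfolding seg by simp_all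
    then show ?thesis by (auto simp: closed_segment_eq_real_ivl min_def max_def split: if_splits)
  qed
qed

lemma sign_compat_on_segment:
  fixes \<F> :: "real poly set"
  assumes closed: "\<And>p. p \<in> \<F> \<Longrightarrow> pderiv p \<in> \<F>"
    and compat: "\<And>p. p \<in> \<F> \<Longrightarrow> sign_compat (poly p c) (poly p y)"
    and "p \<in> \<F>" "t \<in> closed_segment c y"
  shows "sign_compat (poly p c) (poly p t)"
  using assms(3,4)
proof (induction "degree p" arbitrary: p t rule: less_induct)
  case less
  show ?case
  proof (cases "degree p = 0")
    case True
    then obtain a where "p = [:a:]" by (metis degree_eq_zeroE)
    then show ?thesis by (simp add: sign_compat_def)
  next
    case False
    then have "degree (pderiv p) < degree p" by (simp add: degree_pderiv)
    then have "poly p t \<in> closed_segment (poly p c) (poly p y)"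
      using less closed by (intro poly_between_if_sign_compat_pderiv) blast+
    then show ?thesis using compat[OF less.prems(1)] by (rule sign_compat_between[rotated])
  qed
qed

theorem Thom_lemma:
  fixes \<F> :: "real poly set"
  assumes closed: "\<And>p. p \<in> \<F> \<Longrightarrow> pderiv p \<in> \<F>"
    and compat: "\<And>p. p \<in> \<F> \<Longrightarrow> sign_compat (poly p c) (poly p y)"
    and g: "g \<in> \<F>" "g \<noteq> 0" "poly g c = 0"
  shows "y = c"
proof (rule ccontr)
  assume "y \<noteq> c"
  then have "infinite (closed_segment c y)" by (auto simp: closed_segment_eq_real_ivl infinite_Icc_iff)
  moreover have "closed_segment c y \<subseteq> {t. poly g t = 0}"
    using sign_compat_on_segment[OF closed compat g(1)] g(3) by (auto simp: sign_compat_def)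
  ultimately show False using poly_roots_finite[OF g(2)] finite_subset by blast
qed

lemma eventually_sgn_poly_eq:
  fixes p :: "real poly"
  assumes "p = 0 \<or> poly p c \<noteq> 0" shows "\<forall>\<^sub>F y in at c. sgn (poly p y) = sgn (poly p c)"
proof -
  have lim: "(poly p \<longlongrightarrow> poly p c) (at c)" using poly_isCont[of c p] unfolding isCont_def .
  consider (zero) "p = 0" | (pos) "0 < poly p c" | (neg) "poly p c < 0" using assms by linarith
  then show ?thesis
  proof cases
    case pos
    then show ?thesis using order_tendstoD(1)[OF lim pos] by (auto elim: eventually_mono)
  next
    case neg
    then show ?thesis using order_tendstoD(2)[OF lim neg] by (auto elim: eventually_mono)
  qed simp
qed

lemma ex_deriv_closed_superset:
  assumes "finite \<C>" "\<forall>cs\<in>\<C>. poly_funs N cs"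
  obtains \<D> where "finite \<D>" "\<C> \<subseteq> \<D>" "\<forall>cs\<in>\<D>. poly_funs N cs" "\<forall>cs\<in>\<D>. deriv_coeffs cs \<in> \<D>"
proof
  define derivs where "derivs cs = (\<lambda>k. (deriv_coeffs ^^ k) cs) ` {..length cs}"
    for cs :: "(real list \<Rightarrow> real) list"
  have self: "cs \<in> derivs cs" for cs unfolding derivs_def by (rule image_eqI[of _ _ 0]) simp_all
  have length: "length ((deriv_coeffs ^^ k) cs) = length cs - k" for k cs by (induction k) auto
  have "poly_funs N ((deriv_coeffs ^^ k) cs)" if "poly_funs N cs" for k cs
    using that by (induction k) (simp_all add: poly_funs_deriv_coeffs)
  then show "\<forall>cs\<in>\<Union> (derivs ` \<C>). poly_funs N cs" using assms(2) by (auto simp: derivs_def)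
  have "deriv_coeffs ds \<in> derivs cs" if ds: "ds \<in> derivs cs" for ds cs
  proof -
    obtain k where k: "k \<le> length cs" "ds = (deriv_coeffs ^^ k) cs" using ds by (auto simp: derivs_def)
    show ?thesis
    proof (cases "k = length cs")
      case True
      then have "ds = []" using k length[of k cs] by simp
      then have "deriv_coeffs ds = ds" by (simp add: deriv_coeffs_def)
      then show ?thesis using ds by simp
    next
      case False
      then have "deriv_coeffs ds = (deriv_coeffs ^^ Suc k) cs" "Suc k \<le> length cs" using k by auto
      then show ?thesis unfolding derivs_def by blast
    qed
  qed
  then show "\<forall>ds\<in>\<Union> (derivs ` \<C>). deriv_coeffs ds \<in> \<Union> (derivs ` \<C>)" by blast
  show "finite (\<Union> (derivs ` \<C>))" using assms(1) by (simp add: derivs_def)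
  show "\<C> \<subseteq> \<Union> (derivs ` \<C>)" using self by blast
qed

text \<open>If all the nonzero polynomials defining the graph of \<open>x \<mapsto> F x ! i\<close> were nonzero at a point of
  it, then their signs would not change nearby.\<close>

lemma ex_vanishing_family:
  assumes F: "semialg_fun m n F" and i: "i < n"
  obtains \<C> where "finite \<C>" "\<forall>cs\<in>\<C>. poly_funs m cs"
    "\<And>x. length x = m \<Longrightarrow> \<exists>cs\<in>\<C>. specialize cs x \<noteq> 0 \<and> poly (specialize cs x) (F x ! i) = 0"
proof -
  obtain G where G: "finite G" "\<forall>g\<in>G. poly_fun (Suc m) g"
    and graph: "\<And>u v. length u = Suc m \<Longrightarrow> length v = Suc m \<Longrightarrow> \<forall>g\<in>G. sgn (g u) = sgn (g v) \<Longrightarrow>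
      u ! m = F (take m u) ! i \<longleftrightarrow> v ! m = F (take m v) ! i"
    using sign_definable_component_graph[OF F i] unfolding sign_determined_def by blast
  have "\<exists>cs\<in>last_coeffs m ` G. specialize cs x \<noteq> 0 \<and> poly (specialize cs x) (F x ! i) = 0"
    if x: "length x = m" for x
  proof (rule ccontr)
    let ?p = "\<lambda>g. specialize (last_coeffs m g) x" and ?c = "F x ! i"
    assume "\<not> ?thesis"
    then have "\<forall>\<^sub>F y in at ?c. sgn (poly (?p g) y) = sgn (poly (?p g) ?c)" if "g \<in> G" for g
      using that by (intro eventually_sgn_poly_eq) auto
    then have "\<forall>\<^sub>F y in at ?c. \<forall>g\<in>G. sgn (g (x @ [y])) = sgn (g (x @ [?c]))"
      using G x by (simp add: eventually_ball_finite last_coeffs(2))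
    then have "\<forall>\<^sub>F y in at ?c. y = ?c"
    proof (rule eventually_mono)
      fix y assume "\<forall>g\<in>G. sgn (g (x @ [y])) = sgn (g (x @ [?c]))"
      then show "y = ?c" using graph[of "x @ [y]" "x @ [?c]"] x by (simp add: nth_append)
    qed
    moreover have "\<forall>\<^sub>F y in at ?c. y \<noteq> ?c" by (simp add: eventually_at_filter)
    ultimately have "\<forall>\<^sub>F y in at ?c. False" by eventually_elim blast
    then show False by simp
  qed
  then show thesis using G by (intro that[of "last_coeffs m ` G"]) (auto dest: last_coeffs(1))
qed

section \<open>Flows on the unit interval\<close>

lemma nondecreasing_if_derivative_within_nonneg:
  fixes g :: "real \<Rightarrow> real"
  assumes D: "\<And>u. u \<in> {s..t} \<Longrightarrow> (g has_real_derivative D u) (at u within {s..t})"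
    and nonneg: "\<And>u. s < u \<Longrightarrow> u < t \<Longrightarrow> 0 \<le> D u" and "s \<le> t"
  shows "g s \<le> g t"
proof (cases "s = t")
  case False
  then have "s < t" using \<open>s \<le> t\<close> by simp
  then obtain u where u: "u \<in> {s<..<t}" "g t - g s = (t - s) * D u"
    using mvt_simple[of s t g "\<lambda>u h. h * D u"] D
    by (auto simp: has_field_derivative_def mult_commute_abs)
  then have "0 \<le> g t - g s" using nonneg[of u] \<open>s < t\<close> by simp
  then show ?thesis by simp
qed simp

lemma zero_if_derivative_towards_zero:
  fixes e :: "real \<Rightarrow> real"
  assumes D: "\<And>u. u \<in> {s..t} \<Longrightarrow> (e has_real_derivative D u) (at u within {s..t})"
    and towards: "\<And>u. s < u \<Longrightarrow> u < t \<Longrightarrow> e u * D u \<le> 0" and "s \<le> t" "e s = 0"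
  shows "e t = 0"
proof -
  have "- (e s)\<^sup>2 \<le> - (e t)\<^sup>2"
  proof (rule nondecreasing_if_derivative_within_nonneg[where g = "\<lambda>u. - (e u)\<^sup>2"])
    show "((\<lambda>u. - (e u)\<^sup>2) has_real_derivative - (2 * (e u * D u))) (at u within {s..t})"
      if "u \<in> {s..t}" for u
      by (rule derivative_eq_intros D that refl)+ simp
  qed (use towards \<open>s \<le> t\<close> in \<open>auto simp: mult.commute\<close>)
  then show ?thesis using \<open>e s = 0\<close> by simp
qed

lemma has_derivative_zero_if_dominated:
  fixes g r :: "real \<Rightarrow> real"
  assumes r: "(r has_real_derivative 0) (at x within S)" and le: "\<And>v. v \<in> S \<Longrightarrow> \<bar>g v - g x\<bar> \<le> \<bar>r v - r x\<bar>"
  shows "(g has_real_derivative 0) (at x within S)"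
  unfolding has_field_derivative_iff
proof (rule tendsto_0_le[where K = 1])
  show "((\<lambda>v. (r v - r x) / (v - x)) \<longlongrightarrow> 0) (at x within S)" using r
    by (simp add: has_field_derivative_iff)
  show "\<forall>\<^sub>F v in at x within S. norm ((g v - g x) / (v - x)) \<le> norm ((r v - r x) / (v - x)) * 1"
    by (auto simp: eventually_at_filter le divide_right_mono)
qed

lemma inverse_power_has_derivative:
  fixes f x :: real
  assumes "x < f" "0 < n"
  shows "((\<lambda>y. inverse ((f - y) ^ n)) has_real_derivative n / (f - x) ^ Suc n) (at x within S)"
proof -
  have "((\<lambda>y. inverse ((f - y) ^ n)) has_real_derivative
      - (inverse ((f - x) ^ n) * (real n * (f - x) ^ (n - 1) * - 1) * inverse ((f - x) ^ n)))
        (at x within S)"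
    using assms by (auto intro!: derivative_eq_intros)
  moreover have "- (inverse (r ^ n) * (real n * r ^ (n - 1) * - 1) * inverse (r ^ n)) = n / r ^ Suc n"
    if "0 < r" for r
    using that assms(2) by (cases n) (simp_all add: field_simps)
  ultimately show ?thesis using assms by simp
qed

definition ramp :: "real \<Rightarrow> real" where
  "ramp u = u\<^sup>2 * (3 - 2 * u)"

definition ramp_rate :: "real \<Rightarrow> real" where
  "ramp_rate u = 6 * u * (1 - u)"

lemma ramp_0 [simp]: "ramp 0 = 0" and ramp_1 [simp]: "ramp 1 = 1"
  by (simp_all add: ramp_def)

lemma ramp_nonneg: "u \<in> {0..1} \<Longrightarrow> 0 \<le> ramp u"
  by (simp add: ramp_def)

lemma ramp_pos: "0 < u \<Longrightarrow> u \<le> 1 \<Longrightarrow> 0 < ramp u"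
  by (simp add: ramp_def)

lemma ramp_rate_nonneg: "u \<in> {0..1} \<Longrightarrow> 0 \<le> ramp_rate u"
  by (simp add: ramp_rate_def)

lemma ramp_has_derivative: "(ramp has_real_derivative ramp_rate u) (at u within S)"
  unfolding ramp_def ramp_rate_def
  by (auto intro!: derivative_eq_intros simp: power2_eq_square algebra_simps)

text \<open>The factor \<open>ramp_rate\<close> lets every flow start and end at rest, so that flows in different
  components can follow each other differentiably.\<close>

definition flows :: "(real \<Rightarrow> real \<Rightarrow> real) \<Rightarrow> (real \<Rightarrow> real) \<Rightarrow> bool" where
  "flows h y \<longleftrightarrow> (\<forall>u\<in>{0..1}. (y has_real_derivative ramp_rate u * h (y u) u) (at u within {0..1}))"

definition steers :: "(real \<Rightarrow> real \<Rightarrow> real) \<Rightarrow> real \<Rightarrow> real \<Rightarrow> bool" where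
  "steers h y0 y1 \<longleftrightarrow> (\<exists>y. y 0 = y0 \<and> y 1 = y1 \<and> flows h y) \<and> (\<forall>y. y 0 = y0 \<longrightarrow> flows h y \<longrightarrow> y 1 = y1)"

lemma steersD: "steers h y0 y1 \<Longrightarrow> flows h y \<Longrightarrow> y 0 = y0 \<Longrightarrow> y 1 = y1"
  by (simp add: steers_def)

lemma steers_const: "steers (\<lambda>_ _. c) y0 (y0 + c)"
  unfolding steers_def
proof (intro conjI exI[of _ "\<lambda>u. y0 + c * ramp u"] allI impI)
  show "flows (\<lambda>_ _. c) (\<lambda>u. y0 + c * ramp u)"
    unfolding flows_def by (auto intro!: derivative_eq_intros ramp_has_derivative)
  fix y assume y: "y 0 = y0" "flows (\<lambda>_ _. c) y"
  have "\<exists>e. \<forall>u\<in>{0..1}. y u - c * ramp u = e"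
  proof (rule has_field_derivative_zero_constant)
    fix u :: real assume "u \<in> {0..1}"
    then have "(y has_real_derivative ramp_rate u * c) (at u within {0..1})"
      using y(2) by (simp add: flows_def)
    then show "((\<lambda>u. y u - c * ramp u) has_real_derivative 0) (at u within {0..1})"
      by (auto intro!: derivative_eq_intros ramp_has_derivative)
  qed simp
  then obtain e where "\<And>u. u \<in> {0..1} \<Longrightarrow> y u - c * ramp u = e" by blast
  from this[of 0] this[of 1] show "y 1 = y0 + c" using y(1) by simp
qed simp_all

section \<open>Sweeping up to an unknown zero\<close>

definition sweep_field :: "(real \<Rightarrow> real) \<Rightarrow> real \<Rightarrow> nat \<Rightarrow> real \<Rightarrow> real \<Rightarrow> real \<Rightarrow> real" where
  "sweep_field q A n T y u = T * q y / (q y + max 0 (y - A + 1 - T * ramp u) ^ (n + 2))"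

lemma sweep_field_bounds:
  assumes "0 \<le> T" "0 \<le> q y" shows "0 \<le> sweep_field q A n T y u" "sweep_field q A n T y u \<le> T"
proof -
  have ratio: "0 \<le> r / (r + s) \<and> r / (r + s) \<le> 1" if "0 \<le> r" "0 \<le> s" for r s :: real
    using that by (auto simp: divide_le_eq_1)
  have "0 \<le> max 0 (y - A + 1 - T * ramp u) ^ (n + 2)" by simp
  note r = ratio[OF assms(2) this]
  then show "0 \<le> sweep_field q A n T y u"
    using assms(1) unfolding sweep_field_def times_divide_eq_right[symmetric]
    by (intro mult_nonneg_nonneg) simp_all
  show "sweep_field q A n T y u \<le> T"
    using mult_left_mono[OF conjunct2[OF r] assms(1)] by (simp add: sweep_field_def)
qed

locale sweep =
  fixes q :: "real \<Rightarrow> real" and A f L k :: real and n :: nat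
  assumes continuous: "continuous_on UNIV q" and zero: "q f = 0" and pos: "\<And>y. y \<noteq> f \<Longrightarrow> 0 < q y"
    and A_less: "A < f" and L: "0 < L" and k: "0 < k" and n: "0 < n"
    and upper: "\<And>y. A \<le> y \<Longrightarrow> y \<le> f \<Longrightarrow> q y \<le> L * (f - y)"
    and lower: "\<And>y. A \<le> y \<Longrightarrow> y \<le> f \<Longrightarrow> k * (f - y) ^ Suc n \<le> q y"
begin

lemma q_nonneg: "0 \<le> q y"
  using pos[of y] zero by (cases "y = f") (auto intro: less_imp_le)

definition inverse_integral :: "real \<Rightarrow> real" where
  "inverse_integral y = integral {A..y} (\<lambda>t. 1 / q t)"

lemma inverse_integral_A: "inverse_integral A = 0"
  by (simp add: inverse_integral_def)

lemma inverse_integral_has_derivative: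
  assumes "A \<le> y" "y < f" shows "(inverse_integral has_real_derivative 1 / q y) (at y within {A..})"
proof -
  define b where "b = (y + f) / 2"
  have b: "y < b" "b < f" using assms by (auto simp: b_def)
  have "q t \<noteq> 0" if "t \<le> b" for t using pos[of t] b that by force
  then have "continuous_on {A..b} (\<lambda>t. 1 / q t)"
    by (intro continuous_intros continuous_on_subset[OF continuous]) auto
  then have "(inverse_integral has_real_derivative 1 / q y) (at y within {A..b})"
    unfolding inverse_integral_def by (rule integral_has_real_derivative) (use assms b in auto)
  moreover have "at y within {A..b} = at y within {A..}"
    by (rule at_within_nhd[of _ "{..<b}"]) (use b in auto)
  ultimately show ?thesis by simp
qed

lemma inverse_integral_has_derivative_subset:
  "A \<le> y \<Longrightarrow> y < f \<Longrightarrow> S \<subseteq> {A..} \<Longrightarrow> (inverse_integral has_real_derivative 1 / q y) (at y within S)"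
  using inverse_integral_has_derivative by (rule has_field_derivative_subset)

lemma inverse_integral_ge: assumes "A \<le> y" "y < f"
  shows "(ln (f - A) - ln (f - y)) / L \<le> inverse_integral y"
proof -
  have "inverse_integral A + ln (f - A) / L \<le> inverse_integral y + ln (f - y) / L"
  proof (rule nondecreasing_if_derivative_within_nonneg
      [where g = "\<lambda>y. inverse_integral y + ln (f - y) / L"])
    fix x assume x: "x \<in> {A..y}"
    then show "((\<lambda>y. inverse_integral y + ln (f - y) / L) has_real_derivative
      1 / q x - 1 / (L * (f - x))) (at x within {A..y})"
      using assms L by (auto intro!: derivative_eq_intros inverse_integral_has_derivative_subset
        simp: mult.commute)
  next
    fix x assume x: "A < x" "x < y"
    then have "1 / (L * (f - x)) \<le> 1 / q x"
      using upper[of x] pos[of x] assms L by (intro divide_left_mono mult_pos_pos) auto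
    then show "0 \<le> 1 / q x - 1 / (L * (f - x))" by simp
  qed (use assms in auto)
  then show ?thesis by (simp add: inverse_integral_A diff_divide_distrib)
qed

lemma inverse_integral_nonneg: assumes "A \<le> y" "y < f" shows "0 \<le> inverse_integral y"
proof -
  have "0 \<le> (ln (f - A) - ln (f - y)) / L" using assms L by simp
  then show ?thesis using inverse_integral_ge[OF assms] by linarith
qed

lemma inverse_integral_le: assumes "A \<le> y" "y < f" shows "k * n * (f - y) ^ n * inverse_integral y \<le> 1"
proof -
  define g where "g y = inverse ((f - y) ^ n) / (k * n)" for y
  have "g A - inverse_integral A \<le> g y - inverse_integral y"
  proof (rule nondecreasing_if_derivative_within_nonneg[where g = "\<lambda>y. g y - inverse_integral y"])
    fix x assume x: "x \<in> {A..y}"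
    then have "(g has_real_derivative n / (f - x) ^ Suc n / (k * n)) (at x within {A..y})"
      unfolding g_def using assms n by (intro DERIV_cdivide inverse_power_has_derivative) simp_all
    moreover have "n / (f - x) ^ Suc n / (k * n) = 1 / (k * (f - x) ^ Suc n)" using n
      by (simp del: power_Suc)
    moreover have "(inverse_integral has_real_derivative 1 / q x) (at x within {A..y})"
      using x assms by (intro inverse_integral_has_derivative_subset) auto
    ultimately show "((\<lambda>y. g y - inverse_integral y) has_real_derivative
      1 / (k * (f - x) ^ Suc n) - 1 / q x) (at x within {A..y})"
      by (metis DERIV_diff)
  next
    fix x assume x: "A < x" "x < y"
    then have "1 / q x \<le> 1 / (k * (f - x) ^ Suc n)"
      using lower[of x] pos[of x] assms k by (intro divide_left_mono mult_pos_pos) auto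
    then show "0 \<le> 1 / (k * (f - x) ^ Suc n) - 1 / q x" by simp
  qed (use assms in auto)
  moreover have "0 \<le> g A" using A_less k by (simp add: g_def)
  ultimately have "inverse_integral y \<le> g y" by (simp add: inverse_integral_A)
  then show ?thesis using assms k n by (simp add: g_def field_simps)
qed

lemma inverse_integral_at_top: "filterlim inverse_integral at_top (at_left f)"
proof (rule filterlim_at_top_mono)
  have "filterlim (\<lambda>y. f - y) (at_right 0) (at_left f)"
    unfolding filterlim_at by (auto simp: eventually_at_filter intro!: tendsto_eq_intros)
  then have "filterlim (\<lambda>y. - ln (f - y)) at_top (at_left f)"
    by (intro filterlim_compose[OF filterlim_uminus_at_top_at_bot] filterlim_compose[OF ln_at_0])
  then have "filterlim (\<lambda>y. (1 / L) * (ln (f - A) + - ln (f - y))) at_top (at_left f)"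
    using L by (intro filterlim_tendsto_pos_mult_at_top[OF tendsto_const]
      filterlim_tendsto_add_at_top[OF tendsto_const]) auto
  then show "filterlim (\<lambda>y. (ln (f - A) - ln (f - y)) / L) at_top (at_left f)" by simp
  show "\<forall>\<^sub>F y in at_left f. (ln (f - A) - ln (f - y)) / L \<le> inverse_integral y"
    by (rule eventually_at_leftI[OF _ A_less]) (auto intro!: inverse_integral_ge)
qed

text \<open>The slack \<open>w = y - A + 1 - t\<close> of a solution of \<open>y' = q y / (q y + w\<^sup>n\<^sup>+\<^sup>2)\<close>, as a function of
  \<open>y\<close>: it solves \<open>slack_at' = - slack_at\<^sup>n\<^sup>+\<^sup>2 / q\<close> with \<open>slack_at A = 1\<close>.\<close>

definition slack_at :: "real \<Rightarrow> real" where
  "slack_at y = (1 + Suc n * inverse_integral y) powr (- 1 / Suc n)"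

lemma slack_at_base_pos: "A \<le> y \<Longrightarrow> y < f \<Longrightarrow> 0 < 1 + Suc n * inverse_integral y"
  using inverse_integral_nonneg[of y] by (intro add_pos_nonneg mult_nonneg_nonneg) simp_all

lemma slack_at_A: "slack_at A = 1"
  by (simp add: slack_at_def inverse_integral_A)

lemma slack_at_pos: "A \<le> y \<Longrightarrow> y < f \<Longrightarrow> 0 < slack_at y"
  using slack_at_base_pos[of y] by (simp add: slack_at_def)

lemma slack_at_power: assumes "A \<le> y" "y < f"
  shows "slack_at y ^ Suc n = 1 / (1 + Suc n * inverse_integral y)"
proof -
  have "slack_at y ^ Suc n = slack_at y powr Suc n" using slack_at_pos[OF assms]
    by (simp add: powr_realpow del: power_Suc of_nat_Suc)
  also have "\<dots> = (1 + Suc n * inverse_integral y) powr (- 1)"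
    by (simp add: slack_at_def powr_powr del: of_nat_Suc)
  also have "\<dots> = 1 / (1 + Suc n * inverse_integral y)" using slack_at_base_pos[OF assms]
    by (simp add: powr_minus divide_inverse)
  finally show ?thesis .
qed

lemma slack_at_has_derivative:
  assumes "A \<le> y" "y < f"
  shows "(slack_at has_real_derivative - (slack_at y ^ (n + 2)) / q y) (at y within {A..})"
proof -
  have "((\<lambda>y. 1 + Suc n * inverse_integral y) has_real_derivative Suc n * (1 / q y))
    (at y within {A..})"
    by (auto intro!: derivative_eq_intros inverse_integral_has_derivative assms)
  from DERIV_chain2[OF has_real_derivative_powr[OF slack_at_base_pos[OF assms], of "- 1 / Suc n"] this]
  have "(slack_at has_real_derivative
    (- 1 / Suc n) * (1 + Suc n * inverse_integral y) powr (- 1 / Suc n - 1) * (Suc n * (1 / q y)))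
      (at y within {A..})"
    unfolding slack_at_def .
  moreover have "(1 + Suc n * inverse_integral y) powr (- 1 / Suc n - 1) =
    slack_at y * slack_at y ^ Suc n"
    unfolding slack_at_power[OF assms] using slack_at_base_pos[OF assms]
    by (simp add: powr_diff slack_at_def)
  ultimately show ?thesis by (simp del: of_nat_Suc)
qed

lemma slack_at_tendsto: "(slack_at \<longlongrightarrow> 0) (at_left f)"
  unfolding slack_at_def
proof (rule tendsto_neg_powr)
  show "filterlim (\<lambda>y. 1 + Suc n * inverse_integral y) at_top (at_left f)"
    by (intro filterlim_tendsto_add_at_top[OF tendsto_const]
      filterlim_tendsto_pos_mult_at_top[OF tendsto_const _ inverse_integral_at_top]) simp
qed simp

lemma distance_ratio_power_le:
  assumes "A \<le> y" "y < f"
  shows "((f - y) / slack_at y) ^ Suc n \<le> (f - y) ^ Suc n + Suc n / (k * n) * (f - y)"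
proof -
  have "(f - y) ^ n * inverse_integral y \<le> 1 / (k * n)"
    using inverse_integral_le[OF assms] k n
    by (simp add: pos_le_divide_eq mult.commute mult.left_commute)
  then have "Suc n * (f - y) * ((f - y) ^ n * inverse_integral y) \<le> Suc n * (f - y) * (1 / (k * n))"
    using assms by (intro mult_left_mono) simp_all
  moreover have "((f - y) / slack_at y) ^ Suc n =
    (f - y) ^ Suc n + Suc n * (f - y) * ((f - y) ^ n * inverse_integral y)"
    by (simp add: power_divide slack_at_power[OF assms] distrib_left del: power_Suc of_nat_Suc)
      (simp add: mult_ac)
  ultimately show ?thesis using k n by simp
qed

lemma distance_ratio_tendsto: "((\<lambda>y. (f - y) / slack_at y) \<longlongrightarrow> 0) (at_left f)"
proof -
  have ev: "\<forall>\<^sub>F y in at_left f. A \<le> y \<and> y < f" by (rule eventually_at_leftI[OF _ A_less]) auto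
  have nonneg: "0 \<le> (f - y) / slack_at y" if "A \<le> y \<and> y < f" for y
    using that slack_at_pos[of y] by simp
  have "((\<lambda>y. ((f - y) / slack_at y) ^ Suc n) \<longlongrightarrow> 0) (at_left f)"
  proof (rule tendsto_sandwich)
    show "\<forall>\<^sub>F y in at_left f. 0 \<le> ((f - y) / slack_at y) ^ Suc n"
      using ev by eventually_elim (intro zero_le_power nonneg)
    show "\<forall>\<^sub>F y in at_left f. ((f - y) / slack_at y) ^ Suc n \<le>
      (f - y) ^ Suc n + Suc n / (k * n) * (f - y)"
      using ev by eventually_elim (intro distance_ratio_power_le; simp)
    show "((\<lambda>y. (f - y) ^ Suc n + Suc n / (k * n) * (f - y)) \<longlongrightarrow> 0) (at_left f)"
      using k n by (auto intro!: tendsto_eq_intros)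
  qed simp
  from tendsto_real_root[OF this, of "Suc n"]
  have "((\<lambda>y. root (Suc n) (((f - y) / slack_at y) ^ Suc n)) \<longlongrightarrow> 0) (at_left f)" by simp
  then show ?thesis
  proof (rule Lim_transform_eventually)
    show "\<forall>\<^sub>F y in at_left f. root (Suc n) (((f - y) / slack_at y) ^ Suc n) = (f - y) / slack_at y"
      using ev by eventually_elim (intro real_root_power_cancel nonneg; simp)
  qed
qed

end

subsection \<open>Every solution ends at the zero\<close>

locale sweep_solution = sweep +
  fixes T :: real and z :: "real \<Rightarrow> real"
  assumes T: "f - A + 1 < T" and z_0: "z 0 = A" and z_flows: "flows (sweep_field q A n T) z"
begin

definition slack :: "real \<Rightarrow> real" where
  "slack u = z u - A + 1 - T * ramp u"

lemma T_pos: "0 < T"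
  using T A_less by linarith

lemma field_bounds: "0 \<le> sweep_field q A n T y u" "sweep_field q A n T y u \<le> T"
  using sweep_field_bounds q_nonneg T_pos by auto

lemma z_has_derivative:
  assumes "u \<in> {s..t}" "0 \<le> s" "t \<le> 1"
  shows "(z has_real_derivative ramp_rate u * sweep_field q A n T (z u) u) (at u within {s..t})"
proof (rule has_field_derivative_subset)
  show "(z has_real_derivative ramp_rate u * sweep_field q A n T (z u) u) (at u within {0..1})"
    using z_flows assms by (auto simp: flows_def)
qed (use assms in auto)

lemma slack_has_derivative:
  assumes "u \<in> {s..t}" "0 \<le> s" "t \<le> 1"
  shows "(slack has_real_derivative ramp_rate u * (sweep_field q A n T (z u) u - T))
    (at u within {s..t})"
  unfolding slack_def
  by (rule derivative_eq_intros ramp_has_derivative z_has_derivative assms refl)+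
    (simp add: algebra_simps)

lemma z_mono: "0 \<le> s \<Longrightarrow> s \<le> t \<Longrightarrow> t \<le> 1 \<Longrightarrow> z s \<le> z t"
  by (rule nondecreasing_if_derivative_within_nonneg[where g = z, OF z_has_derivative])
    (auto intro!: mult_nonneg_nonneg ramp_rate_nonneg field_bounds)

lemma slack_antimono: assumes "0 \<le> s" "s \<le> t" "t \<le> 1" shows "slack t \<le> slack s"
proof -
  have "- slack s \<le> - slack t"
    by (rule nondecreasing_if_derivative_within_nonneg
        [where g = "\<lambda>u. - slack u", OF DERIV_minus[OF slack_has_derivative]])
      (use assms in \<open>auto intro!: mult_nonneg_nonpos ramp_rate_nonneg simp: field_bounds\<close>)
  then show ?thesis by simp
qed

lemma z_continuous: "continuous_on {0..1} z"
  using z_has_derivative[of _ 0 1] by (intro DERIV_continuous_on) auto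

lemma slack_minus_slack_at_has_derivative:
  assumes u: "u \<in> {0..t}" "t \<le> 1" and below: "\<And>v. v \<in> {0..t} \<Longrightarrow> A \<le> z v \<and> z v < f"
  shows "((\<lambda>u. slack u - slack_at (z u)) has_real_derivative
    ramp_rate u * T / (q (z u) + max 0 (slack u) ^ (n + 2)) *
    (slack_at (z u) ^ (n + 2) - max 0 (slack u) ^ (n + 2))) (at u within {0..t})"
proof -
  define g M V where "g = q (z u)" and "M = max 0 (slack u) ^ (n + 2)"
    and "V = slack_at (z u) ^ (n + 2)"
  have zu: "A \<le> z u" "z u < f" using below u by auto
  have g: "0 < g" "0 \<le> M" using pos[of "z u"] zu by (simp_all add: g_def M_def)
  have field: "sweep_field q A n T (z u) u = T * g / (g + M)"
    by (simp add: sweep_field_def slack_def g_def M_def)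
  have Dz: "(z has_real_derivative ramp_rate u * (T * g / (g + M))) (at u within {0..t})"
    using z_has_derivative[of u 0 t] u by (simp add: field)
  have "(slack_at has_real_derivative - V / g) (at (z u) within z ` {0..t})"
    unfolding V_def g_def using slack_at_has_derivative[OF zu]
    by (rule has_field_derivative_subset) (use below in auto)
  from DERIV_image_chain[OF this Dz]
  have "((\<lambda>u. slack_at (z u)) has_real_derivative - V / g * (ramp_rate u * (T * g / (g + M))))
    (at u within {0..t})"
    by (simp add: o_def)
  from DERIV_diff[OF slack_has_derivative[of u 0 t] this]
  have "((\<lambda>u. slack u - slack_at (z u)) has_real_derivative ramp_rate u * (T * g / (g + M) - T) -
      - V / g * (ramp_rate u * (T * g / (g + M)))) (at u within {0..t})" using u by (simp add: field)
  moreover have "ramp_rate u * (T * g / (g + M) - T) - - V / g * (ramp_rate u * (T * g / (g + M))) =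
      ramp_rate u * T / (g + M) * (V - M)"
  proof -
    define r where "r = T / (g + M)"
    have r: "T * g / (g + M) = r * g" "ramp_rate u * T / (g + M) = ramp_rate u * r" "T = r * g + r * M"
      using g by (simp_all add: r_def flip: distrib_left add_divide_distrib)
    show ?thesis unfolding r(1,2) by (subst r(3)) (use g in \<open>simp add: field_simps\<close>)
  qed
  ultimately show ?thesis by (simp add: g_def M_def V_def)
qed

text \<open>The flow pulls the slack towards \<open>slack_at\<close>, with which it agrees at the beginning.\<close>

lemma slack_eq_slack_at:
  assumes t: "t \<in> {0..1}" "z t < f" shows "slack t = slack_at (z t)"
proof -
  have below: "A \<le> z v \<and> z v < f" if "v \<in> {0..t}" for v
    using z_mono[of 0 v] z_mono[of v t] z_0 that t by auto
  have towards: "(w - V) * (V ^ (n + 2) - max 0 w ^ (n + 2)) \<le> 0" if "0 \<le> V" for w V :: real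
  proof (cases "V \<le> w")
    case True
    then have "V ^ (n + 2) \<le> max 0 w ^ (n + 2)" using that by (intro power_mono) auto
    then show ?thesis using True by (intro mult_nonneg_nonpos) simp_all
  next
    case False
    then have "max 0 w ^ (n + 2) \<le> V ^ (n + 2)" using that by (intro power_mono) auto
    then show ?thesis using False by (intro mult_nonpos_nonneg) simp_all
  qed
  have "slack t - slack_at (z t) = 0"
  proof (rule zero_if_derivative_towards_zero
      [where e = "\<lambda>u. slack u - slack_at (z u)", OF slack_minus_slack_at_has_derivative])
    fix u assume u: "0 < u" "u < t"
    have "0 \<le> ramp_rate u * T / (q (z u) + max 0 (slack u) ^ (n + 2))"
      using u t T_pos q_nonneg
      by (intro divide_nonneg_nonneg mult_nonneg_nonneg ramp_rate_nonneg add_nonneg_nonneg) auto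
    moreover have "(slack u - slack_at (z u)) *
        (slack_at (z u) ^ (n + 2) - max 0 (slack u) ^ (n + 2)) \<le> 0"
      using below[of u] u slack_at_pos by (intro towards) (auto intro: less_imp_le)
    ultimately show "(slack u - slack_at (z u)) *
      (ramp_rate u * T / (q (z u) + max 0 (slack u) ^ (n + 2)) *
        (slack_at (z u) ^ (n + 2) - max 0 (slack u) ^ (n + 2))) \<le> 0"
      by (metis mult.left_commute mult_nonneg_nonpos)
  qed (use t below in \<open>auto simp: slack_def z_0 slack_at_A\<close>)
  then show ?thesis by simp
qed

lemma reaches_zero: "f \<le> z 1"
proof (rule ccontr)
  assume "\<not> ?thesis"
  then have "z 1 < f" by simp
  then have "0 < slack 1" using slack_eq_slack_at[of 1] slack_at_pos[of "z 1"] z_mono[of 0 1] z_0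
    by simp
  then show False using \<open>z 1 < f\<close> T by (simp add: slack_def)
qed

lemma slack_nonpos_at_first_hit:
  assumes t: "0 < t" "t \<le> 1" "z t = f" and before: "\<And>u. 0 \<le> u \<Longrightarrow> u < t \<Longrightarrow> z u < f"
  shows "slack t \<le> 0"
proof (rule tendsto_lowerbound)
  have ev: "\<forall>\<^sub>F u in at_left t. 0 \<le> u \<and> u < t" by (rule eventually_at_leftI[OF _ t(1)]) auto
  have "(z \<longlongrightarrow> z t) (at t within {0..t})"
    using continuous_on_subset[OF z_continuous, of "{0..t}"] t by (auto simp: continuous_on_def)
  moreover have "\<forall>\<^sub>F u in at_left t. z u < f" using ev by eventually_elim (simp add: before)
  ultimately have "filterlim z (at_left f) (at_left t)"
    unfolding filterlim_at using t by (auto simp: at_within_Icc_at_left elim: eventually_mono)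
  then show "((\<lambda>u. slack_at (z u)) \<longlongrightarrow> 0) (at_left t)" by (rule filterlim_compose[OF slack_at_tendsto])
  show "\<forall>\<^sub>F u in at_left t. slack t \<le> slack_at (z u)"
    using ev
  proof eventually_elim
    case (elim u)
    then show ?case using slack_antimono[of u t] slack_eq_slack_at[of u] before[of u] t by simp
  qed
qed simp

lemma ex_first_and_last_hit:
  assumes "f < z 1"
  obtains r s where "0 < r" "r \<le> s" "s < 1" "z r = f" "z s = f"
    "\<And>u. 0 \<le> u \<Longrightarrow> u < r \<Longrightarrow> z u < f" "\<And>u. s < u \<Longrightarrow> u \<le> 1 \<Longrightarrow> f < z u"
proof -
  define H where "H = {0..1} \<inter> z -` {f}"
  have H_iff: "u \<in> H \<longleftrightarrow> 0 \<le> u \<and> u \<le> 1 \<and> z u = f" for u by (auto simp: H_def)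
  have "closed H" unfolding H_def by (intro continuous_closed_preimage z_continuous) simp_all
  then have H: "compact H" using compact_Int_closed[of "{0..1}" H]
    by (simp add: H_def compact_Icc Int_assoc)
  have "H \<noteq> {}" using IVT'[of z 0 f 1] z_continuous z_0 A_less assms by (auto simp: H_def)
  from compact_attains_inf[OF H this] obtain r where r: "r \<in> H" "\<And>u. u \<in> H \<Longrightarrow> r \<le> u" by blast
  from compact_attains_sup[OF H \<open>H \<noteq> {}\<close>] obtain s where s: "s \<in> H" "\<And>u. u \<in> H \<Longrightarrow> u \<le> s" by blast
  have "r \<noteq> 0" "s \<noteq> 1" using r(1) s(1) z_0 A_less assms by (auto simp: H_iff)
  then have rs: "0 < r" "r \<le> s" "s < 1" "z r = f" "z s = f" using r s by (simp_all add: H_iff)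
  have "z u < f" if "0 \<le> u" "u < r" for u
    using z_mono[of u r] r(2)[of u] that rs by (auto simp: H_iff less_le)
  moreover have "f < z u" if "s < u" "u \<le> 1" for u
    using z_mono[of s u] s(2)[of u] that rs by (auto simp: H_iff less_le)
  ultimately show thesis using rs that by blast
qed

text \<open>Beyond \<open>f\<close> the slack is used up and \<open>z\<close> moves at full speed. A derivative cannot jump to full
  speed from the value \<open>0\<close> that it has when \<open>z = f\<close>.\<close>

lemma ends_at_zero: "z 1 = f"
proof (rule ccontr)
  assume "z 1 \<noteq> f"
  then have "f < z 1" using reaches_zero by simp
  then obtain r s where rs: "0 < r" "r \<le> s" "s < 1" "z r = f" "z s = f"
    and before: "\<And>u. 0 \<le> u \<Longrightarrow> u < r \<Longrightarrow> z u < f" and after: "\<And>u. s < u \<Longrightarrow> u \<le> 1 \<Longrightarrow> f < z u"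
    by (rule ex_first_and_last_hit) blast
  have "slack r \<le> 0" using rs before by (intro slack_nonpos_at_first_hit) auto
  then have "slack u \<le> 0" if "s \<le> u" "u \<le> 1" for u
    using slack_antimono[of r u] that rs by simp
  then have full_speed: "sweep_field q A n T (z u) u = T" if "s < u" "u \<le> 1" for u
    using pos[of "z u"] after[OF that] that by (simp add: sweep_field_def slack_def max_absorb1)
  have "slack s \<le> slack u" if "s \<le> u" "u \<le> 1" for u
    by (rule nondecreasing_if_derivative_within_nonneg[where g = slack, OF slack_has_derivative])
      (use that rs full_speed in auto)
  then have slack_constant: "slack u - slack s = 0" if "s \<le> u" "u \<le> 1" for u
    using slack_antimono[of s u] that rs by (simp add: antisym)
  have "(slack has_real_derivative 0) (at s within {s..1})"
    by (rule has_derivative_zero_if_dominated[where r = "\<lambda>_. 0", OF DERIV_const])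
      (subst slack_constant; simp)
  moreover have "(slack has_real_derivative - ramp_rate s * T) (at s within {s..1})"
    using slack_has_derivative[of s s 1] rs zero by (simp add: sweep_field_def)
  moreover have "at s within {s..1} \<noteq> bot" using rs by (simp add: at_within_Icc_at_right)
  ultimately have "ramp_rate s * T = 0" using has_field_derivative_unique by fastforce
  then show False using rs T_pos by (simp add: ramp_rate_def)
qed

end

subsection \<open>A solution\<close>

context sweep
begin

definition arrival_time :: "real \<Rightarrow> real" where
  "arrival_time y = y - A + 1 - (if y < f then slack_at y else 0)"

lemma arrival_time_A: "arrival_time A = 0" and arrival_time_f: "arrival_time f = f - A + 1"
  using A_less by (simp_all add: arrival_time_def slack_at_A)

lemma arrival_time_has_derivative:
  assumes y: "A \<le> y" "y < f"
  shows "(arrival_time has_real_derivative (q y + slack_at y ^ (n + 2)) / q y) (at y within {A..})"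
proof -
  have "((\<lambda>y. y - A + 1 - slack_at y) has_real_derivative (q y + slack_at y ^ (n + 2)) / q y)
    (at y within {A..})"
    using pos[of y] y by (auto intro!: derivative_eq_intros slack_at_has_derivative
      simp: add_divide_distrib)
  then show ?thesis
    by (rule has_field_derivative_transform_within[where d = "f - y"])
      (use y in \<open>auto simp: arrival_time_def dist_real_def\<close>)
qed

lemma arrival_time_continuous: "continuous_on {A..f} arrival_time"
  unfolding continuous_on_def
proof
  fix y assume y: "y \<in> {A..f}"
  show "(arrival_time \<longlongrightarrow> arrival_time y) (at y within {A..f})"
  proof (cases "y < f")
    case True
    then have "(arrival_time \<longlongrightarrow> arrival_time y) (at y within {A..})"
      using DERIV_continuous[OF arrival_time_has_derivative] y by (simp add: continuous_within)
    then show ?thesis by (rule tendsto_within_subset) auto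
  next
    case False
    then have "y = f" using y by simp
    have "((\<lambda>y. y - A + 1 - slack_at y) \<longlongrightarrow> f - A + 1 - 0) (at_left f)"
      by (intro tendsto_intros slack_at_tendsto)
    moreover have "\<forall>\<^sub>F y in at_left f. y - A + 1 - slack_at y = arrival_time y"
      by (rule eventually_at_leftI[OF _ A_less]) (auto simp: arrival_time_def)
    ultimately have "(arrival_time \<longlongrightarrow> f - A + 1 - 0) (at_left f)" by (rule Lim_transform_eventually)
    then show ?thesis using A_less by (simp add: \<open>y = f\<close> arrival_time_f at_within_Icc_at_left)
  qed
qed

lemma slack_at_antimono: assumes "A \<le> s" "s \<le> t" "t < f" shows "slack_at t \<le> slack_at s"
proof -
  have "- slack_at s \<le> - slack_at t"
  proof (rule nondecreasing_if_derivative_within_nonneg[where g = "\<lambda>y. - slack_at y"])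
    fix y assume "y \<in> {s..t}"
    then show "((\<lambda>y. - slack_at y) has_real_derivative - (- (slack_at y ^ (n + 2)) / q y))
      (at y within {s..t})"
      using assms by (intro DERIV_minus has_field_derivative_subset[OF slack_at_has_derivative]) auto
  next
    fix y assume "s < y" "y < t"
    then show "0 \<le> - (- (slack_at y ^ (n + 2)) / q y)"
      using slack_at_pos[of y] q_nonneg[of y] assms by simp
  qed (use assms in simp)
  then show ?thesis by simp
qed

lemma arrival_time_expanding: assumes "A \<le> x" "x \<le> y" "y \<le> f"
  shows "y - x \<le> arrival_time y - arrival_time x"
  using slack_at_antimono[of x y] slack_at_pos[of x] assms by (auto simp: arrival_time_def)

definition position :: "real \<Rightarrow> real" where
  "position \<tau> = the_inv_into {A..f} arrival_time (min \<tau> (f - A + 1))"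

lemma position: assumes "0 \<le> \<tau>"
  shows "position \<tau> \<in> {A..f}" "arrival_time (position \<tau>) = min \<tau> (f - A + 1)"
proof -
  have inj: "inj_on arrival_time {A..f}"
  proof (rule linorder_inj_onI)
    show "arrival_time x \<noteq> arrival_time y" if "x < y" "x \<in> {A..f}" "y \<in> {A..f}" for x y
      using arrival_time_expanding[of x y] that by simp
  qed auto
  have "\<exists>y. A \<le> y \<and> y \<le> f \<and> arrival_time y = min \<tau> (f - A + 1)"
    using IVT'[of arrival_time A "min \<tau> (f - A + 1)" f] assms A_less
      arrival_time_continuous arrival_time_A arrival_time_f by auto
  then have "min \<tau> (f - A + 1) \<in> arrival_time ` {A..f}" by force
  then show "position \<tau> \<in> {A..f}" "arrival_time (position \<tau>) = min \<tau> (f - A + 1)"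
    unfolding position_def using the_inv_into_into[OF inj] f_the_inv_into_f[OF inj] by blast+
qed

lemma position_eqI: "0 \<le> \<tau> \<Longrightarrow> y \<in> {A..f} \<Longrightarrow> arrival_time y = min \<tau> (f - A + 1) \<Longrightarrow> position \<tau> = y"
  using position[of \<tau>] arrival_time_expanding[of "position \<tau>" y]
    arrival_time_expanding[of y "position \<tau>"] by force

lemma position_0: "position 0 = A"
  using A_less by (intro position_eqI) (simp_all add: arrival_time_A)

lemma position_f: "f - A + 1 \<le> \<tau> \<Longrightarrow> position \<tau> = f"
  using A_less by (intro position_eqI) (simp_all add: arrival_time_f)

lemma position_less: "0 \<le> \<tau> \<Longrightarrow> \<tau> < f - A + 1 \<Longrightarrow> position \<tau> < f"
  using position[of \<tau>] arrival_time_f by (cases "position \<tau> = f") auto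

lemma position_Lipschitz: assumes "0 \<le> s" "s \<le> t" shows "\<bar>position t - position s\<bar> \<le> t - s"
  using position[of s] position[of t] arrival_time_expanding[of "position s" "position t"]
    arrival_time_expanding[of "position t" "position s"] assms
  by (cases "position s \<le> position t") (auto simp: min_def split: if_splits)

lemma position_isCont: assumes "0 < \<tau>" shows "isCont position \<tau>"
proof -
  have "1-lipschitz_on {0..} position"
  proof (rule lipschitz_onI)
    show "dist (position s) (position t) \<le> 1 * dist s t" if "s \<in> {0..}" "t \<in> {0..}" for s t
      using position_Lipschitz[of s t] position_Lipschitz[of t s] that
      by (cases "s \<le> t") (auto simp: dist_real_def)
  qed simp
  then have "continuous_on {0..} position" by (rule lipschitz_on_continuous_on)
  then show ?thesis by (rule continuous_on_interior) (use assms in simp)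
qed

lemma position_has_derivative:
  assumes "0 < \<tau>" "\<tau> < f - A + 1"
  shows "(position has_real_derivative
    q (position \<tau>) / (q (position \<tau>) + slack_at (position \<tau>) ^ (n + 2))) (at \<tau>)"
proof -
  have position_\<tau>: "A < position \<tau>" "position \<tau> < f"
    using position[of \<tau>] position_less[of \<tau>] arrival_time_A assms by (cases "position \<tau> = A"; auto)+
  have "at (position \<tau>) within {A..} = at (position \<tau>)" using position_\<tau>
    by (intro at_within_interior) simp
  then have arrival_deriv: "(arrival_time has_real_derivative
    (q (position \<tau>) + slack_at (position \<tau>) ^ (n + 2)) / q (position \<tau>)) (at (position \<tau>))"
    using arrival_time_has_derivative[of "position \<tau>"] position_\<tau> by simp
  have "0 < q (position \<tau>)" "0 < slack_at (position \<tau>) ^ (n + 2)"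
    using pos[of "position \<tau>"] slack_at_pos[of "position \<tau>"] position_\<tau> by simp_all
  then have "(position has_real_derivative
    inverse ((q (position \<tau>) + slack_at (position \<tau>) ^ (n + 2)) / q (position \<tau>))) (at \<tau>)"
    by (intro DERIV_inverse_function[OF arrival_deriv _ assms _ position_isCont])
      (use position(2) assms in auto)
  then show ?thesis by simp
qed

lemma position_has_derivative_end: "(position has_real_derivative 0) (at (f - A + 1))"
proof -
  let ?T = "f - A + 1"
  have T_pos: "0 < ?T" and position_T: "position ?T = f" using A_less by (simp_all add: position_f)
  have ev: "\<forall>\<^sub>F \<tau> in at_left ?T. 0 < \<tau> \<and> \<tau> < ?T" by (rule eventually_at_leftI[OF _ T_pos]) auto
  have "(position \<longlongrightarrow> f) (at_left ?T)"
    using position_isCont[OF T_pos] unfolding isCont_def position_T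
    by (rule filterlim_mono[OF _ order_refl at_le]) simp
  moreover have "\<forall>\<^sub>F \<tau> in at_left ?T. position \<tau> < f" using ev
    by eventually_elim (simp add: position_less)
  ultimately have "filterlim position (at_left f) (at_left ?T)"
    unfolding filterlim_at by (auto elim: eventually_mono)
  then have ratio: "((\<lambda>\<tau>. (f - position \<tau>) / slack_at (position \<tau>)) \<longlongrightarrow> 0) (at_left ?T)"
    by (rule filterlim_compose[OF distance_ratio_tendsto])
  have bounds: "0 \<le> (position \<tau> - position ?T) / (\<tau> - ?T) \<and>
    (position \<tau> - position ?T) / (\<tau> - ?T) \<le> (f - position \<tau>) / slack_at (position \<tau>)"
    if \<tau>: "0 < \<tau> \<and> \<tau> < ?T" for \<tau>
  proof -
    have z: "A \<le> position \<tau>" "position \<tau> < f" "arrival_time (position \<tau>) = \<tau>"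
      using position[of \<tau>] position_less[of \<tau>] \<tau> by simp_all
    have slack_at: "0 < slack_at (position \<tau>)" using slack_at_pos z by blast
    have "(position \<tau> - position ?T) / (\<tau> - ?T) = (f - position \<tau>) / (?T - \<tau>)"
      unfolding position_T by (metis minus_diff_eq minus_divide_divide)
    also have "?T - \<tau> = (f - position \<tau>) + slack_at (position \<tau>)" using z
      by (simp add: arrival_time_def)
    finally have "(position \<tau> - position ?T) / (\<tau> - ?T) =
      (f - position \<tau>) / ((f - position \<tau>) + slack_at (position \<tau>))" .
    moreover have "(f - position \<tau>) / ((f - position \<tau>) + slack_at (position \<tau>)) \<le>
      (f - position \<tau>) / slack_at (position \<tau>)"
      using z slack_at by (intro divide_left_mono) auto
    ultimately show ?thesis using z slack_at by simp
  qed
  have "((\<lambda>\<tau>. (position \<tau> - position ?T) / (\<tau> - ?T)) \<longlongrightarrow> 0) (at_left ?T)"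
    by (rule tendsto_sandwich[OF _ _ tendsto_const ratio])
      (use ev bounds in \<open>auto elim!: eventually_mono\<close>)
  moreover have "((\<lambda>\<tau>. (position \<tau> - position ?T) / (\<tau> - ?T)) \<longlongrightarrow> 0) (at_right ?T)"
  proof (rule Lim_transform_eventually[OF tendsto_const])
    show "\<forall>\<^sub>F \<tau> in at_right ?T. 0 = (position \<tau> - position ?T) / (\<tau> - ?T)"
      by (rule eventually_at_rightI[of _ "?T + 1"]) (auto simp: position_f)
  qed
  ultimately show ?thesis unfolding has_field_derivative_iff by (rule filterlim_split_at)
qed

lemma position_has_derivative_field:
  assumes T: "0 < T" and \<tau>: "\<tau> = T * ramp u" "0 < \<tau>"
  shows "(position has_real_derivative sweep_field q A n T (position \<tau>) u / T) (at \<tau>)"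
proof (cases \<tau> "f - A + 1" rule: linorder_cases)
  case less
  have "A \<le> position \<tau>" "position \<tau> < f" "arrival_time (position \<tau>) = \<tau>"
    using position[of \<tau>] position_less[of \<tau>] \<tau>(2) less by simp_all
  then have "position \<tau> - A + 1 - \<tau> = slack_at (position \<tau>)" "0 < slack_at (position \<tau>)"
    using slack_at_pos by (simp_all add: arrival_time_def)
  then have "sweep_field q A n T (position \<tau>) u / T =
    q (position \<tau>) / (q (position \<tau>) + slack_at (position \<tau>) ^ (n + 2))"
    using T by (simp add: sweep_field_def flip: \<tau>(1))
  then show ?thesis using position_has_derivative[OF \<tau>(2) less] by simp
next
  case equal
  then show ?thesis using position_has_derivative_end position_f[of \<tau>] zero
    by (simp add: sweep_field_def)
next
  case greater
  have "(position has_real_derivative 0) (at \<tau>)"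
    by (rule has_field_derivative_transform_within_open
        [where S = "{f - A + 1<..}", OF DERIV_const[of f]])
      (use greater in \<open>auto simp: position_f\<close>)
  then show ?thesis using greater position_f[of \<tau>] zero by (simp add: sweep_field_def)
qed

lemma flows_Z:
  assumes T: "0 < T" shows "flows (sweep_field q A n T) (\<lambda>u. position (T * ramp u))"
  unfolding flows_def
proof
  fix u :: real assume u: "u \<in> {0..1}"
  let ?field = "sweep_field q A n T (position (T * ramp u)) u"
  have ramp: "((\<lambda>u. T * ramp u) has_real_derivative T * ramp_rate u) (at u within {0..1})"
    by (auto intro!: derivative_eq_intros ramp_has_derivative)
  show "((\<lambda>u. position (T * ramp u)) has_real_derivative ramp_rate u * ?field) (at u within {0..1})"
  proof (cases "u = 0")
    case True
    have "((\<lambda>u. position (T * ramp u)) has_real_derivative 0) (at u within {0..1})"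
    proof (rule has_derivative_zero_if_dominated)
      show "((\<lambda>u. T * ramp u) has_real_derivative 0) (at u within {0..1})"
        using ramp by (simp add: True ramp_rate_def)
      show "\<bar>position (T * ramp v) - position (T * ramp u)\<bar> \<le> \<bar>T * ramp v - T * ramp u\<bar>"
        if "v \<in> {0..1}" for v
        using position_Lipschitz[of 0 "T * ramp v"] ramp_nonneg[OF that] T True by simp
    qed
    then show ?thesis by (simp add: True ramp_rate_def)
  next
    case False
    then have "0 < T * ramp u" using u T by (simp add: ramp_pos)
    from DERIV_chain2[OF position_has_derivative_field[OF T refl this] ramp] show ?thesis
      using T by (simp add: mult.commute)
  qed
qed

theorem steers_sweep_field:
  assumes T: "f - A + 1 < T" shows "steers (sweep_field q A n T) A f"
  unfolding steers_def
proof (intro conjI exI[of _ "\<lambda>u. position (T * ramp u)"] allI impI)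
  show "position (T * ramp 0) = A" by (simp add: position_0)
  show "position (T * ramp 1) = f" using T by (simp add: position_f)
  show "flows (sweep_field q A n T) (\<lambda>u. position (T * ramp u))" using T A_less by (intro flows_Z) simp
  fix y assume "y 0 = A" "flows (sweep_field q A n T) y"
  then interpret sweep_solution q A f L k n T y by unfold_locales (use T in auto)
  show "y 1 = f" by (rule ends_at_zero)
qed

end

section \<open>Scalar matrices\<close>

definition scalar_mat :: "real \<Rightarrow> nat \<Rightarrow> nat \<Rightarrow> real" where
  "scalar_mat d i j = (if i = j then d else 0)"

lemma scalar_mat_mult_left: "i < D \<Longrightarrow> (\<Sum>l<D. scalar_mat d i l * M l) = d * M i"
  by (simp add: scalar_mat_def if_distrib[of "\<lambda>x. x * _"] cong: if_cong)

lemma scalar_mat_mult_right: "j < D \<Longrightarrow> (\<Sum>l<D. M l * scalar_mat d l j) = M j * d"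
  by (simp add: scalar_mat_def if_distrib[of "\<lambda>x. _ * x"] cong: if_cong)

lemma not_mat_invertible_zero: "0 < D \<Longrightarrow> \<not> mat_invertible D (scalar_mat 0)"
  by (auto simp: mat_invertible_def scalar_mat_def)

lemma mat_invertible_scalar: "d \<noteq> 0 \<Longrightarrow> mat_invertible D (scalar_mat d)"
  unfolding mat_invertible_def
  by (intro exI[of _ "scalar_mat (1 / d)"]) (simp add: scalar_mat_mult_left, simp add: scalar_mat_def)

lemma mat_inv_scalar:
  assumes d: "d \<noteq> 0"
  shows "mat_inv D (scalar_mat d) = (\<lambda>i j. if i < D \<and> j < D then scalar_mat (1 / d) i j else 0)"
  unfolding mat_inv_def
proof (rule the_equality)
  have "(\<Sum>l<D. scalar_mat d i l * (if l < D \<and> j < D then scalar_mat (1 / d) l j else 0)) =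
    (if i = j then 1 else 0)"
    "(\<Sum>l<D. (if i < D \<and> l < D then scalar_mat (1 / d) i l else 0) * scalar_mat d l j) =
      (if i = j then 1 else 0)"
    if "i < D" "j < D" for i j
    using that d by (simp_all add: scalar_mat_mult_left scalar_mat_mult_right)
      (simp_all add: scalar_mat_def)
  then show "(\<forall>i j. D \<le> i \<or> D \<le> j \<longrightarrow> (if i < D \<and> j < D then scalar_mat (1 / d) i j else 0) = 0) \<and>
    (\<forall>i<D. \<forall>j<D.
      (\<Sum>l<D. scalar_mat d i l * (if l < D \<and> j < D then scalar_mat (1 / d) l j else 0)) =
        (if i = j then 1 else 0) \<and>
      (\<Sum>l<D. (if i < D \<and> l < D then scalar_mat (1 / d) i l else 0) * scalar_mat d l j) =
        (if i = j then 1 else 0))"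
    by auto
next
  fix X :: "nat \<Rightarrow> nat \<Rightarrow> real"
  assume X: "(\<forall>i j. D \<le> i \<or> D \<le> j \<longrightarrow> X i j = 0) \<and> (\<forall>i<D. \<forall>j<D.
    (\<Sum>l<D. scalar_mat d i l * X l j) = (if i = j then 1 else 0) \<and>
    (\<Sum>l<D. X i l * scalar_mat d l j) = (if i = j then 1 else 0))"
  have "X i j = scalar_mat (1 / d) i j" if "i < D" "j < D" for i j
  proof -
    have "d * X i j = (if i = j then 1 else 0)" using X that by (metis scalar_mat_mult_left)
    then show ?thesis using d by (auto simp: scalar_mat_def eq_divide_eq mult.commute split: if_splits)
  qed
  moreover have "X i j = 0" if "\<not> (i < D \<and> j < D)" for i j using X that by (meson not_less)
  ultimately show "X = (\<lambda>i j. if i < D \<and> j < D then scalar_mat (1 / d) i j else 0)" by (intro ext) simp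
qed

text \<open>Note that \<open>b i / 0 = 0\<close> is also the value of \<open>clamp_sol\<close> for the zero matrix.\<close>

lemma clamp_sol_scalar:
  assumes "0 \<le> c" shows "clamp_sol c D (scalar_mat d) b = map (\<lambda>i. clamp c (b i / d)) [0..<D]"
proof (cases "d = 0")
  case True
  then show ?thesis
    using assms not_mat_invertible_zero[of D]
    by (cases "D = 0") (simp_all add: clamp_sol_def clamp_def map_replicate_const)
next
  case False
  have "(\<Sum>j<D. mat_inv D (scalar_mat d) i j * b j) = b i / d" if "i < D" for i
  proof -
    have "(\<Sum>j<D. mat_inv D (scalar_mat d) i j * b j) = (\<Sum>j<D. scalar_mat (1 / d) i j * b j)"
      using that by (intro sum.cong) (simp_all add: mat_inv_scalar[OF False])
    then show ?thesis using that by (simp add: scalar_mat_mult_left)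
  qed
  then show ?thesis using False by (simp add: clamp_sol_def mat_invertible_scalar)
qed

section \<open>Concatenating phases\<close>

definition solves_on ::
  "(real \<Rightarrow> real list \<Rightarrow> nat \<Rightarrow> real) \<Rightarrow> nat \<Rightarrow> real set \<Rightarrow> (real \<Rightarrow> real list) \<Rightarrow> bool" where
  "solves_on V D S z \<longleftrightarrow> (\<forall>s\<in>S. length (z s) = D \<and>
     (\<forall>i<D. ((\<lambda>t. z t ! i) has_real_derivative V s (z s) i) (at s within S)))"

lemma solves_on_subset: "solves_on V D S z \<Longrightarrow> S' \<subseteq> S \<Longrightarrow> solves_on V D S' z"
  unfolding solves_on_def by (blast intro: has_field_derivative_subset)

lemma solves_on_concat:
  assumes y: "solves_on V D {a..b} y" and z: "solves_on V D {b..c} z" and "y b = z b" "a \<le> b" "b \<le> c"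
  shows "solves_on V D {a..c} (\<lambda>t. if t \<in> {a..b} then y t else z t)"
proof -
  have un: "{a..c} = {a..b} \<union> {b..c}" using assms(4,5) by auto
  have border: "{a..b} \<union> (closure {a..b} \<inter> closure {b..c}) = {a..b}"
    "{b..c} \<union> (closure {a..b} \<inter> closure {b..c}) = {b..c}" using assms(4,5) by auto
  have "((\<lambda>t. (if t \<in> {a..b} then y t else z t) ! i) has_real_derivative
      V s (if s \<in> {a..b} then y s else z s) i) (at s within {a..c})"
    if s: "s \<in> {a..c}" and i: "i < D" for s i
  proof -
    have "((\<lambda>t. if t \<in> {a..b} then y t ! i else z t ! i) has_vector_derivative
        (if s \<in> {a..b} then V s (y s) i else V s (z s) i)) (at s within {a..c})"
    proof (rule has_vector_derivative_If_within_closures)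
      show "((\<lambda>t. y t ! i) has_vector_derivative V s (y s) i)
        (at s within {a..b} \<union> (closure {a..b} \<inter> closure {b..c}))"
        if "s \<in> {a..b} \<union> (closure {a..b} \<inter> closure {b..c})"
        using y that i unfolding border
        by (simp add: solves_on_def has_real_derivative_iff_has_vector_derivative)
      show "((\<lambda>t. z t ! i) has_vector_derivative V s (z s) i)
        (at s within {b..c} \<union> (closure {a..b} \<inter> closure {b..c}))"
        if "s \<in> {b..c} \<union> (closure {a..b} \<inter> closure {b..c})"
        using z that i unfolding border
        by (simp add: solves_on_def has_real_derivative_iff_has_vector_derivative)
    qed (use s assms(3) un in auto)
    then show ?thesis
      unfolding has_real_derivative_iff_has_vector_derivative
      by (simp add: if_distrib[of "\<lambda>l. l ! i"] if_distrib[of "\<lambda>l. V s l i"])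
  qed
  then show ?thesis using y z un by (auto simp: solves_on_def)
qed

locale phase_schedule =
  fixes J D :: nat and component :: "nat \<Rightarrow> nat" and h :: "nat \<Rightarrow> real list \<Rightarrow> real \<Rightarrow> real"
    and V :: "real \<Rightarrow> real list \<Rightarrow> nat \<Rightarrow> real" and v :: "nat \<Rightarrow> real list"
  assumes J: "0 < J" and component: "\<And>j. j < J \<Longrightarrow> component j < D"
    and length_v: "\<And>j. j \<le> J \<Longrightarrow> length (v j) = D"
    and V: "\<And>j s z i. j < J \<Longrightarrow> s \<in> {real j / J..real (Suc j) / J} \<Longrightarrow> length z = D \<Longrightarrow> i < D \<Longrightarrow>
      V s z i = (if i = component j
        then real J * (ramp_rate (real J * s - real j) * h j z (real J * s - real j)) else 0)"
    and v_other: "\<And>j i. j < J \<Longrightarrow> i < D \<Longrightarrow> i \<noteq> component j \<Longrightarrow> v (Suc j) ! i = v j ! i"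
    and steers: "\<And>j. j < J \<Longrightarrow>
      steers (\<lambda>y. h j ((v j)[component j := y])) (v j ! component j) (v (Suc j) ! component j)"
begin

definition phase_interval :: "nat \<Rightarrow> real set" where
  "phase_interval j = {real j / J..real (Suc j) / J}"

lemma local_time_in_unit: "s \<in> phase_interval j \<Longrightarrow> real J * s - real j \<in> {0..1}"
  using J by (auto simp: phase_interval_def field_simps)

lemma in_phase_interval: "u \<in> {0..1} \<Longrightarrow> (real j + u) / real J \<in> phase_interval j"
  by (auto simp: phase_interval_def divide_right_mono)

lemma phase_start: "real j / J \<in> phase_interval j" and phase_end: "real (Suc j) / J \<in> phase_interval j"
  using in_phase_interval[of 0 j] in_phase_interval[of 1 j] by (simp_all add: add.commute)

lemma v_Suc: "j < J \<Longrightarrow> (v j)[component j := v (Suc j) ! component j] = v (Suc j)"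
  using length_v[of j] length_v[of "Suc j"] v_other[of j] component[of j]
  by (intro nth_equalityI) (auto simp: nth_list_update)

context
  fixes j z
  assumes j: "j < J" and z: "solves_on V D (phase_interval j) z" and start: "z (real j / J) = v j"
begin

lemma only_component_moves: assumes "s \<in> phase_interval j"
  shows "z s = (v j)[component j := z s ! component j]"
proof -
  have "z s ! i = v j ! i" if "i < D" "i \<noteq> component j" for i
  proof -
    have "\<exists>c. \<forall>s\<in>phase_interval j. z s ! i = c"
    proof (rule has_field_derivative_zero_constant)
      show "((\<lambda>s. z s ! i) has_real_derivative 0) (at s within phase_interval j)"
        if "s \<in> phase_interval j" for s
      proof -
        have "length (z s) = D"
          "((\<lambda>s. z s ! i) has_real_derivative V s (z s) i) (at s within phase_interval j)"
          using z that \<open>i < D\<close> by (simp_all add: solves_on_def)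
        then show ?thesis using V[OF j that[unfolded phase_interval_def]] \<open>i < D\<close> \<open>i \<noteq> component j\<close>
          by simp
      qed
    qed (simp add: phase_interval_def)
    then show ?thesis using start phase_start assms by metis
  qed
  then show ?thesis
    using z assms length_v[of j] component[OF j] j
    by (intro nth_equalityI) (auto simp: solves_on_def nth_list_update)
qed

lemma flows_in_phase:
  "flows (\<lambda>y. h j ((v j)[component j := y])) (\<lambda>u. z ((real j + u) / real J) ! component j)"
  unfolding flows_def
proof
  fix u :: real assume u: "u \<in> {0..1}"
  let ?s = "(real j + u) / real J"
  note s = in_phase_interval[OF u, of j]
  have "((\<lambda>t. z t ! component j) has_real_derivative V ?s (z ?s) (component j))
    (at ?s within phase_interval j)"
    using z s component[OF j] by (simp add: solves_on_def)
  then have "((\<lambda>t. z t ! component j) has_real_derivative V ?s (z ?s) (component j))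
      (at ?s within (\<lambda>u. (real j + u) / real J) ` {0..1})"
    by (rule has_field_derivative_subset) (use in_phase_interval in blast)
  moreover have "((\<lambda>u. (real j + u) / real J) has_real_derivative 1 / real J) (at u within {0..1})"
    using J by (auto intro!: derivative_eq_intros)
  ultimately have "((\<lambda>u. z ((real j + u) / real J) ! component j) has_real_derivative
    V ?s (z ?s) (component j) * (1 / real J))
      (at u within {0..1})"
    by (rule DERIV_image_chain[unfolded o_def])
  moreover have "length (z ?s) = D" "real J * ?s - real j = u" using z s J
    by (simp_all add: solves_on_def)
  then have "V ?s (z ?s) (component j) * (1 / real J) = ramp_rate u * h j (z ?s) u"
    using V[OF j s[unfolded phase_interval_def] _ component[OF j]] J by simp
  ultimately show "((\<lambda>u. z ((real j + u) / real J) ! component j) has_real_derivative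
      ramp_rate u * h j ((v j)[component j := z ?s ! component j]) u) (at u within {0..1})"
    using only_component_moves[OF s] by simp
qed

lemma phase_ends: "z (real (Suc j) / J) = v (Suc j)"
proof -
  have "z (real (Suc j) / J) ! component j = v (Suc j) ! component j"
    using steersD[OF steers[OF j] flows_in_phase] start by (simp add: add.commute)
  then show ?thesis using only_component_moves[OF phase_end] v_Suc[OF j] by simp
qed

end

lemma ex_phase_solution:
  assumes j: "j < J"
  shows "\<exists>z. solves_on V D (phase_interval j) z \<and> z (real j / J) = v j \<and>
    z (real (Suc j) / J) = v (Suc j)"
proof -
  obtain y where y: "y 0 = v j ! component j" "y 1 = v (Suc j) ! component j"
    and flows: "flows (\<lambda>y. h j ((v j)[component j := y])) y"
    using steers[OF j] unfolding steers_def by blast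
  define z where "z s = (v j)[component j := y (real J * s - real j)]" for s
  have len: "length (z s) = D" for s using length_v[of j] j by (simp add: z_def)
  have "((\<lambda>t. z t ! i) has_real_derivative V s (z s) i) (at s within phase_interval j)"
    if s: "s \<in> phase_interval j" and i: "i < D" for s i
  proof (cases "i = component j")
    case False
    then have "(\<lambda>t. z t ! i) = (\<lambda>t. v j ! i)" by (simp add: z_def)
    then show ?thesis using V[OF j s[unfolded phase_interval_def] len i] False by simp
  next
    case True
    let ?u = "real J * s - real j"
    have "(y has_real_derivative ramp_rate ?u * h j (z s) ?u) (at ?u within {0..1})"
      using flows local_time_in_unit[OF s] by (simp add: flows_def z_def)
    then have "(y has_real_derivative ramp_rate ?u * h j (z s) ?u)
      (at ?u within (\<lambda>t. real J * t - real j) ` phase_interval j)"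
      by (rule has_field_derivative_subset) (use local_time_in_unit in blast)
    moreover have "((\<lambda>t. real J * t - real j) has_real_derivative real J)
      (at s within phase_interval j)"
      by (auto intro!: derivative_eq_intros)
    ultimately have "((\<lambda>t. y (real J * t - real j)) has_real_derivative
      ramp_rate ?u * h j (z s) ?u * real J) (at s within phase_interval j)"
      by (rule DERIV_image_chain[unfolded o_def])
    moreover have "(\<lambda>t. z t ! i) = (\<lambda>t. y (real J * t - real j))" using True i length_v[of j] j
      by (simp add: z_def)
    ultimately show ?thesis using V[OF j s[unfolded phase_interval_def] len i] True
      by (simp add: mult.commute)
  qed
  then have "solves_on V D (phase_interval j) z" using len by (simp add: solves_on_def)
  moreover have "z (real j / J) = v j" "z (real (Suc j) / J) = v (Suc j)"
    using y J v_Suc[OF j] by (simp_all add: z_def)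
  ultimately show ?thesis by blast
qed

lemma ends_if_solves: assumes z: "solves_on V D {0..1} z" "z 0 = v 0" shows "z 1 = v J"
proof -
  have "j \<le> J \<Longrightarrow> z (real j / J) = v j" for j
  proof (induction j)
    case (Suc j)
    then have j: "j < J" "z (real j / J) = v j" by simp_all
    have "phase_interval j \<subseteq> {0..1}" using j(1)
      by (auto simp: phase_interval_def divide_le_eq_1 intro: order_trans)
    then have "solves_on V D (phase_interval j) z" by (rule solves_on_subset[OF z(1)])
    then show ?case by (intro phase_ends j)
  qed (simp add: z(2))
  from this[of J] show ?thesis using J by simp
qed

lemma ex_solution: "\<exists>z. solves_on V D {0..1} z \<and> z 0 = v 0"
proof -
  have "j \<le> J \<Longrightarrow> \<exists>z. solves_on V D {0..real j / J} z \<and> z 0 = v 0 \<and> z (real j / J) = v j" for j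
  proof (induction j)
    case 0
    have "solves_on V D {0..0} (\<lambda>_. v 0)" using length_v[of 0]
      by (simp add: solves_on_def has_field_derivative_def has_derivative_within_singleton_iff
        bounded_linear_mult_right)
    then show ?case by auto
  next
    case (Suc j)
    then obtain y where y: "solves_on V D {0..real j / J} y" "y 0 = v 0" "y (real j / J) = v j" by auto
    obtain z where z: "solves_on V D (phase_interval j) z" "z (real j / J) = v j"
      "z (real (Suc j) / J) = v (Suc j)"
      using ex_phase_solution[of j] Suc.prems by auto
    let ?z = "\<lambda>t. if t \<in> {0..real j / J} then y t else z t"
    have "solves_on V D {0..real (Suc j) / J} ?z"
      using y z unfolding phase_interval_def
      by (intro solves_on_concat) (simp_all add: divide_right_mono)
    moreover have "?z 0 = v 0" "?z (real (Suc j) / J) = v (Suc j)"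
      using y z J by (simp_all add: divide_le_cancel)
    ultimately show ?case by blast
  qed
  from this[of J] show ?thesis using J by auto
qed

end

section \<open>Networks that work in phases\<close>

text \<open>The last entry of the input is the time. In the \<open>j\<close>-th of \<open>J\<close> phases of equal length the only
  nonzero pulse is that of \<open>j\<close>, so that the quotient of \<open>rhs\<close> and \<open>diag\<close> is this pulse times
  \<open>num j / den j\<close>.\<close>

locale phase_network =
  fixes m n k J :: nat and component :: "nat \<Rightarrow> nat"
    and num den :: "nat \<Rightarrow> real list \<Rightarrow> real" and C :: real
    and v :: "real list \<Rightarrow> nat \<Rightarrow> real list"
  assumes J: "0 < J" and component: "\<And>j. j < J \<Longrightarrow> component j < n + k"
    and isd_num: "\<And>j. j < J \<Longrightarrow> isd_gen (m + (n + k) + 1) (num j)"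
    and isd_den: "\<And>j. j < J \<Longrightarrow> isd_gen (m + (n + k) + 1) (den j)"
    and bounded: "\<And>j w. j < J \<Longrightarrow> \<bar>num j w / den j w\<bar> \<le> C"
    and length_v: "\<And>x j. length x = m \<Longrightarrow> length (v x j) = n + k"
    and v_0: "\<And>x. length x = m \<Longrightarrow> v x 0 = replicate (n + k) 0"
    and v_other: "\<And>x j i. length x = m \<Longrightarrow> j < J \<Longrightarrow> i < n + k \<Longrightarrow> i \<noteq> component j \<Longrightarrow>
      v x (Suc j) ! i = v x j ! i"
    and steers: "\<And>x j. length x = m \<Longrightarrow> j < J \<Longrightarrow>
      steers (\<lambda>y u. num j (x @ (v x j)[component j := y] @ [(real j + u) / real J]) /
          den j (x @ (v x j)[component j := y] @ [(real j + u) / real J]))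
        (v x j ! component j) (v x (Suc j) ! component j)"
begin

definition pulse :: "nat \<Rightarrow> real list \<Rightarrow> real" where
  "pulse j w = real J * max 0 (ramp_rate (real J * w ! (m + (n + k)) - real j))"

definition diag :: "real list \<Rightarrow> real" where
  "diag w = (\<Sum>j<J. pulse j w * den j w)"

definition rhs :: "nat \<Rightarrow> real list \<Rightarrow> real" where
  "rhs i w = (\<Sum>j<J. if i = component j then (pulse j w)\<^sup>2 * num j w else 0)"

definition cmax :: real where
  "cmax = 6 * real J * C"

lemma cmax_nonneg: "0 \<le> cmax"
  using order_trans[OF abs_ge_zero bounded[OF J]] by (simp add: cmax_def)

lemma isd_pulse: "isd_gen (m + (n + k) + 1) (pulse j)"
  unfolding pulse_def[abs_def] ramp_rate_def
  by (intro isd_mult isd_max isd_diff isd_const isd_nth) simp_all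

lemma ISDnet: "ISDnet m n k (\<lambda>i j w. scalar_mat (diag w) i j) rhs"
proof -
  have "isd_gen (m + (n + k) + 1) diag"
    unfolding diag_def[abs_def] by (intro isd_sum isd_mult isd_pulse isd_den) simp
  then have "isd_gen (m + (n + k) + 1) (\<lambda>w. scalar_mat (diag w) i j)" for i j
    by (cases "i = j") (simp_all add: scalar_mat_def isd_const)
  moreover have "isd_gen (m + (n + k) + 1) (rhs i)" for i
    unfolding rhs_def[abs_def]
  proof (rule isd_sum)
    fix j assume "j \<in> {..<J}"
    then show "isd_gen (m + (n + k) + 1) (\<lambda>w. if i = component j then (pulse j w)\<^sup>2 * num j w else 0)"
      by (cases "i = component j")
        (auto intro!: isd_mult isd_power isd_pulse isd_num isd_const
        simp del: One_nat_def add_Suc_right)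
  qed
  ultimately show ?thesis unfolding ISDnet_def ISD_def by blast
qed

lemma pulse_eq:
  assumes j: "j < J" and s: "s \<in> {real j / J..real (Suc j) / J}"
    and len: "length x = m" "length z = n + k"
  shows "pulse l (x @ z @ [s]) = (if l = j then real J * ramp_rate (real J * s - real j) else 0)"
proof -
  have time: "(x @ z @ [s]) ! (m + (n + k)) = s" using len by (simp add: nth_append)
  have s': "real j \<le> real J * s" "real J * s \<le> real j + 1" using s J by (auto simp: field_simps)
  consider (current) "l = j" | (past) "l \<noteq> j" "real l + 1 \<le> real j"
    | (future) "l \<noteq> j" "real j + 1 \<le> real l" by linarith
  then show ?thesis
  proof cases
    case current
    then show ?thesis using s' ramp_rate_nonneg[of "real J * s - real j"] by (simp add: pulse_def time)
  next
    case past
    then have "1 \<le> real J * s - real l" using s' by linarith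
    then have "ramp_rate (real J * s - real l) \<le> 0" by (simp add: ramp_rate_def mult_le_0_iff)
    then show ?thesis using past(1) by (simp add: pulse_def time max_absorb1)
  next
    case future
    then have "real J * s - real l \<le> 0" using s' by linarith
    then have "ramp_rate (real J * s - real l) \<le> 0" by (simp add: ramp_rate_def mult_le_0_iff)
    then show ?thesis using future(1) by (simp add: pulse_def time max_absorb1)
  qed
qed

lemma clamp_rhs_div_diag:
  assumes j: "j < J" and s: "s \<in> {real j / J..real (Suc j) / J}"
    and len: "length x = m" "length z = n + k"
  defines "w \<equiv> x @ z @ [s]"
  shows "clamp cmax (rhs i w / diag w) =
    (if i = component j then real J * (ramp_rate (real J * s - real j) * (num j w / den j w)) else 0)"
proof -
  note pulse = pulse_eq[OF j s len, folded w_def]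
  have diag: "diag w = pulse j w * den j w"
    using j by (simp add: diag_def pulse if_distrib[of "\<lambda>x. x * _"] cong: if_cong)
  have rhs: "rhs i w = (if i = component j then (pulse j w)\<^sup>2 * num j w else 0)"
  proof -
    have "rhs i w =
        (\<Sum>l<J. if l = j then (if i = component j then (pulse j w)\<^sup>2 * num j w else 0) else 0)"
      unfolding rhs_def by (intro sum.cong) (auto simp: pulse)
    then show ?thesis using j by simp
  qed
  show ?thesis
  proof (cases "i = component j")
    case False
    then show ?thesis using cmax_nonneg by (simp add: rhs clamp_def)
  next
    case True
    have u: "real J * s - real j \<in> {0..1}" using s J by (auto simp: field_simps)
    have "ramp_rate (real J * s - real j) \<le> 6 * 1 * 1" unfolding ramp_rate_def using u
      by (intro mult_mono) auto
    then have "\<bar>real J * ramp_rate (real J * s - real j)\<bar> \<le> real J * 6"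
      using ramp_rate_nonneg[OF u] by (simp add: abs_mult mult_left_mono)
    then have "\<bar>real J * ramp_rate (real J * s - real j) * (num j w / den j w)\<bar> \<le> real J * 6 * C"
      unfolding abs_mult[of "real J * ramp_rate (real J * s - real j)"] using bounded[OF j, of w]
      by (intro mult_mono) auto
    moreover have "rhs i w / diag w = real J * ramp_rate (real J * s - real j) * (num j w / den j w)"
      unfolding rhs diag using True by (simp add: power2_eq_square pulse)
    ultimately have "clamp cmax (rhs i w / diag w) =
      real J * ramp_rate (real J * s - real j) * (num j w / den j w)"
      unfolding clamp_def cmax_def by linarith
    then show ?thesis using True by simp
  qed
qed

lemma SANN_lim_eq:
  assumes x: "length x = m"
  shows "SANN_lim_eq m n k (\<lambda>i j w. scalar_mat (diag w) i j) rhs x cmax (take n (v x J))"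
proof -
  let ?V = "\<lambda>s z i. clamp cmax (rhs i (x @ z @ [s]) / diag (x @ z @ [s]))"
  let ?h = "\<lambda>j z u. num j (x @ z @ [(real j + u) / real J]) / den j (x @ z @ [(real j + u) / real J])"
  interpret phase_schedule J "n + k" component ?h ?V "v x"
  proof
    show "?V s z i = (if i = component j then real J * (ramp_rate (real J * s - real j) *
        ?h j z (real J * s - real j)) else 0)"
      if "j < J" "s \<in> {real j / J..real (Suc j) / J}" "length z = n + k" for j s z i
      using clamp_rhs_div_diag[OF that(1,2) x that(3)] J by simp
    show "length (v x j) = n + k" for j by (rule length_v[OF x])
    show "v x (Suc j) ! i = v x j ! i" if "j < J" "i < n + k" "i \<noteq> component j" for j i
      using that by (rule v_other[OF x])
    show "steers (\<lambda>y. ?h j ((v x j)[component j := y])) (v x j ! component j) (v x (Suc j) ! component j)"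
      if "j < J" for j using steers[OF x that] by simp
  qed (fact J component)+
  have solution_iff: "SANN_solution m n k (\<lambda>i j w. scalar_mat (diag w) i j) rhs x cmax z \<longleftrightarrow>
      solves_on ?V (n + k) {0..1} z \<and> z 0 = v x 0" for z
    unfolding SANN_solution_def solves_on_def clamp_sol_scalar[OF cmax_nonneg] v_0[OF x]
    by (simp add: ball_conj_distrib conj_commute conj_left_commute)
  show ?thesis unfolding SANN_lim_eq_def solution_iff
  proof (intro conjI allI impI)
    show "\<exists>z. solves_on ?V (n + k) {0..1} z \<and> z 0 = v x 0" by (rule ex_solution)
    show "take n (z 1) = take n (v x J)" if "solves_on ?V (n + k) {0..1} z \<and> z 0 = v x 0" for z
      by (rule arg_cong[OF ends_if_solves]) (use that in blast)+
  qed
qed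

end

section \<open>Isolating families and their violation\<close>

definition isolating_family :: "nat \<Rightarrow> (real list \<Rightarrow> real) \<Rightarrow> (real list \<Rightarrow> real) list set \<Rightarrow> bool" where
  "isolating_family m f \<C> \<longleftrightarrow> finite \<C> \<and> (\<forall>cs\<in>\<C>. poly_funs m cs \<and> deriv_coeffs cs \<in> \<C>) \<and>
     (\<forall>x. length x = m \<longrightarrow> (\<exists>cs\<in>\<C>. specialize cs x \<noteq> 0 \<and> poly (specialize cs x) (f x) = 0))"

lemma ex_isolating_family:
  assumes "semialg_fun m n F" "i < n" shows "\<exists>\<C>. isolating_family m (\<lambda>x. F x ! i) \<C>"
proof -
  obtain \<C> where \<C>: "finite \<C>" "\<forall>cs\<in>\<C>. poly_funs m cs"
    "\<And>x. length x = m \<Longrightarrow> \<exists>cs\<in>\<C>. specialize cs x \<noteq> 0 \<and> poly (specialize cs x) (F x ! i) = 0"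
    using ex_vanishing_family[OF assms] by blast
  obtain \<D> where "finite \<D>" "\<C> \<subseteq> \<D>" "\<forall>cs\<in>\<D>. poly_funs m cs" "\<forall>cs\<in>\<D>. deriv_coeffs cs \<in> \<D>"
    using ex_deriv_closed_superset[OF \<C>(1,2)] .
  then show ?thesis using \<C>(3) unfolding isolating_family_def by (intro exI[of _ \<D>]) blast
qed

definition violation :: "real \<Rightarrow> real \<Rightarrow> real" where
  "violation c t = (if 0 < c then max 0 (- t) else if c < 0 then max 0 t else \<bar>t\<bar>)"

lemma violation_nonneg: "0 \<le> violation c t"
  by (simp add: violation_def)

lemma violation_eq_0_iff: "violation c t = 0 \<longleftrightarrow> sign_compat c t"
  by (auto simp: violation_def sign_compat_def)

lemma violation_self: "violation c c = 0"
  by (simp add: violation_def)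

lemma violation_cong: "sgn c = sgn c' \<Longrightarrow> violation c = violation c'"
  by (auto simp: violation_def fun_eq_iff sgn_if split: if_splits)

lemma violation_le: "violation c t \<le> \<bar>t - c\<bar>"
  by (auto simp: violation_def)

lemma violation_0: "violation 0 t = \<bar>t\<bar>"
  by (simp add: violation_def)

lemma continuous_on_violation: "continuous_on S g \<Longrightarrow> continuous_on S (\<lambda>y. violation c (g y))"
  unfolding violation_def by (cases "0 < c"; cases "c < 0")
    (auto intro!: continuous_on_max continuous_intros)

lemma isd_violation: "isd_gen N f \<Longrightarrow> isd_gen N (\<lambda>w. violation c (f w))"
  unfolding violation_def by (cases "0 < c"; cases "c < 0")
    (auto intro!: isd_max isd_const isd_uminus isd_abs)

lemma poly_Lipschitz_on_Icc:
  fixes p :: "real poly"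
  shows "\<exists>L\<ge>0. \<forall>x\<in>{a..b}. \<forall>y\<in>{a..b}. \<bar>poly p x - poly p y\<bar> \<le> L * \<bar>x - y\<bar>"
proof -
  have "bounded (poly (pderiv p) ` {a..b})"
    by (intro compact_imp_bounded compact_continuous_image continuous_intros) auto
  then obtain L where L: "\<And>u. u \<in> {a..b} \<Longrightarrow> \<bar>poly (pderiv p) u\<bar> \<le> L"
    unfolding bounded_iff by fastforce
  have "\<bar>poly p x - poly p y\<bar> \<le> \<bar>L\<bar> * \<bar>x - y\<bar>" if "x \<in> {a..b}" "y \<in> {a..b}" for x y
  proof -
    have "norm (poly p x - poly p y) \<le> \<bar>L\<bar> * norm (x - y)"
    proof (rule field_differentiable_bound[of "{a..b}"])
      show "norm (poly (pderiv p) u) \<le> \<bar>L\<bar>" if "u \<in> {a..b}" for u using L[OF that] by simp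
    qed (use that in \<open>auto intro: has_field_derivative_at_within poly_DERIV\<close>)
    then show ?thesis by simp
  qed
  then show ?thesis by (intro exI[of _ "\<bar>L\<bar>"]) simp
qed

lemma poly_lower_bound_near_root:
  fixes g :: "real poly"
  assumes g: "g \<noteq> 0" "poly g f = 0" "degree g \<le> a"
  shows "\<exists>c>0. \<exists>e>0. \<forall>y. \<bar>f - y\<bar> < e \<longrightarrow> c * \<bar>f - y\<bar> ^ a \<le> \<bar>poly g y\<bar>"
proof -
  define r where "r = order f g"
  obtain h where h: "g = [:- f, 1:] ^ r * h" "\<not> [:- f, 1:] dvd h" using order_decomp[OF g(1)]
    by (auto simp: r_def)
  have r: "r \<noteq> 0" "r \<le> a" using order_degree[OF g(1), of f] g by (auto simp: r_def order_root)
  define c where "c = \<bar>poly h f\<bar> / 2"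
  have c: "0 < c" "c < \<bar>poly h f\<bar>" using h(2) by (auto simp: c_def poly_eq_0_iff_dvd)
  have "((\<lambda>y. \<bar>poly h y\<bar>) \<longlongrightarrow> \<bar>poly h f\<bar>) (at f)"
    using poly_isCont[of f h] unfolding isCont_def by (intro tendsto_intros)
  then have "\<forall>\<^sub>F y in at f. c < \<bar>poly h y\<bar>" using c(2) by (rule order_tendstoD)
  then obtain e where e: "e > 0" "\<And>y. y \<noteq> f \<Longrightarrow> dist y f < e \<Longrightarrow> c < \<bar>poly h y\<bar>"
    by (auto simp: eventually_at)
  have "c * \<bar>f - y\<bar> ^ a \<le> \<bar>poly g y\<bar>" if y: "\<bar>f - y\<bar> < min e 1" for y
  proof (cases "y = f")
    case True
    then show ?thesis using r by (cases a) simp_all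
  next
    case False
    have "c * \<bar>f - y\<bar> ^ a \<le> \<bar>poly h y\<bar> * \<bar>f - y\<bar> ^ r"
      using e(2)[OF False] c(1) y r
      by (intro mult_mono power_decreasing) (auto simp: dist_real_def abs_minus_commute)
    also have "\<dots> = \<bar>poly g y\<bar>"
      by (simp add: h(1) poly_power abs_mult power_abs mult.commute abs_minus_commute)
    finally show ?thesis .
  qed
  then show ?thesis using c(1) e(1) by (intro exI[of _ c] conjI exI[of _ "min e 1"]) simp_all
qed

lemma power_lower_bound_on_Icc:
  fixes q :: "real \<Rightarrow> real"
  assumes cont: "continuous_on {A..f} q" and pos: "\<And>y. A \<le> y \<Longrightarrow> y < f \<Longrightarrow> 0 < q y"
    and near: "0 < c" "0 < e" "\<And>y. f - e < y \<Longrightarrow> y \<le> f \<Longrightarrow> c * (f - y) ^ a \<le> q y"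
  shows "\<exists>k>0. \<forall>y\<in>{A..f}. k * (f - y) ^ a \<le> q y"
proof (cases "A \<le> f - e")
  case False
  then show ?thesis using near by (intro exI[of _ c] conjI ballI) auto
next
  case True
  have "continuous_on {A..f - e} q" by (rule continuous_on_subset[OF cont]) (use near(2) in auto)
  then obtain y0 where y0: "y0 \<in> {A..f - e}" "\<And>y. y \<in> {A..f - e} \<Longrightarrow> q y0 \<le> q y"
    using continuous_attains_inf[of "{A..f - e}" q] True by (auto simp: compact_Icc)
  define k where "k = min c (q y0 / (f - A) ^ a)"
  have "0 < q y0" using pos[of y0] y0(1) near(2) by simp
  moreover have "0 < (f - A) ^ a" using True near(2) by simp
  ultimately have k: "0 < k" "k * (f - A) ^ a \<le> q y0"
    using near(1) by (simp_all add: k_def pos_le_divide_eq[symmetric])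
  have "k * (f - y) ^ a \<le> q y" if y: "y \<in> {A..f}" for y
  proof (cases "y \<le> f - e")
    case True
    have "k * (f - y) ^ a \<le> k * (f - A) ^ a" using k(1) y by (intro mult_left_mono power_mono) auto
    then show ?thesis using k(2) y0(2)[of y] y True by simp
  next
    case False
    have "k * (f - y) ^ a \<le> c * (f - y) ^ a" using y by (intro mult_right_mono) (simp_all add: k_def)
    then show ?thesis using near(3)[of y] y False by simp
  qed
  then show ?thesis using k(1) by blast
qed

section \<open>The network\<close>

datatype phase = Reset nat | Encode nat | Sweep nat

locale sign_code_network =
  fixes m n :: nat and F :: "real list \<Rightarrow> real list" and B :: real
    and gs :: "(real list \<Rightarrow> real) list" and \<C> :: "nat \<Rightarrow> (real list \<Rightarrow> real) list set" and d :: nat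
  assumes length_F: "\<And>x. length x = m \<Longrightarrow> length (F x) = n"
    and B: "\<And>x i. length x = m \<Longrightarrow> i < n \<Longrightarrow> \<bar>F x ! i\<bar> < B" and B_pos: "0 < B"
    and gs: "poly_funs m gs" "gs \<noteq> []"
    and isolating: "\<And>i. i < n \<Longrightarrow> isolating_family m (\<lambda>x. F x ! i) (\<C> i)"
    and determined: "\<And>u v i cs. length u = m \<Longrightarrow> length v = m \<Longrightarrow> \<forall>g\<in>set gs. 0 < g u \<longleftrightarrow> 0 < g v \<Longrightarrow>
      i < n \<Longrightarrow> cs \<in> \<C> i \<Longrightarrow>
      sgn (poly (specialize cs u) (F u ! i)) = sgn (poly (specialize cs v) (F v ! i))"
    and d: "0 < d" "\<And>i cs. i < n \<Longrightarrow> cs \<in> \<C> i \<Longrightarrow> length cs \<le> Suc d"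
begin

lemma finite_family: "i < n \<Longrightarrow> finite (\<C> i)"
  and poly_funs_family: "i < n \<Longrightarrow> cs \<in> \<C> i \<Longrightarrow> poly_funs m cs"
  and deriv_closed: "i < n \<Longrightarrow> cs \<in> \<C> i \<Longrightarrow> deriv_coeffs cs \<in> \<C> i"
  and ex_vanishing: "i < n \<Longrightarrow> length x = m \<Longrightarrow>
    \<exists>cs\<in>\<C> i. specialize cs x \<noteq> 0 \<and> poly (specialize cs x) (F x ! i) = 0"
  using isolating by (auto simp: isolating_family_def)

abbreviation "R \<equiv> length gs"

definition code :: "nat \<Rightarrow> real list \<Rightarrow> nat" where
  "code r x = (\<Sum>l<r. of_bool (0 < (gs ! l) x) * 2 ^ l)"

lemma code_Suc: "code (Suc r) x = code r x + of_bool (0 < (gs ! r) x) * 2 ^ r"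
  by (simp only: code_def sum.lessThan_Suc)

lemma code_eq_horner_sum: "code R x = horner_sum of_bool 2 (map (\<lambda>g. 0 < g x) gs)"
  unfolding code_def horner_sum_eq_sum by (intro sum.cong) auto

lemma code_less: "code R x < 2 ^ R"
  unfolding code_eq_horner_sum using horner_sum_of_bool_2_less[of "map (\<lambda>g. 0 < g x) gs"] by simp

lemma code_eq_imp_signs_eq: assumes "code R u = code R v" "g \<in> set gs" shows "0 < g u \<longleftrightarrow> 0 < g v"
proof -
  obtain l where "l < R" "g = gs ! l" using assms(2) by (metis in_set_conv_nth)
  then have "bit (code R x) l \<longleftrightarrow> 0 < g x" for x
    by (simp add: code_eq_horner_sum bit_horner_sum_bit_iff)
  then show ?thesis using assms(1) by metis
qed

text \<open>An arbitrary list if \<open>c\<close> is not the code of any point.\<close>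

definition representative :: "nat \<Rightarrow> real list" where
  "representative c = (SOME x. length x = m \<and> code R x = c)"

lemma representative:
  "length x = m \<Longrightarrow> length (representative (code R x)) = m \<and>
    code R (representative (code R x)) = code R x"
  unfolding representative_def by (rule someI[of _ x]) simp

definition gap :: "nat \<Rightarrow> nat \<Rightarrow> real list \<Rightarrow> real \<Rightarrow> real" where
  "gap i c x y = (\<Sum>cs\<in>\<C> i.
     violation (poly (specialize cs (representative c)) (F (representative c) ! i))
       (poly (specialize cs x) y))"

lemma gap_nonneg: "0 \<le> gap i c x y"
  unfolding gap_def by (intro sum_nonneg violation_nonneg)

lemma gap_append: "i < n \<Longrightarrow> length x = m \<Longrightarrow> gap i c (x @ w) y = gap i c x y"
  unfolding gap_def using specialize_append[OF poly_funs_family] by (intro sum.cong) auto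

lemma gap_continuous: "continuous_on S (gap i c x)"
  unfolding gap_def by (intro continuous_on_sum continuous_on_violation continuous_intros)

context
  fixes i :: nat and x :: "real list"
  assumes i: "i < n" and x: "length x = m"
begin

lemma gap_code:
  "gap i (code R x) x y =
    (\<Sum>cs\<in>\<C> i. violation (poly (specialize cs x) (F x ! i)) (poly (specialize cs x) y))"
  unfolding gap_def
proof (rule sum.cong[OF refl])
  fix cs assume cs: "cs \<in> \<C> i"
  have "\<forall>g\<in>set gs. 0 < g (representative (code R x)) \<longleftrightarrow> 0 < g x"
    using representative[OF x] code_eq_imp_signs_eq by blast
  then have "sgn (poly (specialize cs (representative (code R x))) (F (representative (code R x)) ! i)) =
      sgn (poly (specialize cs x) (F x ! i))"
    using representative[OF x] x i cs by (intro determined) simp_all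
  from violation_cong[OF this]
  show "violation (poly (specialize cs (representative (code R x))) (F (representative (code R x)) ! i))
      (poly (specialize cs x) y) =
      violation (poly (specialize cs x) (F x ! i)) (poly (specialize cs x) y)" by simp
qed

lemma violation_le_gap:
  "cs \<in> \<C> i \<Longrightarrow> violation (poly (specialize cs x) (F x ! i)) (poly (specialize cs x) y) \<le>
    gap i (code R x) x y"
  unfolding gap_code using finite_family[OF i] by (intro member_le_sum violation_nonneg)

lemma gap_zero: "gap i (code R x) x (F x ! i) = 0"
  by (simp add: gap_code violation_self)

lemma gap_pos: assumes "y \<noteq> F x ! i" shows "0 < gap i (code R x) x y"
proof (rule ccontr)
  assume "\<not> ?thesis"
  then have "violation (poly (specialize cs x) (F x ! i)) (poly (specialize cs x) y) = 0"
    if "cs \<in> \<C> i" for cs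
    using violation_le_gap[OF that, of y] violation_nonneg by (smt (verit))
  then have compat: "sign_compat (poly (specialize cs x) (F x ! i)) (poly (specialize cs x) y)"
    if "cs \<in> \<C> i" for cs
    using that by (simp add: violation_eq_0_iff)
  obtain cs where cs: "cs \<in> \<C> i" "specialize cs x \<noteq> 0" "poly (specialize cs x) (F x ! i) = 0"
    using ex_vanishing[OF i x] by blast
  have "y = F x ! i"
  proof (rule Thom_lemma[where \<F> = "(\<lambda>cs. specialize cs x) ` \<C> i"])
    show "pderiv p \<in> (\<lambda>cs. specialize cs x) ` \<C> i" if "p \<in> (\<lambda>cs. specialize cs x) ` \<C> i" for p
      using that deriv_closed[OF i] by (auto simp flip: specialize_deriv_coeffs)
  qed (use compat cs in auto)
  then show False using assms by simp
qed

lemma gap_lower_bound: "\<exists>k>0. \<forall>y\<in>{A..F x ! i}. k * (F x ! i - y) ^ Suc d \<le> gap i (code R x) x y"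
proof -
  obtain cs where cs: "cs \<in> \<C> i" "specialize cs x \<noteq> 0" "poly (specialize cs x) (F x ! i) = 0"
    using ex_vanishing[OF i x] by blast
  have "degree (specialize cs x) \<le> Suc d"
    using degree_specialize_le[of cs x] d(2)[OF i cs(1)] by linarith
  from poly_lower_bound_near_root[OF cs(2,3) this] obtain c e where "c > 0" "e > 0"
    and near: "\<And>y. \<bar>F x ! i - y\<bar> < e \<Longrightarrow> c * \<bar>F x ! i - y\<bar> ^ Suc d \<le> \<bar>poly (specialize cs x) y\<bar>" by blast
  have "\<bar>poly (specialize cs x) y\<bar> \<le> gap i (code R x) x y" for y
    using violation_le_gap[OF cs(1), of y] by (simp add: cs(3) violation_0)
  note le_gap = order_trans[OF near this]
  show ?thesis
  proof (rule power_lower_bound_on_Icc[OF gap_continuous gap_pos \<open>c > 0\<close> \<open>e > 0\<close>])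
    show "c * (F x ! i - y) ^ Suc d \<le> gap i (code R x) x y" if "F x ! i - e < y" "y \<le> F x ! i" for y
      using le_gap[of y] that by simp
  qed simp
qed

lemma gap_upper_bound: "\<exists>L>0. \<forall>y\<in>{A..F x ! i}. gap i (code R x) x y \<le> L * (F x ! i - y)"
proof -
  let ?f = "F x ! i"
  have "\<exists>L. \<forall>cs. L cs \<ge> 0 \<and> (\<forall>y\<in>{A..?f}. \<forall>y'\<in>{A..?f}.
      \<bar>poly (specialize cs x) y - poly (specialize cs x) y'\<bar> \<le> L cs * \<bar>y - y'\<bar>)"
    using poly_Lipschitz_on_Icc by (intro choice) blast
  then obtain L where L: "\<And>cs. L cs \<ge> 0" and Lipschitz: "\<And>cs y y'. y \<in> {A..?f} \<Longrightarrow> y' \<in> {A..?f} \<Longrightarrow>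
      \<bar>poly (specialize cs x) y - poly (specialize cs x) y'\<bar> \<le> L cs * \<bar>y - y'\<bar>" by blast
  define K where "K = 1 + (\<Sum>cs\<in>\<C> i. L cs)"
  have "gap i (code R x) x y \<le> K * (?f - y)" if y: "y \<in> {A..?f}" for y
  proof -
    have "gap i (code R x) x y \<le> (\<Sum>cs\<in>\<C> i. L cs * (?f - y))"
      unfolding gap_code
    proof (rule sum_mono)
      fix cs
      show "violation (poly (specialize cs x) ?f) (poly (specialize cs x) y) \<le> L cs * (?f - y)"
        using violation_le[of "poly (specialize cs x) ?f" "poly (specialize cs x) y"]
          Lipschitz[OF y, of ?f cs] y
        by (simp add: abs_of_nonpos)
    qed
    also have "\<dots> = (K - 1) * (?f - y)" by (simp add: K_def sum_distrib_right)
    also have "\<dots> \<le> K * (?f - y)" using y by (intro mult_right_mono) auto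
    finally show ?thesis .
  qed
  moreover have "0 < K" unfolding K_def using L by (intro add_pos_nonneg sum_nonneg) auto
  ultimately show ?thesis by blast
qed

lemma sweep_gap: "\<exists>L k. sweep (gap i (code R x) x) (- B) (F x ! i) L k d"
proof -
  obtain L where "L > 0" "\<forall>y\<in>{- B..F x ! i}. gap i (code R x) x y \<le> L * (F x ! i - y)"
    using gap_upper_bound by blast
  moreover obtain k where "k > 0" "\<forall>y\<in>{- B..F x ! i}. k * (F x ! i - y) ^ Suc d \<le> gap i (code R x) x y"
    using gap_lower_bound by blast
  moreover have "- B < F x ! i" using B[OF x i] by linarith
  ultimately have "sweep (gap i (code R x) x) (- B) (F x ! i) L k d"
    by unfold_locales (use gap_continuous gap_zero gap_pos d(1) in auto)
  then show ?thesis by blast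
qed

end

definition phases :: "phase list" where
  "phases = map Reset [0..<n] @ map Encode [0..<R] @ map Sweep [0..<n]"

definition J :: nat where
  "J = n + R + n"

lemma J_pos: "0 < J"
  using gs(2) by (simp add: J_def)

lemma phases_nth:
  "i < n \<Longrightarrow> phases ! i = Reset i"
  "l < R \<Longrightarrow> phases ! (n + l) = Encode l"
  "i < n \<Longrightarrow> phases ! (n + R + i) = Sweep i"
  by (simp_all add: phases_def nth_append)

lemma phase_cases:
  assumes "j < J"
  obtains (Reset) i where "j = i" "i < n" | (Encode) l where "j = n + l" "l < R"
    | (Sweep) i where "j = n + R + i" "i < n"
  using assms unfolding J_def by (metis add_less_cancel_left le_Suc_ex not_less)

fun component :: "phase \<Rightarrow> nat" where
  "component (Reset i) = i"
| "component (Encode l) = n"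
| "component (Sweep i) = i"

text \<open>The sum over \<open>c\<close> is an ISD function that interpolates the gap between the possible values of the
  code, which is found in the extra component.\<close>

definition coded_gap :: "nat \<Rightarrow> real list \<Rightarrow> real" where
  "coded_gap i w = (\<Sum>c<2 ^ R. max 0 (1 - \<bar>w ! (m + n) - real c\<bar>) * gap i c w (w ! (m + i)))"

definition T :: real where
  "T = 2 * B + 2"

fun num :: "phase \<Rightarrow> real list \<Rightarrow> real" where
  "num (Reset i) w = - B"
| "num (Encode l) w = 2 ^ l * max ((gs ! l) w) 0"
| "num (Sweep i) w = T * coded_gap i w"

fun den :: "phase \<Rightarrow> real \<Rightarrow> real list \<Rightarrow> real" where
  "den (Reset i) u w = 1"
| "den (Encode l) u w = max ((gs ! l) w) 0"
| "den (Sweep i) u w = coded_gap i w + max 0 (w ! (m + i) + B + 1 - T * ramp u) ^ (d + 2)"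

lemma T_pos: "0 < T"
  using B_pos by (simp add: T_def)

lemma isd_gs: "l < R \<Longrightarrow> isd_gen (m + (n + 1) + 1) (gs ! l)"
  using gs(1) poly_fun_mono[of m "gs ! l"] by (intro isd_poly) simp

lemma isd_coded_gap: assumes i: "i < n" shows "isd_gen (m + (n + 1) + 1) (coded_gap i)"
proof -
  have "isd_gen (m + (n + 1) + 1) (\<lambda>w. poly (specialize cs w) (w ! (m + i)))" if "cs \<in> \<C> i" for cs
    using poly_funs_family[OF i that] i
    by (intro isd_poly poly_fun_poly_specialize pf_proj) (auto intro: poly_fun_mono)
  then show ?thesis
    unfolding coded_gap_def[abs_def] gap_def
    by (intro isd_sum isd_mult isd_max isd_const isd_diff isd_abs isd_nth isd_violation) auto
qed

lemma isd_num:
  assumes "j < J" shows "isd_gen (m + (n + 1) + 1) (num (phases ! j))"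
  using assms
proof (cases rule: phase_cases)
  case (Reset i)
  have "num (Reset i) = (\<lambda>w. - B)" by (intro ext) simp
  then show ?thesis using Reset by (simp add: phases_nth isd_const)
next
  case (Encode l)
  have "num (Encode l) = (\<lambda>w. 2 ^ l * max ((gs ! l) w) 0)" by (intro ext) simp
  moreover have "isd_gen (m + (n + 1) + 1) (\<lambda>w. 2 ^ l * max ((gs ! l) w) 0)"
    using Encode by (intro isd_mult isd_max isd_const isd_gs)
  ultimately show ?thesis using Encode by (simp add: phases_nth)
next
  case (Sweep i)
  have "num (Sweep i) = (\<lambda>w. T * coded_gap i w)" by (intro ext) simp
  moreover have "isd_gen (m + (n + 1) + 1) (\<lambda>w. T * coded_gap i w)"
    using Sweep by (intro isd_mult isd_const isd_coded_gap)
  ultimately show ?thesis using Sweep by (simp add: phases_nth)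
qed

lemma isd_den:
  assumes "j < J" and u: "isd_gen (m + (n + 1) + 1) u"
  shows "isd_gen (m + (n + 1) + 1) (\<lambda>w. den (phases ! j) (u w) w)"
  using assms(1)
proof (cases rule: phase_cases)
  case (Reset i)
  then show ?thesis by (simp add: phases_nth isd_const)
next
  case (Encode l)
  have "isd_gen (m + (n + 1) + 1) (\<lambda>w. max ((gs ! l) w) 0)" using Encode
    by (intro isd_max isd_const isd_gs)
  then show ?thesis using Encode by (simp add: phases_nth)
next
  case (Sweep i)
  have "isd_gen (m + (n + 1) + 1)
      (\<lambda>w. coded_gap i w + max 0 (w ! (m + i) + B + 1 - T * ((u w)\<^sup>2 * (3 - 2 * u w))) ^ (d + 2))"
    using Sweep u
    by (intro isd_add isd_power isd_max isd_diff isd_mult isd_const isd_nth isd_coded_gap) simp_all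
  then show ?thesis using Sweep by (simp add: phases_nth ramp_def)
qed

lemma coded_gap_nonneg: "0 \<le> coded_gap i w"
  unfolding coded_gap_def by (intro sum_nonneg mult_nonneg_nonneg gap_nonneg) auto

lemma abs_num_div_den_le:
  assumes "j < J" shows "\<bar>num (phases ! j) w / den (phases ! j) u w\<bar> \<le> B + 2 ^ R + T"
  using assms
proof (cases rule: phase_cases)
  case (Reset i)
  have "0 \<le> (2::real) ^ R" by simp
  then show ?thesis using Reset B_pos T_pos by (simp add: phases_nth)
next
  case (Encode l)
  have "\<bar>num (phases ! j) w / den (phases ! j) u w\<bar> \<le> 2 ^ l"
    using Encode by (simp add: phases_nth max_def)
  also have "\<dots> \<le> 2 ^ R" using Encode by (intro power_increasing) auto
  finally show ?thesis using B_pos T_pos by linarith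
next
  case (Sweep i)
  then have "num (phases ! j) w / den (phases ! j) u w =
    sweep_field (\<lambda>_. coded_gap i w) (- B) d T (w ! (m + i)) u"
    by (simp add: phases_nth sweep_field_def)
  moreover have "0 \<le> (2::real) ^ R" by simp
  ultimately show ?thesis
    using sweep_field_bounds[of T "\<lambda>_. coded_gap i w" "w ! (m + i)" "- B" d u]
      T_pos B_pos coded_gap_nonneg[of i w]
    by linarith
qed

lemma coded_gap_eq:
  assumes x: "length x = m" and z: "length z = n + 1" and i: "i < n" and c: "z ! n = real (code R x)"
  shows "coded_gap i (x @ z @ [s]) = gap i (code R x) x (z ! i)"
proof -
  have "max 0 (1 - \<bar>real a - real b\<bar>) = (if a = b then 1 else 0)" for a b :: nat
  proof (cases "a = b")
    case False
    then have "1 \<le> \<bar>int a - int b\<bar>" by linarith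
    then have "1 \<le> \<bar>real a - real b\<bar>" by linarith
    then show ?thesis using False by simp
  qed simp
  moreover have "(x @ z @ [s]) ! (m + n) = z ! n" "(x @ z @ [s]) ! (m + i) = z ! i"
    using x z i by (simp_all add: nth_append)
  ultimately have "coded_gap i (x @ z @ [s]) =
      (\<Sum>b<2 ^ R. (if code R x = b then 1 else 0) * gap i b x (z ! i))"
    by (simp add: coded_gap_def c gap_append[OF i x])
  also have "\<dots> = gap i (code R x) x (z ! i)"
    using code_less[of x] by (simp add: if_distrib[of "\<lambda>r. r * _"] cong: if_cong)
  finally show ?thesis .
qed

definition state :: "real list \<Rightarrow> nat \<Rightarrow> real list" where
  "state x j = map (\<lambda>i. if j \<le> i then 0 else if j \<le> n + R + i then - B else F x ! i) [0..<n] @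
     [real (code (min (j - n) R) x)]"

lemma length_state: "length (state x j) = n + 1"
  by (simp add: state_def)

lemma state_nth:
  "i < n \<Longrightarrow> state x j ! i = (if j \<le> i then 0 else if j \<le> n + R + i then - B else F x ! i)"
  "state x j ! n = real (code (min (j - n) R) x)"
  by (simp_all add: state_def nth_append)

lemma state_0: "state x 0 = replicate (n + 1) 0"
  by (simp add: state_def code_def map_replicate_const replicate_append_same[symmetric]
    del: replicate_append_same)

lemma take_state_J: "length x = m \<Longrightarrow> take n (state x J) = F x"
  using length_F[of x] by (intro nth_equalityI) (auto simp: state_def J_def)

lemma state_Suc_other:
  assumes "j < J" "i < n + 1" "i \<noteq> component (phases ! j)" shows "state x (Suc j) ! i = state x j ! i"
  using assms(1)
proof (cases rule: phase_cases)
  case (Reset i')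
  then show ?thesis using assms by (cases "i = n") (auto simp: phases_nth state_nth)
next
  case (Encode l)
  then show ?thesis using assms by (auto simp: phases_nth state_nth)
next
  case (Sweep i')
  then show ?thesis using assms by (cases "i = n") (auto simp: phases_nth state_nth)
qed

lemma steers_Encode:
  assumes x: "length x = m" and l: "l < R"
  shows "steers (\<lambda>y u. num (Encode l) (x @ z u y) / den (Encode l) (t u) (x @ z u y))
    (real (code l x)) (real (code (Suc l) x))"
proof -
  have "(gs ! l) (x @ w) = (gs ! l) x" for w using gs(1) l x by (intro poly_fun_append[of m]) simp_all
  then have "num (Encode l) (x @ w) / den (Encode l) t (x @ w) = of_bool (0 < (gs ! l) x) * 2 ^ l"
    for t w
    by (simp add: max_def)
  then show ?thesis
    using steers_const[of "of_bool (0 < (gs ! l) x) * 2 ^ l" "real (code l x)"] by (simp add: code_Suc)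
qed

lemma steers_Sweep:
  assumes x: "length x = m" and i: "i < n" and z: "length z = n + 1" "z ! n = real (code R x)"
  shows "steers (\<lambda>y u. num (Sweep i) (x @ z[i := y] @ [s u]) / den (Sweep i) u (x @ z[i := y] @ [s u]))
    (- B) (F x ! i)"
proof -
  have "coded_gap i (x @ z[i := y] @ [s u]) = gap i (code R x) x y"
    "(x @ z[i := y] @ [s u]) ! (m + i) = y" for y u
    using coded_gap_eq[OF x, of "z[i := y]" i "s u"] z i x by (simp_all add: nth_append)
  then have "(\<lambda>y u. num (Sweep i) (x @ z[i := y] @ [s u]) / den (Sweep i) u (x @ z[i := y] @ [s u])) =
      sweep_field (gap i (code R x) x) (- B) d T"
    by (simp add: sweep_field_def fun_eq_iff)
  moreover obtain L k where "sweep (gap i (code R x) x) (- B) (F x ! i) L k d"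
    using sweep_gap[OF i x] by blast
  moreover have "F x ! i - - B + 1 < T" using B[OF x i] by (simp add: T_def)
  ultimately show ?thesis by (simp add: sweep.steers_sweep_field)
qed

lemma steers_phase:
  assumes x: "length x = m" and j: "j < J"
  defines "w y u \<equiv> x @ (state x j)[component (phases ! j) := y] @ [(real j + u) / real J]"
  shows "steers
    (\<lambda>y u. num (phases ! j) (w y u) / den (phases ! j)
      (real J * w y u ! (m + (n + 1)) - real j) (w y u))
    (state x j ! component (phases ! j)) (state x (Suc j) ! component (phases ! j))"
proof -
  have time: "real J * w y u ! (m + (n + 1)) - real j = u" for y u
    using x J_pos by (simp add: w_def nth_append length_state)
  have "steers (\<lambda>y u. num (phases ! j) (w y u) / den (phases ! j) u (w y u))
    (state x j ! component (phases ! j)) (state x (Suc j) ! component (phases ! j))"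
    using j
  proof (cases rule: phase_cases)
    case (Reset i)
    then show ?thesis using steers_const[of "- B" 0] by (simp add: phases_nth state_nth)
  next
    case (Encode l)
    then have "phases ! j = Encode l" "min (j - n) R = l" "min (Suc j - n) R = Suc l"
      by (simp_all add: phases_nth)
    then show ?thesis unfolding w_def using steers_Encode[OF x Encode(2)]
      by (simp add: state_nth del: num.simps den.simps)
  next
    case (Sweep i)
    then have "phases ! j = Sweep i" "min (j - n) R = R" by (simp_all add: phases_nth)
    then show ?thesis unfolding w_def using Sweep steers_Sweep[OF x Sweep(2), of "state x j"]
      by (simp add: state_nth length_state del: num.simps den.simps)
  qed
  then show ?thesis by (simp only: time)
qed

lemma phase_network:
  "phase_network m n 1 J (\<lambda>j. component (phases ! j)) (\<lambda>j. num (phases ! j))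
    (\<lambda>j w. den (phases ! j) (real J * w ! (m + (n + 1)) - real j) w) (B + 2 ^ R + T) state"
proof
  show "component (phases ! j) < n + 1" if "j < J" for j
    using that by (cases rule: phase_cases) (auto simp: phases_nth)
  show "isd_gen (m + (n + 1) + 1) (\<lambda>w. den (phases ! j) (real J * w ! (m + (n + 1)) - real j) w)"
    if "j < J" for j
    by (intro isd_den that isd_diff isd_mult isd_const isd_nth) simp
qed (rule J_pos isd_num abs_num_div_den_le length_state state_0 state_Suc_other steers_phase;
  assumption)+

end

lemma ex_sign_code_network:
  assumes F: "semialg_fun m n F" and bounded: "bounded_fun m n F"
  shows "\<exists>B gs \<C> d. sign_code_network m n F B gs \<C> d"
proof -
  obtain B where B: "\<And>x i. length x = m \<Longrightarrow> i < n \<Longrightarrow> \<bar>F x ! i\<bar> \<le> B" using bounded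
    by (auto simp: bounded_fun_def)
  have "\<exists>\<C>. \<forall>i. i < n \<longrightarrow> isolating_family m (\<lambda>x. F x ! i) (\<C> i)"
    using ex_isolating_family[OF F] by (intro choice) blast
  then obtain \<C> where \<C>: "\<And>i. i < n \<Longrightarrow> isolating_family m (\<lambda>x. F x ! i) (\<C> i)" by blast
  then have fin: "finite (\<C> i)" and pf: "\<forall>cs\<in>\<C> i. poly_funs m cs" if "i < n" for i
    using that by (auto simp: isolating_family_def)
  have "sign_determined m (\<lambda>u v. \<forall>i\<in>{..<n}. \<forall>cs\<in>\<C> i.
      sgn (poly (specialize cs u) (F u ! i)) = sgn (poly (specialize cs v) (F v ! i)))"
    using fin pf by (intro sign_determined_ball sign_determined_sgn_component[OF F]) auto
  then obtain gs where gs: "gs \<noteq> []" "poly_funs m gs"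
    and determined: "\<And>u v. length u = m \<Longrightarrow> length v = m \<Longrightarrow> \<forall>g\<in>set gs. 0 < g u \<longleftrightarrow> 0 < g v \<Longrightarrow>
      \<forall>i\<in>{..<n}. \<forall>cs\<in>\<C> i.
        sgn (poly (specialize cs u) (F u ! i)) = sgn (poly (specialize cs v) (F v ! i))"
    by (rule sign_determinedE_positivity) blast
  define d where "d = 1 + (\<Sum>i<n. \<Sum>cs\<in>\<C> i. length cs)"
  have "sign_code_network m n F (\<bar>B\<bar> + 1) gs \<C> d"
  proof
    show "length (F x) = n" if "length x = m" for x using semialg_fun_length[OF F that] .
    show "\<bar>F x ! i\<bar> < \<bar>B\<bar> + 1" if "length x = m" "i < n" for x i using B[OF that] by simp
    show "gs \<noteq> []" "poly_funs m gs" by (fact gs)+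
    show "sgn (poly (specialize cs u) (F u ! i)) = sgn (poly (specialize cs v) (F v ! i))"
      if "length u = m" "length v = m" "\<forall>g\<in>set gs. 0 < g u \<longleftrightarrow> 0 < g v" "i < n" "cs \<in> \<C> i" for u v i cs
      using determined[OF that(1-3)] that(4,5) by blast
    show "length cs \<le> Suc d" if "i < n" "cs \<in> \<C> i" for i cs
    proof -
      have "length cs \<le> (\<Sum>cs\<in>\<C> i. length cs)" using that fin by (intro member_le_sum) auto
      also have "\<dots> \<le> (\<Sum>i<n. \<Sum>cs\<in>\<C> i. length cs)" using that by (intro member_le_sum) auto
      finally show ?thesis by (simp add: d_def)
    qed
  qed (simp_all add: \<C> d_def)
  then show ?thesis by blast
qed

theorem mainTheorem6:
  fixes m n :: nat and F :: "real list \<Rightarrow> real list"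
  assumes "semialg_fun m n F" and "bounded_fun m n F"
  shows "\<exists>Mf bf (cmax::real). ISDnet m n 1 Mf bf \<and> cmax \<ge> 0 \<and>
           (\<forall>x. length x = m \<longrightarrow> SANN_lim_eq m n 1 Mf bf x cmax (F x))"
proof -
  obtain B gs \<C> d where "sign_code_network m n F B gs \<C> d" using ex_sign_code_network[OF assms] by blast
  then interpret sign_code_network m n F B gs \<C> d .
  interpret net: phase_network m n 1 J "\<lambda>j. component (phases ! j)" "\<lambda>j. num (phases ! j)"
    "\<lambda>j w. den (phases ! j) (real J * w ! (m + (n + 1)) - real j) w" "B + 2 ^ R + T" state
    by (rule phase_network)
  show ?thesis
  proof (intro exI conjI allI impI)
    show "ISDnet m n 1 (\<lambda>i j w. scalar_mat (net.diag w) i j) net.rhs" by (rule net.ISDnet)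
    show "0 \<le> net.cmax" by (rule net.cmax_nonneg)
    show "SANN_lim_eq m n 1 (\<lambda>i j w. scalar_mat (net.diag w) i j) net.rhs x net.cmax (F x)"
      if "length x = m" for x
      using net.SANN_lim_eq[OF that] take_state_J[OF that] by simp
  qed
qed

end
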